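(* The following are equivalent: (1) The sets $\mathrm{Fix}_k(\sigma)^\circ$ are closed in $X$ for all $k\in\mathbb{Z}$. (2) There exists a norm one projection from $C^*(\Sigma)$ onto $C(X)'_*$. (3) There exists a positive projection from $C^*(\Sigma)$ onto $C(X)'_*$. In that case a projection as in (2) or (3) is unique. Denoting it by $E'$ and denoting by $\chi_k\in C(X)$ the (continuous) characteristic function of $\mathrm{Fix}_k(\sigma)^\circ$, it is given on $c_{00}(\Sigma)$ by $E'\big(\sum_kf_k\delta^k\big)=\sum_k\chi_kf_k\delta^k$ for $\sum_kf_k\delta^k\in c_{00}(\Sigma)$. Furthermore, $E'$ is a faithful positive norm one projection, is a morphism of $C(X)'_*$-bimodules, and restricts to a projection from $c_{00}(\Sigma)$ onto $C(X)'_{00}$.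
   Context: Let $X$ be a non-empty compact Hausdorff space and $\sigma:X\to X$ a homeomorphism; $\mathrm{Fix}_k(\sigma)=\{x:\sigma^kx=x\}$ and superscript $\circ$ denotes interior. $C(X)$ is the algebra of continuous complex functions with sup norm, $\alpha(f)=f\circ\sigma^{-1}$. $\ell^1(\Sigma)$ is the set of $\ell:\mathbb{Z}\to C(X)$ with $\|\ell\|=\sum_k\|\ell(k)\|_\infty<\infty$, product $(\ell\ell')(n)=\sum_k\ell(k)\alpha^k(\ell'(n-k))$, involution $\ell^*(n)=\overline{\alpha^n(\ell(-n))}$; with $\delta$ the element equal to the constant $1$ at $1\in\mathbb{Z}$ and $0$ elsewhere, elements are written $\sum_kf_k\delta^k$ ($f_k=\ell(k)$), and $C(X)$ is embedded as $\{f\delta^0\}$. $c_{00}(\Sigma)$ is the dense $*$-subalgebra of finite sums. $C^*(\Sigma)$ is the enveloping $C^*$-algebra of $\ell^1(\Sigma)$, containing $\ell^1(\Sigma)$ densely. $C(X)'_*$ and $C(X)'_{00}$ are the commutants of $C(X)$ in $C^*(\Sigma)$ and in $c_{00}(\Sigma)$. A projection onto a subalgebra is a linear idempotent map with that range; a positive map is faithful if it vanishes on no non-zero positive element. *)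

theory Defs
  imports "HOL-Analysis.Analysis"
begin

definition spow :: "('a \<Rightarrow> 'a) \<Rightarrow> int \<Rightarrow> 'a \<Rightarrow> 'a" where
  "spow \<sigma> k = (if 0 \<le> k then \<sigma> ^^ nat k else inv \<sigma> ^^ nat (- k))"

definition Fix :: "('a \<Rightarrow> 'a) \<Rightarrow> int \<Rightarrow> 'a set" where
  "Fix \<sigma> k = {x. spow \<sigma> k x = x}"

definition CX :: "('a::topological_space \<Rightarrow> complex) set" where
  "CX = {f. continuous_on UNIV f}"

definition supn :: "('a \<Rightarrow> complex) \<Rightarrow> real" where
  "supn f = Sup (range (\<lambda>x. cmod (f x)))"

text \<open>An element is a map from the integers to functions on X; l k is the coefficient f_k.\<close>
type_synonym 'a l1 = "int \<Rightarrow> 'a \<Rightarrow> complex"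

definition l1 :: "('a::topological_space \<Rightarrow> 'a) \<Rightarrow> 'a l1 set" where
  "l1 \<sigma> = {l. (\<forall>k. l k \<in> CX) \<and> (\<lambda>k. supn (l k)) summable_on UNIV}"

definition l1_norm :: "'a l1 \<Rightarrow> real" where
  "l1_norm l = infsum (\<lambda>k. supn (l k)) UNIV"

definition l1_add :: "'a l1 \<Rightarrow> 'a l1 \<Rightarrow> 'a l1" where
  "l1_add l m = (\<lambda>k x. l k x + m k x)"

definition l1_smult :: "complex \<Rightarrow> 'a l1 \<Rightarrow> 'a l1" where
  "l1_smult c l = (\<lambda>k x. c * l k x)"

definition l1_diff :: "'a l1 \<Rightarrow> 'a l1 \<Rightarrow> 'a l1" where
  "l1_diff l m = (\<lambda>k x. l k x - m k x)"

text \<open>(l l')(n) = sum_k l(k) alpha^k(l'(n-k)), with alpha^k(f) = f o sigma^(-k).\<close>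
definition l1_mult :: "('a \<Rightarrow> 'a) \<Rightarrow> 'a l1 \<Rightarrow> 'a l1 \<Rightarrow> 'a l1" where
  "l1_mult \<sigma> l m = (\<lambda>n x. infsum (\<lambda>k. l k x * m (n - k) (spow \<sigma> (- k) x)) UNIV)"

definition l1_star :: "('a \<Rightarrow> 'a) \<Rightarrow> 'a l1 \<Rightarrow> 'a l1" where
  "l1_star \<sigma> l = (\<lambda>n x. cnj (l (- n) (spow \<sigma> (- n) x)))"

text \<open>f delta^0: the embedding of C(X); the unit is 1 delta^0.\<close>
definition coef0 :: "('a \<Rightarrow> complex) \<Rightarrow> 'a l1" where
  "coef0 f = (\<lambda>k x. if k = 0 then f x else 0)"

definition c00 :: "('a::topological_space \<Rightarrow> 'a) \<Rightarrow> 'a l1 set" where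
  "c00 \<sigma> = {l \<in> l1 \<sigma>. finite {k. l k \<noteq> (\<lambda>x. 0)}}"

definition comm00 :: "('a::topological_space \<Rightarrow> 'a) \<Rightarrow> 'a l1 set" where
  "comm00 \<sigma> = {l \<in> c00 \<sigma>. \<forall>f \<in> CX. l1_mult \<sigma> l (coef0 f) = l1_mult \<sigma> (coef0 f) l}"

definition l1_state :: "('a::topological_space \<Rightarrow> 'a) \<Rightarrow> ('a l1 \<Rightarrow> complex) \<Rightarrow> bool" where
  "l1_state \<sigma> \<phi> \<longleftrightarrow>
     (\<forall>a \<in> l1 \<sigma>. \<forall>b \<in> l1 \<sigma>. \<phi> (l1_add a b) = \<phi> a + \<phi> b) \<and>
     (\<forall>c. \<forall>a \<in> l1 \<sigma>. \<phi> (l1_smult c a) = c * \<phi> a) \<and>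
     (\<forall>a \<in> l1 \<sigma>. Im (\<phi> (l1_mult \<sigma> (l1_star \<sigma> a) a)) = 0 \<and>
                 0 \<le> Re (\<phi> (l1_mult \<sigma> (l1_star \<sigma> a) a))) \<and>
     \<phi> (coef0 (\<lambda>x. 1)) = 1"

text \<open>The enveloping C*-(semi)norm: the supremum of the norms in all *-representations,
  computed via states (GNS): ||a||^2 = sup over states phi of phi(a* a).\<close>
definition cs_norm :: "('a::topological_space \<Rightarrow> 'a) \<Rightarrow> 'a l1 \<Rightarrow> real" where
  "cs_norm \<sigma> a = sqrt (Sup {Re (\<phi> (l1_mult \<sigma> (l1_star \<sigma> a) a)) | \<phi>. l1_state \<sigma> \<phi>})"

text \<open>C*(Sigma) is the completion of l1(Sigma) w.r.t. cs_norm: classes of Cauchy sequences.\<close>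
definition cs_seq :: "('a::topological_space \<Rightarrow> 'a) \<Rightarrow> (nat \<Rightarrow> 'a l1) \<Rightarrow> bool" where
  "cs_seq \<sigma> s \<longleftrightarrow> (\<forall>n. s n \<in> l1 \<sigma>) \<and>
     (\<forall>e>0. \<exists>N. \<forall>m\<ge>N. \<forall>n\<ge>N. cs_norm \<sigma> (l1_diff (s m) (s n)) < e)"

definition cs_class :: "('a::topological_space \<Rightarrow> 'a) \<Rightarrow> (nat \<Rightarrow> 'a l1) \<Rightarrow> (nat \<Rightarrow> 'a l1) set" where
  "cs_class \<sigma> s = {t. cs_seq \<sigma> t \<and> (\<lambda>n. cs_norm \<sigma> (l1_diff (t n) (s n))) \<longlonglongrightarrow> 0}"

type_synonym 'a cstar = "(nat \<Rightarrow> 'a l1) set"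

definition Cstar :: "('a::topological_space \<Rightarrow> 'a) \<Rightarrow> 'a cstar set" where
  "Cstar \<sigma> = cs_class \<sigma> ` {s. cs_seq \<sigma> s}"

definition rep :: "'a cstar \<Rightarrow> nat \<Rightarrow> 'a l1" where
  "rep A = (SOME s. s \<in> A)"

definition emb :: "('a::topological_space \<Rightarrow> 'a) \<Rightarrow> 'a l1 \<Rightarrow> 'a cstar" where
  "emb \<sigma> l = cs_class \<sigma> (\<lambda>n. l)"

definition cadd :: "('a::topological_space \<Rightarrow> 'a) \<Rightarrow> 'a cstar \<Rightarrow> 'a cstar \<Rightarrow> 'a cstar" where
  "cadd \<sigma> A B = cs_class \<sigma> (\<lambda>n. l1_add (rep A n) (rep B n))"

definition csmult :: "('a::topological_space \<Rightarrow> 'a) \<Rightarrow> complex \<Rightarrow> 'a cstar \<Rightarrow> 'a cstar" where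
  "csmult \<sigma> c A = cs_class \<sigma> (\<lambda>n. l1_smult c (rep A n))"

definition cmul :: "('a::topological_space \<Rightarrow> 'a) \<Rightarrow> 'a cstar \<Rightarrow> 'a cstar \<Rightarrow> 'a cstar" where
  "cmul \<sigma> A B = cs_class \<sigma> (\<lambda>n. l1_mult \<sigma> (rep A n) (rep B n))"

definition cstar_inv :: "('a::topological_space \<Rightarrow> 'a) \<Rightarrow> 'a cstar \<Rightarrow> 'a cstar" where
  "cstar_inv \<sigma> A = cs_class \<sigma> (\<lambda>n. l1_star \<sigma> (rep A n))"

definition cnorm :: "('a::topological_space \<Rightarrow> 'a) \<Rightarrow> 'a cstar \<Rightarrow> real" where
  "cnorm \<sigma> A = lim (\<lambda>n. cs_norm \<sigma> (rep A n))"

definition czero :: "('a::topological_space \<Rightarrow> 'a) \<Rightarrow> 'a cstar" where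
  "czero \<sigma> = emb \<sigma> (\<lambda>k x. 0)"

definition cpos :: "('a::topological_space \<Rightarrow> 'a) \<Rightarrow> 'a cstar \<Rightarrow> bool" where
  "cpos \<sigma> A \<longleftrightarrow> (\<exists>B \<in> Cstar \<sigma>. A = cmul \<sigma> (cstar_inv \<sigma> B) B)"

definition CX_in :: "('a::topological_space \<Rightarrow> 'a) \<Rightarrow> 'a cstar set" where
  "CX_in \<sigma> = (\<lambda>f. emb \<sigma> (coef0 f)) ` CX"

definition comm_star :: "('a::topological_space \<Rightarrow> 'a) \<Rightarrow> 'a cstar set" where
  "comm_star \<sigma> = {A \<in> Cstar \<sigma>. \<forall>F \<in> CX_in \<sigma>. cmul \<sigma> A F = cmul \<sigma> F A}"

definition is_proj_onto :: "('a::topological_space \<Rightarrow> 'a) \<Rightarrow> ('a cstar \<Rightarrow> 'a cstar) \<Rightarrow> 'a cstar set \<Rightarrow> bool" where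
  "is_proj_onto \<sigma> E S \<longleftrightarrow>
     (\<forall>A \<in> Cstar \<sigma>. \<forall>B \<in> Cstar \<sigma>. E (cadd \<sigma> A B) = cadd \<sigma> (E A) (E B)) \<and>
     (\<forall>c. \<forall>A \<in> Cstar \<sigma>. E (csmult \<sigma> c A) = csmult \<sigma> c (E A)) \<and>
     (\<forall>A \<in> Cstar \<sigma>. E (E A) = E A) \<and>
     E ` Cstar \<sigma> = S"

definition norm_one :: "('a::topological_space \<Rightarrow> 'a) \<Rightarrow> ('a cstar \<Rightarrow> 'a cstar) \<Rightarrow> bool" where
  "norm_one \<sigma> E \<longleftrightarrow>
     (\<forall>A \<in> Cstar \<sigma>. cnorm \<sigma> A \<le> 1 \<longrightarrow> cnorm \<sigma> (E A) \<le> 1) \<and>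
     (\<forall>e>0. \<exists>A \<in> Cstar \<sigma>. cnorm \<sigma> A \<le> 1 \<and> cnorm \<sigma> (E A) > 1 - e)"

definition positive_map :: "('a::topological_space \<Rightarrow> 'a) \<Rightarrow> ('a cstar \<Rightarrow> 'a cstar) \<Rightarrow> bool" where
  "positive_map \<sigma> E \<longleftrightarrow> (\<forall>A \<in> Cstar \<sigma>. cpos \<sigma> A \<longrightarrow> cpos \<sigma> (E A))"

definition faithful_map :: "('a::topological_space \<Rightarrow> 'a) \<Rightarrow> ('a cstar \<Rightarrow> 'a cstar) \<Rightarrow> bool" where
  "faithful_map \<sigma> E \<longleftrightarrow> (\<forall>A \<in> Cstar \<sigma>. cpos \<sigma> A \<and> E A = czero \<sigma> \<longrightarrow> A = czero \<sigma>)"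

definition bimodule_map :: "('a::topological_space \<Rightarrow> 'a) \<Rightarrow> ('a cstar \<Rightarrow> 'a cstar) \<Rightarrow> 'a cstar set \<Rightarrow> bool" where
  "bimodule_map \<sigma> E S \<longleftrightarrow>
     (\<forall>A \<in> S. \<forall>B \<in> S. \<forall>Y \<in> Cstar \<sigma>. E (cmul \<sigma> (cmul \<sigma> A Y) B) = cmul \<sigma> (cmul \<sigma> A (E Y)) B)"

definition chi :: "('a::topological_space \<Rightarrow> 'a) \<Rightarrow> int \<Rightarrow> 'a \<Rightarrow> complex" where
  "chi \<sigma> k x = (if x \<in> interior (Fix \<sigma> k) then 1 else 0)"

end

theory Submission
  imports Defs
begin

text \<open>
  Every positive functional on the l1-algebra is bounded, because 1 - x has a square root there when
  x is self-adjoint of norm at most 1; hence the seminorm given by states is a C*-seminorm, and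
  Fejer means show that an element of the completion is determined by its Fourier coefficients.
  An element lies in the commutant of C(X) iff its n-th coefficient is supported on Fix n, which by
  continuity is the interior of Fix n.

  Let E be a positive or norm one projection onto the commutant, and let x be in Fix n. Composing E
  with the functionals in the span of the vectors e_0 and e_(-n) of the regular representation over
  the orbit of x gives positive functionals that vanish on |f - f(x)|^2 for f in C(X), so by
  Cauchy-Schwarz the n-th coefficient of E at x is a C(X)-bimodule map. This forces the coefficients
  of E(f delta^k) to be those of chi_k f delta^k, so chi_k is continuous and E is unique.

  Conversely, if all chi_k are continuous, then the kernel chi_(j-i) is positive definite, since
  "x is in the interior of Fix (j-i)" is an equivalence relation between i and j. So multiplication
  of coefficients by chi_k maps squares to sums of squares and extends to the required expectation.
\<close>

section \<open>The Banach *-algebra of the system\<close>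

text \<open>The completion is seen only through functionals that are Lipschitz for
  \<open>cs_norm\<close>: positive functionals and Fourier coefficients. Three obstacles shape the
  argument. A positive projection is not assumed bounded, yet its formula must pass from finite sums
  to limits; its composition with a positive functional is bounded because 1 - h has a square root
  in the completion. Such roots are built along representing sequences and need a rate of
  convergence uniform in h, hence an iteration with a scalar majorant rather than a bare existence
  statement. Next, \<open>cpos\<close> asks for a single square, so what multiplication by
  \<open>chi\<close> makes of a square has to be rewritten as one square, again by such a root.
  Finally, the classical theorem that norm one projections are bimodule maps (Tomiyama) is bypassed:
  only a C(X)-module property at one point and one coefficient is extracted from E, and the bimodule
  property over the commutant is read off the explicit expectation with which E is then
  identified.\<close>

definition fdelta :: "('a \<Rightarrow> complex) \<Rightarrow> int \<Rightarrow> 'a l1" where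
  "fdelta f k = (\<lambda>n x. if n = k then f x else 0)"

lemma coef0_eq_fdelta: "coef0 f = fdelta f 0"
  by (simp add: coef0_def fdelta_def)

text \<open>The shear (n, k) to (k, n - k) is a bijection of the integer lattice and turns the
  convolution series into the product series. This is where submultiplicativity of
  \<open>l1_norm\<close> comes from.\<close>

lemma summable_on_convolution:
  fixes A B :: "int \<Rightarrow> real"
  assumes A: "A summable_on UNIV" "\<And>k. A k \<ge> 0" and B: "B summable_on UNIV" "\<And>k. B k \<ge> 0"
  shows "(\<lambda>(n,k). A k * B (n - k)) summable_on (UNIV \<times> UNIV)"
    and "infsum (\<lambda>n. infsum (\<lambda>k. A k * B (n - k)) UNIV) UNIV = infsum A UNIV * infsum B UNIV"
proof -
  have 1: "(\<lambda>(k,m). A k * B m) summable_on (UNIV \<times> UNIV)"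
  proof (rule summable_on_SigmaI)
    show "((\<lambda>y. case (k, y) of (k, m) \<Rightarrow> A k * B m) has_sum A k * infsum B UNIV) UNIV" for k
      using has_sum_cmult_right[OF has_sum_infsum[OF B(1)]] by simp
    show "(\<lambda>k. A k * infsum B UNIV) summable_on UNIV"
      using A(1) by (rule summable_on_cmult_left)
  qed (use A B in auto)
  have "(\<lambda>(n,k). A k * B (n - k)) summable_on (UNIV \<times> UNIV)
      \<longleftrightarrow> (\<lambda>(k,m). A k * B m) summable_on (UNIV \<times> UNIV)"
    by (rule summable_on_reindex_bij_witness[of _ "\<lambda>(k,m). (k+m,k)" "\<lambda>(n,k). (k,n-k)"]) auto
  with 1 show 2: "(\<lambda>(n,k). A k * B (n - k)) summable_on (UNIV \<times> UNIV)" by simp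
  have "infsum (\<lambda>n. infsum (\<lambda>k. A k * B (n - k)) UNIV) UNIV
      = infsum (\<lambda>(n,k). A k * B (n - k)) (UNIV \<times> UNIV)"
    using infsum_Sigma_banach[OF 2] by simp
  also have "\<dots> = infsum (\<lambda>(k,m). A k * B m) (UNIV \<times> UNIV)"
    by (rule infsum_reindex_bij_witness[of _ "\<lambda>(k,m). (k+m,k)" "\<lambda>(n,k). (k,n-k)"]) auto
  also have "\<dots> = infsum (\<lambda>k. infsum (\<lambda>m. A k * B m) UNIV) UNIV"
    using infsum_Sigma_banach[OF 1] by simp
  also have "\<dots> = infsum A UNIV * infsum B UNIV"
    by (simp add: infsum_cmult_right' infsum_cmult_left')
  finally show "infsum (\<lambda>n. infsum (\<lambda>k. A k * B (n - k)) UNIV) UNIV = infsum A UNIV * infsum B UNIV" .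
qed

lemma summable_on_convolution_row:
  fixes A B :: "int \<Rightarrow> real"
  assumes A: "A summable_on UNIV" "\<And>k. A k \<ge> 0" and B: "B summable_on UNIV" "\<And>k. B k \<ge> 0"
  shows "(\<lambda>k. A k * B (n - k)) summable_on UNIV"
    and "(\<lambda>n. infsum (\<lambda>k. A k * B (n - k)) UNIV) summable_on UNIV"
proof -
  note s = summable_on_convolution(1)[OF assms]
  show "(\<lambda>k. A k * B (n - k)) summable_on UNIV"
    using summable_on_SigmaD1[of "\<lambda>n k. A k * B (n - k)", OF s, of n] by simp
  show "(\<lambda>n. infsum (\<lambda>k. A k * B (n - k)) UNIV) summable_on UNIV"
    using summable_on_Sigma_banach[OF s] by simp
qed

text \<open>The space X is the whole type \<open>'a\<close>, hence non-empty. The homeomorphism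
  hypothesis names \<open>inv \<sigma>\<close> as the continuous inverse, so the negative powers in
  \<open>spow\<close> are genuine inverses.\<close>

locale dynamical_system =
  fixes \<sigma> :: "'a::t2_space \<Rightarrow> 'a"
  assumes compact_space: "compact (UNIV :: 'a set)"
    and homeo: "homeomorphism UNIV UNIV \<sigma> (inv \<sigma>)"
begin

abbreviation "L \<equiv> l1 \<sigma>"
abbreviation "tr \<equiv> spow \<sigma>"
abbreviation mul (infixl \<open>\<otimes>\<close> 70) where "a \<otimes> b \<equiv> l1_mult \<sigma> a b"
abbreviation add (infixl \<open>\<oplus>\<close> 65) where "a \<oplus> b \<equiv> l1_add a b"
abbreviation diff (infixl \<open>\<ominus>\<close> 65) where "a \<ominus> b \<equiv> l1_diff a b"
abbreviation smult (infixr \<open>\<odot>\<close> 75) where "c \<odot> a \<equiv> l1_smult c a"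
abbreviation star (\<open>_\<dagger>\<close> [1000] 999) where "a\<dagger> \<equiv> l1_star \<sigma> a"
abbreviation one (\<open>\<e>\<close>) where "\<e> \<equiv> coef0 (\<lambda>x. 1)"

subsection \<open>Iterates and continuous functions\<close>

lemma inv_sigma [simp]: "\<sigma> (inv \<sigma> x) = x" "inv \<sigma> (\<sigma> x) = x"
  using homeo by (auto simp: homeomorphism_def)

lemma spow_0 [simp]: "tr 0 x = x"
  by (simp add: spow_def)

lemma spow_succ: "tr (k + 1) x = \<sigma> (tr k x)"
proof (cases "0 \<le> k")
  case True
  then have "nat (k + 1) = Suc (nat k)" by simp
  with True show ?thesis by (simp add: spow_def)
next
  case False
  then have *: "nat (- k) = Suc (nat (- (k + 1)))" by simp
  show ?thesis
  proof (cases "k + 1 = 0")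
    case True
    then have "k = - 1" by simp
    then show ?thesis by (simp add: spow_def)
  next
    case False
    with \<open>\<not> 0 \<le> k\<close> have "\<not> 0 \<le> k + 1" by simp
    with \<open>\<not> 0 \<le> k\<close> * show ?thesis by (simp add: spow_def)
  qed
qed

lemma spow_pred: "tr (k - 1) x = inv \<sigma> (tr k x)"
  using spow_succ[of "k - 1" x] by simp

lemma spow_add: "tr (j + k) x = tr j (tr k x)"
proof (induction j rule: int_induct[where k = 0])
  case (step1 i)
  then show ?case using spow_succ[of "i + k" x] spow_succ[of i "tr k x"] by (simp add: algebra_simps)
next
  case (step2 i)
  then show ?case using spow_pred[of "i + k" x] spow_pred[of i "tr k x"] by (simp add: algebra_simps)
qed simp

lemma spow_spow [simp]: "tr j (tr k x) = tr (j + k) x"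
  by (simp add: spow_add)

lemma continuous_spow: "continuous_on UNIV (tr k)"
proof (induction k rule: int_induct[where k = 0])
  case base
  show ?case by (simp add: spow_def)
next
  case (step1 i)
  have "continuous_on UNIV (\<lambda>x. \<sigma> (tr i x))"
    using homeo step1 by (auto intro!: continuous_on_compose2[of UNIV \<sigma>] simp: homeomorphism_def)
  then show ?case using spow_succ[of i] by (simp add: fun_eq_iff cong: continuous_on_cong)
next
  case (step2 i)
  have "continuous_on UNIV (\<lambda>x. inv \<sigma> (tr i x))"
    using homeo step2 by (auto intro!: continuous_on_compose2[of UNIV "inv \<sigma>"] simp: homeomorphism_def)
  then show ?case using spow_pred[of i] by (simp add: fun_eq_iff cong: continuous_on_cong)
qed

lemma CX_const [simp]: "(\<lambda>x. c) \<in> CX" by (simp add: CX_def)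

lemma CX_add: "f \<in> CX \<Longrightarrow> g \<in> CX \<Longrightarrow> (\<lambda>x. f x + g x) \<in> CX"
  and CX_diff: "f \<in> CX \<Longrightarrow> g \<in> CX \<Longrightarrow> (\<lambda>x. f x - g x) \<in> CX"
  and CX_mult: "f \<in> CX \<Longrightarrow> g \<in> CX \<Longrightarrow> (\<lambda>x. f x * g x) \<in> CX"
  and CX_cnj: "f \<in> CX \<Longrightarrow> (\<lambda>x. cnj (f x)) \<in> CX"
  by (auto simp: CX_def intro!: continuous_intros)

lemma CX_spow: "f \<in> CX \<Longrightarrow> (\<lambda>x. f (tr k x)) \<in> CX"
  using continuous_spow[of k] by (auto simp: CX_def intro: continuous_on_compose2)

lemma bdd_CX:
  fixes f :: "'a \<Rightarrow> complex"
  assumes "f \<in> CX"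
  shows "bdd_above (range (\<lambda>x. cmod (f x)))"
proof -
  from assms
  have "compact (range (\<lambda>x. cmod (f x)))"
    unfolding CX_def mem_Collect_eq by (rule compact_continuous_image[OF continuous_on_norm compact_space])
  then show ?thesis by (simp add: bounded_imp_bdd_above compact_imp_bounded)
qed

lemma cmod_le_supn: "(f :: 'a \<Rightarrow> complex) \<in> CX \<Longrightarrow> cmod (f x) \<le> supn f"
  unfolding supn_def by (rule cSUP_upper[OF _ bdd_CX]) simp_all

lemma supn_least: "(\<And>x. cmod (f x) \<le> M) \<Longrightarrow> supn f \<le> M"
  unfolding supn_def by (rule cSUP_least) simp_all

lemma supn_nonneg [simp]: "(f :: 'a \<Rightarrow> complex) \<in> CX \<Longrightarrow> 0 \<le> supn f"
  using cmod_le_supn[of f undefined] norm_ge_zero[of "f undefined"] by linarith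

subsection \<open>Membership and norm\<close>

lemma l1_CX: "a \<in> L \<Longrightarrow> a k \<in> CX"
  and l1_summable: "a \<in> L \<Longrightarrow> (\<lambda>k. supn (a k)) summable_on UNIV"
  by (auto simp: l1_def)

text \<open>A summable pointwise majorant yields membership and the norm bound at once; the closure
  properties of \<open>L\<close> below are all obtained by exhibiting one.\<close>

lemma l1_dominated:
  assumes "\<And>k. a k \<in> CX" "b summable_on UNIV" "\<And>k x. cmod (a k x) \<le> b k"
  shows "a \<in> L" "l1_norm a \<le> infsum b UNIV"
proof -
  have 1: "supn (a k) \<le> b k" for k using assms(3) by (rule supn_least)
  have 2: "(\<lambda>k. supn (a k)) summable_on UNIV"
    by (rule summable_on_comparison_test[OF assms(2)]) (use 1 assms(1) in auto)
  show "a \<in> L" using 2 assms(1) by (simp add: l1_def)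
  show "l1_norm a \<le> infsum b UNIV"
    unfolding l1_norm_def by (rule infsum_mono[OF 2 assms(2)]) (rule 1)
qed

lemma supn_le_l1_norm: "a \<in> L \<Longrightarrow> supn (a k) \<le> l1_norm a"
  using finite_sum_le_infsum[OF l1_summable, of a "{k}"] l1_CX[of a] by (simp add: l1_norm_def)

lemma l1_norm_nonneg [simp]: "a \<in> L \<Longrightarrow> 0 \<le> l1_norm a"
  unfolding l1_norm_def using l1_CX[of a] by (intro infsum_nonneg) simp

lemma cmod_le_l1_norm: "a \<in> L \<Longrightarrow> cmod (a k x) \<le> l1_norm a"
  using cmod_le_supn[OF l1_CX, of a k x] supn_le_l1_norm[of a k] by linarith

lemma l1_zero [simp]: "(\<lambda>k x. 0) \<in> L" "l1_norm (\<lambda>k x. 0) = 0"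
  by (simp_all add: l1_def l1_norm_def supn_def)

lemma l1_norm_eq_0: "a \<in> L \<Longrightarrow> l1_norm a \<le> 0 \<Longrightarrow> a = (\<lambda>k x. 0)"
  using cmod_le_l1_norm[of a] by (metis (no_types, lifting) ext norm_le_zero_iff order_trans)

lemma l1_add [simp]: "a \<in> L \<Longrightarrow> b \<in> L \<Longrightarrow> a \<oplus> b \<in> L"
  and l1_norm_add: "a \<in> L \<Longrightarrow> b \<in> L \<Longrightarrow> l1_norm (a \<oplus> b) \<le> l1_norm a + l1_norm b"
proof -
  assume a: "a \<in> L" and b: "b \<in> L"
  have s: "(\<lambda>k. supn (a k) + supn (b k)) summable_on UNIV"
    using a b by (intro summable_on_add l1_summable)
  have d: "cmod ((a \<oplus> b) k x) \<le> supn (a k) + supn (b k)" for k x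
    unfolding l1_add_def using cmod_le_supn[OF l1_CX[OF a], of k x] cmod_le_supn[OF l1_CX[OF b], of k x]
    by (intro norm_triangle_mono) auto
  have c: "(a \<oplus> b) k \<in> CX" for k
    unfolding l1_add_def using a b by (intro CX_add l1_CX)
  show "a \<oplus> b \<in> L" by (rule l1_dominated(1)[OF c s d])
  show "l1_norm (a \<oplus> b) \<le> l1_norm a + l1_norm b"
    using l1_dominated(2)[OF c s d] infsum_add[OF l1_summable[OF a] l1_summable[OF b]]
    by (simp add: l1_norm_def)
qed

lemma l1_smult [simp]: "a \<in> L \<Longrightarrow> c \<odot> a \<in> L"
  and l1_norm_smult_le: "a \<in> L \<Longrightarrow> l1_norm (c \<odot> a) \<le> cmod c * l1_norm a"
proof -
  assume a: "a \<in> L"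
  have s: "(\<lambda>k. cmod c * supn (a k)) summable_on UNIV"
    using a by (intro summable_on_cmult_right l1_summable)
  have d: "cmod ((c \<odot> a) k x) \<le> cmod c * supn (a k)" for k x
    unfolding l1_smult_def using cmod_le_supn[OF l1_CX[OF a], of k x]
    by (simp add: norm_mult mult_left_mono)
  have c: "(c \<odot> a) k \<in> CX" for k
    unfolding l1_smult_def using a by (intro CX_mult l1_CX CX_const)
  show "c \<odot> a \<in> L" by (rule l1_dominated(1)[OF c s d])
  show "l1_norm (c \<odot> a) \<le> cmod c * l1_norm a"
    using l1_dominated(2)[OF c s d] by (simp add: l1_norm_def infsum_cmult_right')
qed

lemma diff_conv: "a \<ominus> b = a \<oplus> (- 1) \<odot> b"
  by (simp add: l1_diff_def l1_add_def l1_smult_def)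

lemma l1_diff [simp]: "a \<in> L \<Longrightarrow> b \<in> L \<Longrightarrow> a \<ominus> b \<in> L"
  by (simp add: diff_conv)

lemma l1_norm_diff: "a \<in> L \<Longrightarrow> b \<in> L \<Longrightarrow> l1_norm (a \<ominus> b) \<le> l1_norm a + l1_norm b"
  using l1_norm_add[of a "(- 1) \<odot> b"] l1_norm_smult_le[of b "- 1"] by (simp add: diff_conv)

lemma l1_fdelta [simp]: "f \<in> CX \<Longrightarrow> fdelta f k \<in> L"
  and l1_norm_fdelta: "f \<in> CX \<Longrightarrow> l1_norm (fdelta f k) \<le> supn f"
proof -
  assume f: "f \<in> CX"
  let ?b = "\<lambda>n. if n = k then supn f else 0"
  have s: "?b summable_on UNIV"
    by (rule finite_nonzero_values_imp_summable_on) auto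
  have c: "fdelta f k n \<in> CX" for n using f by (cases "n = k") (simp_all add: fdelta_def)
  have d: "cmod (fdelta f k n x) \<le> ?b n" for n x
    using cmod_le_supn[OF f] by (simp add: fdelta_def)
  show "fdelta f k \<in> L" by (rule l1_dominated(1)[OF c s d])
  have "infsum ?b UNIV = infsum ?b {k}" by (rule infsum_cong_neutral) auto
  then show "l1_norm (fdelta f k) \<le> supn f"
    using l1_dominated(2)[OF c s d] by simp
qed

lemma l1_coef0 [simp]: "f \<in> CX \<Longrightarrow> coef0 f \<in> L"
  by (simp add: coef0_eq_fdelta)

lemma l1_star [simp]: "a \<in> L \<Longrightarrow> a\<dagger> \<in> L"
  and l1_norm_star_le: "a \<in> L \<Longrightarrow> l1_norm (a\<dagger>) \<le> l1_norm a"
proof -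
  assume a: "a \<in> L"
  have eq: "(\<lambda>k. supn (a (- k))) summable_on UNIV \<longleftrightarrow> (\<lambda>k. supn (a k)) summable_on UNIV"
    by (rule summable_on_reindex_bij_witness[of _ uminus uminus]) auto
  have s: "(\<lambda>k. supn (a (- k))) summable_on UNIV"
    using l1_summable[OF a] eq by simp
  have d: "cmod ((a\<dagger>) k x) \<le> supn (a (- k))" for k x
    unfolding l1_star_def using cmod_le_supn[OF l1_CX[OF a]] by simp
  have c: "(a\<dagger>) k \<in> CX" for k
    unfolding l1_star_def using a by (intro CX_cnj CX_spow l1_CX)
  show "a\<dagger> \<in> L" by (rule l1_dominated(1)[OF c s d])
  have "infsum (\<lambda>k. supn (a (- k))) UNIV = infsum (\<lambda>k. supn (a k)) UNIV"
    by (rule infsum_reindex_bij_witness[of _ uminus uminus]) auto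
  then show "l1_norm (a\<dagger>) \<le> l1_norm a"
    using l1_dominated(2)[OF c s d] by (simp add: l1_norm_def)
qed

text \<open>The points \<open>y k\<close> may be arbitrary, since only sup norms enter the
  majorant.\<close>

lemma mul_abs_summable:
  assumes "a \<in> L" "b \<in> L"
  shows "(\<lambda>k. cmod (a k x * b (n - k) (y k))) summable_on UNIV"
  by (rule Infinite_Sum.abs_summable_on_comparison_test'[OF summable_on_convolution_row(1)
        [of "\<lambda>k. supn (a k)" "\<lambda>k. supn (b k)" n]])
    (use assms in \<open>auto intro!: mult_mono cmod_le_supn simp: l1_summable l1_CX norm_mult\<close>)

lemma mul_summable:
  assumes "a \<in> L" "b \<in> L"
  shows "(\<lambda>k. a k x * b (n - k) (y k)) summable_on UNIV"
  using mul_abs_summable[OF assms] by (simp add: summable_on_iff_abs_summable_on_complex)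

text \<open>The convolution of the sup norms majorises the product. Continuity of each coefficient
  follows from the M-test: the partial sums converge uniformly in x.\<close>

lemma l1_mul [simp]: "a \<in> L \<Longrightarrow> b \<in> L \<Longrightarrow> a \<otimes> b \<in> L"
  and l1_norm_mul: "a \<in> L \<Longrightarrow> b \<in> L \<Longrightarrow> l1_norm (a \<otimes> b) \<le> l1_norm a * l1_norm b"
proof -
  assume a: "a \<in> L" and b: "b \<in> L"
  let ?A = "\<lambda>k. supn (a k)" and ?B = "\<lambda>k. supn (b k)"
  let ?c = "\<lambda>n. infsum (\<lambda>k. ?A k * ?B (n - k)) UNIV"
  note AB = l1_summable[OF a] supn_nonneg[OF l1_CX[OF a]] l1_summable[OF b] supn_nonneg[OF l1_CX[OF b]]
  note rows = summable_on_convolution_row[OF AB]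
  have t: "cmod (a k x * b (n - k) (tr (- k) x)) \<le> ?A k * ?B (n - k)" for k n x
    using a b by (auto intro!: mult_mono cmod_le_supn simp: l1_CX norm_mult)
  have d: "cmod ((a \<otimes> b) n x) \<le> ?c n" for n x
    unfolding l1_mult_def
    by (rule norm_infsum_le[OF has_sum_infsum[OF mul_summable[OF a b]] has_sum_infsum[OF rows(1)]])
      (rule t)
  have c: "(a \<otimes> b) n \<in> CX" for n
  proof -
    have u: "uniform_limit UNIV (\<lambda>F x. \<Sum>k\<in>F. a k x * b (n - k) (tr (- k) x))
       (\<lambda>x. infsum (\<lambda>k. a k x * b (n - k) (tr (- k) x)) UNIV) (finite_subsets_at_top UNIV)"
      by (rule Weierstrass_m_test_general[OF _ rows(1)]) (rule t)
    have v: "continuous_on UNIV (\<lambda>x. \<Sum>k\<in>F. a k x * b (n - k) (tr (- k) x))" for F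
    proof (rule continuous_on_sum)
      fix k
      have "(\<lambda>x. a k x * b (n - k) (tr (- k) x)) \<in> CX"
        using a b by (intro CX_mult CX_spow l1_CX)
      then show "continuous_on UNIV (\<lambda>x. a k x * b (n - k) (tr (- k) x))" by (simp add: CX_def)
    qed
    have "continuous_on UNIV (\<lambda>x. infsum (\<lambda>k. a k x * b (n - k) (tr (- k) x)) UNIV)"
      by (rule uniform_limit_theorem[OF always_eventually u]) (simp_all add: v)
    then show ?thesis by (simp add: l1_mult_def CX_def)
  qed
  show "a \<otimes> b \<in> L" by (rule l1_dominated(1)[OF c rows(2) d])
  show "l1_norm (a \<otimes> b) \<le> l1_norm a * l1_norm b"
    using l1_dominated(2)[OF c rows(2) d] summable_on_convolution(2)[OF AB] by (simp add: l1_norm_def)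
qed

subsection \<open>Algebraic identities\<close>

lemma mul_add_left: "a \<in> L \<Longrightarrow> b \<in> L \<Longrightarrow> c \<in> L \<Longrightarrow> (a \<oplus> b) \<otimes> c = a \<otimes> c \<oplus> b \<otimes> c"
  and mul_add_right: "a \<in> L \<Longrightarrow> b \<in> L \<Longrightarrow> c \<in> L \<Longrightarrow> c \<otimes> (a \<oplus> b) = c \<otimes> a \<oplus> c \<otimes> b"
  by (auto simp: l1_mult_def l1_add_def fun_eq_iff distrib_left distrib_right
      intro!: infsum_add mul_summable)

lemma mul_smult_left: "(c \<odot> a) \<otimes> b = c \<odot> (a \<otimes> b)"
  and mul_smult_right: "a \<otimes> (c \<odot> b) = c \<odot> (a \<otimes> b)"
  by (simp_all add: l1_mult_def l1_smult_def mult.assoc mult.left_commute[of _ c] infsum_cmult_right')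

lemma mul_fdelta_left: "(fdelta f k \<otimes> b) n x = f x * b (n - k) (tr (- k) x)"
proof -
  have "(fdelta f k \<otimes> b) n x = infsum (\<lambda>j. f x * b (n - j) (tr (- j) x)) {k}"
    unfolding l1_mult_def fdelta_def by (rule infsum_cong_neutral) auto
  then show ?thesis by simp
qed

lemma mul_fdelta_right: "(a \<otimes> fdelta f k) n x = a (n - k) x * f (tr (k - n) x)"
proof -
  have "(a \<otimes> fdelta f k) n x = infsum (\<lambda>j. a j x * f (tr (- j) x)) {n - k}"
    unfolding l1_mult_def fdelta_def by (rule infsum_cong_neutral) auto
  then show ?thesis by simp
qed

lemma mul_one [simp]: "\<e> \<otimes> a = a" "a \<otimes> \<e> = a"
  by (simp_all add: fun_eq_iff coef0_eq_fdelta mul_fdelta_left mul_fdelta_right)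

text \<open>Both sides sum one absolutely summable double series in the two possible orders; the
  inner index is then shifted by j.\<close>

lemma mul_assoc:
  assumes a: "a \<in> L" and b: "b \<in> L" and c: "c \<in> L"
  shows "(a \<otimes> b) \<otimes> c = a \<otimes> (b \<otimes> c)"
proof (intro ext)
  fix n x
  let ?A = "\<lambda>k. supn (a k)" and ?B = "\<lambda>k. supn (b k)" and ?C = "\<lambda>k. supn (c k)"
  note AB = l1_summable[OF a] supn_nonneg[OF l1_CX[OF a]] l1_summable[OF b] supn_nonneg[OF l1_CX[OF b]]
  define T where "T k j = a j x * b (k - j) (tr (- j) x) * c (n - k) (tr (- k) x)" for k j
  have "(\<lambda>(k,j). (?A j * ?B (k - j)) * l1_norm c) summable_on UNIV \<times> UNIV"
    using summable_on_cmult_left[OF summable_on_convolution(1)[OF AB], of "l1_norm c"]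
    by (simp add: split_def)
  then have "(\<lambda>p. cmod (case p of (k, j) \<Rightarrow> T k j)) summable_on UNIV \<times> UNIV"
  proof (rule Infinite_Sum.abs_summable_on_comparison_test')
    fix p :: "int \<times> int"
    obtain k j where p: "p = (k,j)" by force
    show "cmod (case p of (k, j) \<Rightarrow> T k j) \<le> (case p of (k,j) \<Rightarrow> (?A j * ?B (k - j)) * l1_norm c)"
      using a b c unfolding p T_def
      by (auto intro!: mult_mono cmod_le_supn cmod_le_l1_norm simp: l1_CX norm_mult)
  qed
  then have s: "(\<lambda>(k,j). T k j) summable_on UNIV \<times> UNIV"
    by (simp add: summable_on_iff_abs_summable_on_complex)
  have "((a \<otimes> b) \<otimes> c) n x = infsum (\<lambda>k. infsum (\<lambda>j. T k j) UNIV) UNIV"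
    unfolding l1_mult_def T_def by (simp add: infsum_cmult_left')
  also have "\<dots> = infsum (\<lambda>j. infsum (\<lambda>k. T k j) UNIV) UNIV"
    by (rule infsum_swap_banach[OF s])
  also have "\<dots> = infsum (\<lambda>j. a j x * infsum (\<lambda>m. b m (tr (- j) x) * c (n - j - m) (tr (- m) (tr (- j) x))) UNIV) UNIV"
  proof (rule infsum_cong)
    fix j
    have "infsum (\<lambda>k. T k j) UNIV =
       infsum (\<lambda>m. a j x * (b m (tr (- j) x) * c (n - j - m) (tr (- m) (tr (- j) x)))) UNIV"
      by (rule infsum_reindex_bij_witness[of _ "\<lambda>m. m + j" "\<lambda>k. k - j"])
        (auto simp: T_def mult.assoc)
    then show "infsum (\<lambda>k. T k j) UNIV =
       a j x * infsum (\<lambda>m. b m (tr (- j) x) * c (n - j - m) (tr (- m) (tr (- j) x))) UNIV"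
      by (simp add: infsum_cmult_right')
  qed
  finally show "((a \<otimes> b) \<otimes> c) n x = (a \<otimes> (b \<otimes> c)) n x"
    by (simp add: l1_mult_def)
qed

lemma star_star [simp]: "(a\<dagger>)\<dagger> = a"
  by (simp add: l1_star_def)

lemma star_add: "(a \<oplus> b)\<dagger> = a\<dagger> \<oplus> b\<dagger>"
  and star_smult: "(c \<odot> a)\<dagger> = cnj c \<odot> a\<dagger>"
  by (simp_all add: l1_star_def l1_add_def l1_smult_def)

lemma star_coef0: "(coef0 f)\<dagger> = coef0 (\<lambda>x. cnj (f x))"
  by (auto simp: l1_star_def coef0_def fun_eq_iff)

lemma star_fdelta: "(fdelta f k)\<dagger> = fdelta (\<lambda>x. cnj (f (tr k x))) (- k)"
  by (auto simp: l1_star_def fdelta_def fun_eq_iff)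

lemma star_one [simp]: "\<e>\<dagger> = \<e>"
  by (simp add: star_coef0)

lemma star_mul: "(a \<otimes> b)\<dagger> = b\<dagger> \<otimes> a\<dagger>"
proof (intro ext)
  fix n x
  have "((a \<otimes> b)\<dagger>) n x = infsum (\<lambda>k. cnj (a k (tr (- n) x)) * cnj (b (- n - k) (tr (- k - n) x))) UNIV"
    unfolding l1_star_def l1_mult_def by (simp del: infsum_cnj add: infsum_cnj[symmetric])
  also have "\<dots> = infsum (\<lambda>k. cnj (b (- k) (tr (- k) x)) * cnj (a (- (n - k)) (tr (- (n - k)) (tr (- k) x)))) UNIV"
    by (rule infsum_reindex_bij_witness[of _ "\<lambda>k. - (n - k)" "\<lambda>k. n + k"])
      (simp_all add: mult.commute add.commute minus_diff_commute)
  also have "\<dots> = (b\<dagger> \<otimes> a\<dagger>) n x"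
    by (simp add: l1_star_def l1_mult_def)
  finally show "((a \<otimes> b)\<dagger>) n x = (b\<dagger> \<otimes> a\<dagger>) n x" .
qed

lemma l1_smult_one [simp]: "1 \<odot> a = a"
  by (simp add: l1_smult_def)

lemma l1_smult_smult [simp]: "c \<odot> (d \<odot> a) = (c * d) \<odot> a"
  by (simp add: l1_smult_def mult.assoc)

lemma smult_add: "c \<odot> (a \<oplus> b) = c \<odot> a \<oplus> c \<odot> b"
  by (simp add: l1_smult_def l1_add_def distrib_left)

lemma add_assoc: "(a \<oplus> b) \<oplus> e = a \<oplus> (b \<oplus> e)"
  by (simp add: l1_add_def add.assoc)

lemmas expand = diff_conv mul_add_left mul_add_right mul_smult_left mul_smult_right mul_assoc
  star_add star_smult star_mul smult_add add_assoc

lemmas vec_defs = l1_add_def l1_diff_def l1_smult_def fun_eq_iff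

end

section \<open>Square roots\<close>

text \<open>The scalar majorant of the iteration z = (x + z * z) / 2, whose fixed point gives the
  square root 1 - z of 1 - x without requiring that the norm of x is less than 1.\<close>

primrec sqrt_bound :: "nat \<Rightarrow> real" where
  "sqrt_bound 0 = 0"
| "sqrt_bound (Suc n) = (1 + (sqrt_bound n)\<^sup>2) / 2"

lemma sqrt_bound_range: "0 \<le> sqrt_bound n \<and> sqrt_bound n \<le> 1"
proof (induction n)
  case (Suc n)
  then have "(sqrt_bound n)\<^sup>2 \<le> 1" by (simp add: power_le_one)
  then show ?case by simp
qed simp

text \<open>The increment is half the square of \<open>sqrt_bound n - 1\<close>.\<close>

lemma sqrt_bound_Suc_ge: "sqrt_bound n \<le> sqrt_bound (Suc n)"
  using zero_le_power2[of "sqrt_bound n - 1"] by (simp add: power2_eq_square algebra_simps)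

lemma sqrt_bound_mono: "m \<le> n \<Longrightarrow> sqrt_bound m \<le> sqrt_bound n"
  by (rule lift_Suc_mono_le[of sqrt_bound]) (rule sqrt_bound_Suc_ge)

lemma sqrt_bound_convergent: "convergent sqrt_bound"
proof (rule Bseq_mono_convergent)
  show "Bseq sqrt_bound"
    using sqrt_bound_range by (intro BseqI'[of _ 1]) auto
qed (simp add: sqrt_bound_mono)

context dynamical_system
begin

text \<open>The seminorm is a parameter because the iteration is analysed twice: for
  \<open>l1_norm\<close>, to prove that positive functionals are bounded, and for
  \<open>cs_norm\<close>, to take square roots in the completion.\<close>

definition submult_seminorm :: "('a l1 \<Rightarrow> real) \<Rightarrow> bool" where
  "submult_seminorm p \<longleftrightarrow> (\<forall>a\<in>L. 0 \<le> p a) \<and> (\<forall>a\<in>L. \<forall>b\<in>L. p (a \<oplus> b) \<le> p a + p b) \<and>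
     (\<forall>a\<in>L. \<forall>c. p (c \<odot> a) \<le> cmod c * p a) \<and> (\<forall>a\<in>L. \<forall>b\<in>L. p (a \<otimes> b) \<le> p a * p b)"

lemma submult_l1_norm: "submult_seminorm l1_norm"
  by (simp add: submult_seminorm_def l1_norm_add l1_norm_mul l1_norm_smult_le)

primrec sqrt_iter :: "'a l1 \<Rightarrow> nat \<Rightarrow> 'a l1" where
  "sqrt_iter x 0 = (\<lambda>k y. 0)"
| "sqrt_iter x (Suc n) = (1/2) \<odot> (x \<oplus> sqrt_iter x n \<otimes> sqrt_iter x n)"

lemma sqrt_iter_l1 [simp]: "x \<in> L \<Longrightarrow> sqrt_iter x n \<in> L"
  by (induction n) auto

lemma sqrt_iter_star: "x\<dagger> = x \<Longrightarrow> (sqrt_iter x n)\<dagger> = sqrt_iter x n"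
proof (induction n)
  case 0
  show ?case by (simp add: l1_star_def)
qed (simp add: star_add star_smult star_mul)

context
  fixes p assumes p: "submult_seminorm p"
begin

lemma p_nonneg: "a \<in> L \<Longrightarrow> 0 \<le> p a"
  and p_add: "a \<in> L \<Longrightarrow> b \<in> L \<Longrightarrow> p (a \<oplus> b) \<le> p a + p b"
  and p_smult: "a \<in> L \<Longrightarrow> p (c \<odot> a) \<le> cmod c * p a"
  and p_mul: "a \<in> L \<Longrightarrow> b \<in> L \<Longrightarrow> p (a \<otimes> b) \<le> p a * p b"
  using p by (auto simp: submult_seminorm_def)

lemma p_half: "a \<in> L \<Longrightarrow> p ((1/2) \<odot> a) \<le> p a / 2"
  using p_smult[of a "1/2"] by (simp add: norm_divide)

lemma p_zero: "p (\<lambda>k x. 0) = 0"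
  using p_smult[of "\<lambda>k x. 0" 0] p_nonneg[of "\<lambda>k x. 0"] by (simp add: l1_smult_def)

lemma p_diff_commute: "a \<in> L \<Longrightarrow> b \<in> L \<Longrightarrow> p (a \<ominus> b) \<le> p (b \<ominus> a)"
proof -
  assume "a \<in> L" "b \<in> L"
  moreover have "a \<ominus> b = (- 1) \<odot> (b \<ominus> a)" by (simp add: vec_defs)
  ultimately show ?thesis using p_smult[of "b \<ominus> a" "- 1"] by simp
qed

lemma sqrt_iter_bound:
  assumes x: "x \<in> L" "p x \<le> 1"
  shows "p (sqrt_iter x n) \<le> sqrt_bound n"
proof (induction n)
  case 0
  show ?case by (simp add: p_zero)
next
  case (Suc n)
  let ?z = "sqrt_iter x n"
  have z: "?z \<in> L" using x(1) by (rule sqrt_iter_l1)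
  have "p (?z \<otimes> ?z) \<le> p ?z * p ?z" by (rule p_mul[OF z z])
  also have "\<dots> \<le> (sqrt_bound n)\<^sup>2"
    unfolding power2_eq_square using Suc p_nonneg[OF z] by (intro mult_mono) auto
  finally have "p (x \<oplus> ?z \<otimes> ?z) \<le> 1 + (sqrt_bound n)\<^sup>2"
    using p_add[of x "?z \<otimes> ?z"] x z by simp
  then show ?case using p_half[of "x \<oplus> ?z \<otimes> ?z"] x z by simp
qed

text \<open>With d = z1 - z0, the difference z1 z1 - z0 z0 equals z1 d + d z0 without any
  commutativity. The scalar recursion satisfies the same identity, so its increments
  dominate.\<close>

lemma sqrt_iter_step:
  assumes x: "x \<in> L" "p x \<le> 1"
  shows "p (sqrt_iter x (Suc n) \<ominus> sqrt_iter x n) \<le> sqrt_bound (Suc n) - sqrt_bound n"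
proof (induction n)
  case 0
  have "sqrt_iter x (Suc 0) \<ominus> sqrt_iter x 0 = (1/2) \<odot> x"
    by (simp add: vec_defs l1_mult_def)
  then show ?case using p_half[of x] x by (simp del: sqrt_iter.simps)
next
  case (Suc n)
  define z0 z1 where "z0 = sqrt_iter x n" and "z1 = sqrt_iter x (Suc n)"
  have z: "z0 \<in> L" "z1 \<in> L" using x unfolding z0_def z1_def by (auto simp del: sqrt_iter.simps)
  define d where "d = z1 \<ominus> z0"
  have d: "d \<in> L" using z by (simp add: d_def)
  have b: "p z0 \<le> sqrt_bound n" "p z1 \<le> sqrt_bound (Suc n)"
    unfolding z0_def z1_def by (rule sqrt_iter_bound[OF x])+
  have IH: "p d \<le> sqrt_bound (Suc n) - sqrt_bound n" using Suc by (simp add: d_def z0_def z1_def)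
  have "sqrt_iter x (Suc (Suc n)) \<ominus> sqrt_iter x (Suc n)
      = (1/2) \<odot> (x \<oplus> z1 \<otimes> z1) \<ominus> (1/2) \<odot> (x \<oplus> z0 \<otimes> z0)"
    by (simp add: z0_def z1_def)
  also have "\<dots> = (1/2) \<odot> (z1 \<otimes> d \<oplus> d \<otimes> z0)"
    unfolding d_def using z by (simp add: expand) (simp add: vec_defs field_simps)
  finally have eq: "sqrt_iter x (Suc (Suc n)) \<ominus> sqrt_iter x (Suc n) = (1/2) \<odot> (z1 \<otimes> d \<oplus> d \<otimes> z0)" .
  have "p (z1 \<otimes> d \<oplus> d \<otimes> z0) \<le> p (z1 \<otimes> d) + p (d \<otimes> z0)" using z d by (intro p_add) auto
  also have "\<dots> \<le> p z1 * p d + p d * p z0" using z d by (intro add_mono p_mul)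
  also have "\<dots> = (p z1 + p z0) * p d" by (simp add: algebra_simps)
  also have "\<dots> \<le> (sqrt_bound (Suc n) + sqrt_bound n) * (sqrt_bound (Suc n) - sqrt_bound n)"
    using b IH p_nonneg[OF d] sqrt_bound_range[of n] sqrt_bound_range[of "Suc n"]
    by (intro mult_mono) (auto simp del: sqrt_bound.simps)
  also have "\<dots> = 2 * (sqrt_bound (Suc (Suc n)) - sqrt_bound (Suc n))"
    by (simp add: power2_eq_square algebra_simps)
  finally show ?case
    unfolding eq using p_half[of "z1 \<otimes> d \<oplus> d \<otimes> z0"] z d by (simp del: sqrt_bound.simps)
qed

text \<open>Telescoping. The bound does not involve x, so the rate of convergence is uniform over
  the unit ball of p; the diagonal argument in \<open>cseq_sqrt\<close> rests on this.\<close>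

lemma sqrt_iter_diff:
  assumes x: "x \<in> L" "p x \<le> 1" and mn: "n \<le> m"
  shows "p (sqrt_iter x m \<ominus> sqrt_iter x n) \<le> sqrt_bound m - sqrt_bound n"
  using mn
proof (induction m rule: dec_induct)
  case base
  have "sqrt_iter x n \<ominus> sqrt_iter x n = (\<lambda>k x. 0)" by (simp add: vec_defs)
  then show ?case by (simp add: p_zero)
next
  case (step m)
  have "sqrt_iter x (Suc m) \<ominus> sqrt_iter x n
     = (sqrt_iter x (Suc m) \<ominus> sqrt_iter x m) \<oplus> (sqrt_iter x m \<ominus> sqrt_iter x n)"
    by (simp add: vec_defs)
  then have "p (sqrt_iter x (Suc m) \<ominus> sqrt_iter x n)
     \<le> p (sqrt_iter x (Suc m) \<ominus> sqrt_iter x m) + p (sqrt_iter x m \<ominus> sqrt_iter x n)"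
    using x p_add by (simp del: sqrt_iter.simps)
  then show ?case using step sqrt_iter_step[OF x, of m] by linarith
qed

end

subsection \<open>Completeness in the l1-norm\<close>

text \<open>Completeness in the form the iteration needs: increments with a summable bound. The
  limit is \<open>z 0\<close> plus the series of increments, and exchanging the sums over steps and
  over coefficients controls the remainder in norm.\<close>

lemma l1_complete:
  assumes z: "\<And>n. z n \<in> L" and e: "summable e"
    and ze: "\<And>n. l1_norm (z (Suc n) \<ominus> z n) \<le> e n"
  shows "\<exists>w\<in>L. (\<lambda>n. l1_norm (w \<ominus> z n)) \<longlonglongrightarrow> 0"
proof -
  define d where "d n = z (Suc n) \<ominus> z n" for n
  have d: "d n \<in> L" for n by (simp add: d_def z)
  define r where "r n = l1_norm (d n)" for n
  have r0: "0 \<le> r n" for n by (simp add: r_def d)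
  have rs: "summable r"
    by (rule summable_comparison_test'[OF e, of 0]) (use ze r0 in \<open>auto simp: r_def d_def\<close>)
  define tail where "tail n = (\<Sum>j. r (j + n))" for n
  have tail0: "tail \<longlonglongrightarrow> 0"
    unfolding tail_def by (rule suminf_exist_split2[OF rs])
  have rs': "summable (\<lambda>j. r (j + n))" for n using rs by simp
  have s2: "(\<lambda>(j,k). supn (d (j + n) k)) summable_on (UNIV \<times> UNIV)" for n
  proof (rule summable_on_SigmaI)
    show "((\<lambda>y. case (j, y) of (j, k) \<Rightarrow> supn (d (j + n) k)) has_sum r (j + n)) UNIV" for j
      using has_sum_infsum[OF l1_summable[OF d]] by (simp add: r_def l1_norm_def)
    show "(\<lambda>j. r (j + n)) summable_on UNIV"
      using rs' r0 by (simp add: summable_on_UNIV_nonneg_real_iff)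
  qed (use l1_CX[OF d] in auto)
  \<comment> \<open>Majorant for coefficient k of the limit minus \<open>z n\<close>. Summed over k
    it gives \<open>tail n\<close>, by exchanging the two sums.\<close>
  define b where "b n k = infsum (\<lambda>j. supn (d (j + n) k)) UNIV" for n k
  have sw: "(\<lambda>(k,j). supn (d (j + n) k)) summable_on (UNIV \<times> UNIV)" for n
    using summable_on_swap[of "\<lambda>(j,k). supn (d (j + n) k)" UNIV UNIV] s2[of n]
    by (simp add: split_def prod.swap_def)
  have col: "(\<lambda>j. supn (d (j + n) k)) summable_on UNIV" for n k
    using summable_on_SigmaD1[of "\<lambda>k j. supn (d (j + n) k)", OF sw[of n], of k] by simp
  have bs: "b n summable_on UNIV" for n
    using summable_on_Sigma_banach[OF sw[of n]] by (simp add: b_def[abs_def])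
  have bt: "infsum (b n) UNIV = tail n" for n
  proof -
    have "infsum (b n) UNIV = infsum (\<lambda>j. infsum (\<lambda>k. supn (d (j + n) k)) UNIV) UNIV"
      unfolding b_def using infsum_swap_banach[OF s2[of n]] by simp
    also have "\<dots> = infsum (\<lambda>j. r (j + n)) UNIV" by (simp add: r_def l1_norm_def)
    also have "\<dots> = tail n"
      unfolding tail_def using rs' r0
      by (intro infsumI sums_nonneg_imp_has_sum summable_sums) auto
    finally show ?thesis .
  qed
  have b0: "0 \<le> b n k" for n k
    unfolding b_def using l1_CX[OF d] by (intro infsum_nonneg) auto
  have btail: "b n k \<le> tail n" for n k
    using finite_sum_le_infsum[OF bs[of n], of "{k}"] b0 bt by simp
  define w where "w k x = z 0 k x + (\<Sum>j. d j k x)" for k x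
  have sc: "summable (\<lambda>j. d j k x)" "cmod (\<Sum>j. d (j + n) k x) \<le> b n k" for k x n
  proof -
    have le: "cmod (d (j + n) k x) \<le> supn (d (j + n) k)" for j n using l1_CX[OF d] by (rule cmod_le_supn)
    have s: "summable (\<lambda>j. supn (d (j + n) k))" for n
      using col[of n k] l1_CX[OF d] by (simp add: summable_on_UNIV_nonneg_real_iff)
    have n: "summable (\<lambda>j. cmod (d (j + n) k x))" for n
      by (rule summable_comparison_test'[OF s[of n], of 0]) (simp add: le)
    show "summable (\<lambda>j. d j k x)" using summable_norm_cancel[OF n[of 0]] by simp
    have "cmod (\<Sum>j. d (j + n) k x) \<le> (\<Sum>j. cmod (d (j + n) k x))" by (rule summable_norm[OF n])
    also have "\<dots> \<le> (\<Sum>j. supn (d (j + n) k))" by (rule suminf_le[OF le n s])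
    also have "\<dots> = b n k"
      unfolding b_def using s l1_CX[OF d]
      by (intro infsumI[symmetric] sums_nonneg_imp_has_sum summable_sums) auto
    finally show "cmod (\<Sum>j. d (j + n) k x) \<le> b n k" .
  qed
  have wz: "cmod (w k x - z n k x) \<le> b n k" for n k x
  proof -
    have "(\<Sum>j<n. d j k x) = z n k x - z 0 k x"
      using sum_lessThan_telescope[of "\<lambda>j. z j k x" n] by (simp add: d_def l1_diff_def)
    then have "w k x - z n k x = (\<Sum>j. d (j + n) k x)"
      using suminf_minus_initial_segment[OF sc(1)[of k x], of n] by (simp add: w_def)
    then show ?thesis using sc(2)[of n k x] by simp
  qed
  have wc: "w k \<in> CX" for k
  proof -
    have u: "uniform_limit UNIV (\<lambda>n. z n k) (w k) sequentially"
    proof (rule uniform_limitI)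
      fix \<epsilon> :: real assume "\<epsilon> > 0"
      then have "\<forall>\<^sub>F n in sequentially. tail n < \<epsilon>" using tail0 by (simp add: order_tendstoD)
      then show "\<forall>\<^sub>F n in sequentially. \<forall>x\<in>UNIV. dist (z n k x) (w k x) < \<epsilon>"
      proof eventually_elim
        case (elim n)
        show ?case
          using wz[of k _ n] btail[of n k] elim
          by (metis dist_commute dist_norm le_less_trans)
      qed
    qed
    have "continuous_on UNIV (w k)"
      by (rule uniform_limit_theorem[OF always_eventually u]) (use l1_CX[OF z] in \<open>simp_all add: CX_def\<close>)
    then show ?thesis by (simp add: CX_def)
  qed
  have diff: "w \<ominus> z n \<in> L" "l1_norm (w \<ominus> z n) \<le> tail n" for n
    using l1_dominated[of "w \<ominus> z n" "b n"] wz bs bt wc l1_CX[OF z]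
    by (simp_all add: l1_diff_def CX_diff)
  have "w = (w \<ominus> z 0) \<oplus> z 0" by (simp add: vec_defs)
  then have wL: "w \<in> L" using diff(1) z by (metis l1_add)
  have "(\<lambda>n. l1_norm (w \<ominus> z n)) \<longlonglongrightarrow> 0"
    by (rule tendsto_sandwich[OF _ _ tendsto_const tail0]) (use diff in auto)
  with wL show ?thesis by blast
qed

text \<open>The limit w of the iteration satisfies 2 w = x + w w, so the square of the unit minus w
  is the unit minus x. The fixed point equation and self-adjointness both pass to the limit.\<close>

lemma l1_sqrt:
  assumes x: "x \<in> L" "x\<dagger> = x" "l1_norm x \<le> 1"
  shows "\<exists>y\<in>L. y\<dagger> = y \<and> y \<otimes> y = \<e> \<ominus> x"
proof -
  let ?z = "sqrt_iter x"
  have z: "?z n \<in> L" for n using x by simp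
  have e: "summable (\<lambda>n. sqrt_bound (Suc n) - sqrt_bound n)"
    using sqrt_bound_convergent telescope_summable[of sqrt_bound]
    by (auto simp: convergent_def simp del: sqrt_bound.simps)
  obtain w where w: "w \<in> L" and lim: "(\<lambda>n. l1_norm (w \<ominus> ?z n)) \<longlonglongrightarrow> 0"
    using l1_complete[OF z e sqrt_iter_step[OF submult_l1_norm x(1,3)]] by blast
  have unique: "u = v" if "u \<in> L" "v \<in> L" and "\<And>n. l1_norm (u \<ominus> v) \<le> f n" and "f \<longlonglongrightarrow> 0" for u v f
  proof -
    have "l1_norm (u \<ominus> v) \<le> 0" using that(3,4) by (meson LIMSEQ_le_const)
    then have "u \<ominus> v = (\<lambda>k x. 0)" using that by (intro l1_norm_eq_0) auto
    then show ?thesis by (simp add: l1_diff_def fun_eq_iff)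
  qed
  have "w = (1/2) \<odot> (x \<oplus> w \<otimes> w)"
  proof (rule unique)
    fix n
    let ?d = "?z n \<ominus> w"
    have d: "?d \<in> L" using z w by simp
    have dl: "l1_norm ?d \<le> l1_norm (w \<ominus> ?z n)"
      by (rule p_diff_commute[OF submult_l1_norm z w])
    have zb: "l1_norm (?z n) \<le> 1"
      using sqrt_iter_bound[OF submult_l1_norm x(1,3), of n] sqrt_bound_range[of n] by linarith
    \<comment> \<open>Replaces x by means of the recursion for \<open>?z (Suc n)\<close>; the rest
      is half of z z - w w = z d + d w with d = z - w.\<close>
    have eq: "w \<ominus> (1/2) \<odot> (x \<oplus> w \<otimes> w) = (w \<ominus> ?z (Suc n)) \<oplus> (1/2) \<odot> (?z n \<otimes> ?d \<oplus> ?d \<otimes> w)"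
      using z[of n] w x(1) by (simp add: expand) (simp add: vec_defs field_simps)
    have 1: "l1_norm (w \<ominus> (1/2) \<odot> (x \<oplus> w \<otimes> w)) \<le> l1_norm (w \<ominus> ?z (Suc n)) + l1_norm ((1/2) \<odot> (?z n \<otimes> ?d \<oplus> ?d \<otimes> w))"
      unfolding eq using z w d by (intro l1_norm_add l1_smult l1_add l1_diff l1_mul)
    have 2: "l1_norm ((1/2) \<odot> (?z n \<otimes> ?d \<oplus> ?d \<otimes> w)) \<le> l1_norm (?z n \<otimes> ?d \<oplus> ?d \<otimes> w) / 2"
      using z w d by (intro p_half[OF submult_l1_norm] l1_add l1_mul)
    have "l1_norm (?z n \<otimes> ?d \<oplus> ?d \<otimes> w) \<le> l1_norm (?z n \<otimes> ?d) + l1_norm (?d \<otimes> w)"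
      using z w d by (intro l1_norm_add l1_mul)
    also have "\<dots> \<le> l1_norm (?z n) * l1_norm ?d + l1_norm ?d * l1_norm w"
      using z w d by (intro add_mono l1_norm_mul)
    also have "\<dots> \<le> 1 * l1_norm (w \<ominus> ?z n) + l1_norm (w \<ominus> ?z n) * l1_norm w"
      using dl zb w d z by (intro add_mono mult_mono) auto
    finally have 3: "l1_norm (?z n \<otimes> ?d \<oplus> ?d \<otimes> w)
       \<le> 1 * l1_norm (w \<ominus> ?z n) + l1_norm (w \<ominus> ?z n) * l1_norm w" .
    show "l1_norm (w \<ominus> (1/2) \<odot> (x \<oplus> w \<otimes> w))
       \<le> l1_norm (w \<ominus> ?z (Suc n)) + (1 * l1_norm (w \<ominus> ?z n) + l1_norm (w \<ominus> ?z n) * l1_norm w) / 2"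
      by (rule order_trans[OF 1 add_left_mono[OF order_trans[OF 2 divide_right_mono[OF 3]]]]) simp
  next
    show "(\<lambda>n. l1_norm (w \<ominus> ?z (Suc n)) + (1 * l1_norm (w \<ominus> ?z n) + l1_norm (w \<ominus> ?z n) * l1_norm w) / 2) \<longlonglongrightarrow> 0"
      by (rule tendsto_eq_intros LIMSEQ_Suc[OF lim] lim | simp)+
  qed (use x w in auto)
  then have ww: "w \<otimes> w = 2 \<odot> w \<ominus> x"
    by (simp add: vec_defs field_simps)
  have ws: "w\<dagger> = w"
  proof (rule unique)
    fix n
    have "w\<dagger> \<ominus> w = (w \<ominus> ?z n)\<dagger> \<oplus> (?z n \<ominus> w)"
      using sqrt_iter_star[OF x(2), of n] by (simp add: diff_conv star_add star_smult) (simp add: vec_defs)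
    then have "l1_norm (w\<dagger> \<ominus> w) \<le> l1_norm ((w \<ominus> ?z n)\<dagger>) + l1_norm (?z n \<ominus> w)"
      using l1_norm_add[of "(w \<ominus> ?z n)\<dagger>" "?z n \<ominus> w"] w z by simp
    then show "l1_norm (w\<dagger> \<ominus> w) \<le> 2 * l1_norm (w \<ominus> ?z n)"
      using l1_norm_star_le[of "w \<ominus> ?z n"] p_diff_commute[OF submult_l1_norm z w, of n] w z by simp
  next
    show "(\<lambda>n. 2 * l1_norm (w \<ominus> ?z n)) \<longlonglongrightarrow> 0"
      using tendsto_mult_left[OF lim, of 2] by simp
  qed (use w in auto)
  show ?thesis
  proof (intro bexI conjI)
    show "(\<e> \<ominus> w)\<dagger> = \<e> \<ominus> w" using ws by (simp add: diff_conv star_add star_smult)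
    show "(\<e> \<ominus> w) \<otimes> (\<e> \<ominus> w) = \<e> \<ominus> x"
      using w ww by (simp add: expand) (simp add: vec_defs field_simps)
    show "\<e> \<ominus> w \<in> L" using w by simp
  qed
qed

end

section \<open>Positive functionals and the enveloping seminorm\<close>

lemma mult_mult_square: "(r::real) * (r * s\<^sup>2) = (r * s)\<^sup>2"
  by (simp add: power2_eq_square)

context dynamical_system
begin

text \<open>States without the normalisation: compressing a state by b, or composing one with a
  projection and a vector, need not give value 1 at the unit. Boundedness is not demanded but
  derived.\<close>

definition pos_functional :: "('a l1 \<Rightarrow> complex) \<Rightarrow> bool" where
  "pos_functional \<phi> \<longleftrightarrow>
     (\<forall>a \<in> L. \<forall>b \<in> L. \<phi> (a \<oplus> b) = \<phi> a + \<phi> b) \<and>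
     (\<forall>c. \<forall>a \<in> L. \<phi> (c \<odot> a) = c * \<phi> a) \<and>
     (\<forall>a \<in> L. Im (\<phi> (a\<dagger> \<otimes> a)) = 0 \<and> 0 \<le> Re (\<phi> (a\<dagger> \<otimes> a)))"

lemma state_iff: "l1_state \<sigma> \<phi> \<longleftrightarrow> pos_functional \<phi> \<and> \<phi> \<e> = 1"
  by (auto simp: l1_state_def pos_functional_def)

context
  fixes \<phi> assumes phi: "pos_functional \<phi>"
begin

lemma phi_add: "a \<in> L \<Longrightarrow> b \<in> L \<Longrightarrow> \<phi> (a \<oplus> b) = \<phi> a + \<phi> b"
  and phi_smult: "a \<in> L \<Longrightarrow> \<phi> (c \<odot> a) = c * \<phi> a"
  and phi_Im: "a \<in> L \<Longrightarrow> Im (\<phi> (a\<dagger> \<otimes> a)) = 0"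
  and phi_Re: "a \<in> L \<Longrightarrow> 0 \<le> Re (\<phi> (a\<dagger> \<otimes> a))"
  using phi by (auto simp: pos_functional_def)

lemma phi_diff: "a \<in> L \<Longrightarrow> b \<in> L \<Longrightarrow> \<phi> (a \<ominus> b) = \<phi> a - \<phi> b"
  by (simp add: diff_conv phi_add phi_smult)

lemma phi_zero: "\<phi> (\<lambda>k x. 0) = 0"
  using phi_smult[of "\<lambda>k x. 0" 0] by (simp add: l1_smult_def)

lemma phi_square: "a \<in> L \<Longrightarrow> \<phi> (a\<dagger> \<otimes> a) = of_real (Re (\<phi> (a\<dagger> \<otimes> a)))"
  by (simp add: complex_eq_iff phi_Im)

lemma phi_one: "0 \<le> Re (\<phi> \<e>)" "Im (\<phi> \<e>) = 0" "\<phi> \<e> = of_real (Re (\<phi> \<e>))"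
  using phi_Re[of \<e>] phi_Im[of \<e>] by (simp_all add: complex_eq_iff)

lemma phi_expand:
  assumes "a \<in> L" "b \<in> L"
  shows "\<phi> ((a \<oplus> c \<odot> b)\<dagger> \<otimes> (a \<oplus> c \<odot> b))
    = \<phi> (a\<dagger> \<otimes> a) + c * \<phi> (a\<dagger> \<otimes> b) + cnj c * \<phi> (b\<dagger> \<otimes> a) + cnj c * c * \<phi> (b\<dagger> \<otimes> b)"
  using assms by (simp add: expand phi_add phi_smult)

text \<open>The values at the squares of a + b and of a + i b are real, which determines both parts
  of the identity.\<close>

lemma phi_hermitian:
  assumes a: "a \<in> L" and b: "b \<in> L"
  shows "\<phi> (a\<dagger> \<otimes> b) = cnj (\<phi> (b\<dagger> \<otimes> a))"
proof -
  have "Im (\<phi> ((a \<oplus> c \<odot> b)\<dagger> \<otimes> (a \<oplus> c \<odot> b))) = 0" for c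
    using a b by (intro phi_Im) auto
  from this[of 1] this[of \<i>] show ?thesis
    unfolding phi_expand[OF a b] using phi_Im[OF a] phi_Im[OF b] by (auto simp: complex_eq_iff)
qed

lemma phi_star: "a \<in> L \<Longrightarrow> \<phi> (a\<dagger>) = cnj (\<phi> a)"
  using phi_hermitian[of a \<e>] by simp

lemma phi_Cauchy_Schwarz:
  assumes a: "a \<in> L" and b: "b \<in> L"
  shows "(cmod (\<phi> (b\<dagger> \<otimes> a)))\<^sup>2 \<le> Re (\<phi> (a\<dagger> \<otimes> a)) * Re (\<phi> (b\<dagger> \<otimes> b))"
proof -
  define A B z where "A = Re (\<phi> (a\<dagger> \<otimes> a))" and "B = Re (\<phi> (b\<dagger> \<otimes> b))" and "z = \<phi> (b\<dagger> \<otimes> a)"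
  have B0: "0 \<le> B" and A0: "0 \<le> A" using phi_Re a b by (auto simp: A_def B_def)
  \<comment> \<open>Positivity at the square of a - s z b with z the mixed term: a real quadratic
    polynomial in s.\<close>
  have key: "0 \<le> A - 2 * s * (cmod z)\<^sup>2 + s\<^sup>2 * (cmod z)\<^sup>2 * B" for s :: real
  proof -
    define c where "c = - of_real s * z"
    have "\<phi> ((a \<oplus> c \<odot> b)\<dagger> \<otimes> (a \<oplus> c \<odot> b)) = A + c * cnj z + cnj c * z + cnj c * c * B"
      unfolding phi_expand[OF a b] using phi_square[OF a] phi_square[OF b] phi_hermitian[OF a b]
      by (simp add: A_def B_def z_def)
    also have "\<dots> = of_real (A - 2 * s * (cmod z)\<^sup>2 + s\<^sup>2 * (cmod z)\<^sup>2 * B)"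
      using complex_norm_square[of z]
      by (simp add: c_def algebra_simps power2_eq_square[of s] del: of_real_power)
    finally have "Re (\<phi> ((a \<oplus> c \<odot> b)\<dagger> \<otimes> (a \<oplus> c \<odot> b))) = A - 2 * s * (cmod z)\<^sup>2 + s\<^sup>2 * (cmod z)\<^sup>2 * B"
      by (simp del: of_real_add of_real_diff of_real_mult)
    then show ?thesis using phi_Re[of "a \<oplus> c \<odot> b"] a b by simp
  qed
  show ?thesis
  proof (cases "B = 0")
    case True
    have "(cmod z)\<^sup>2 \<le> 0"
    proof (rule ccontr)
      assume "\<not> (cmod z)\<^sup>2 \<le> 0"
      \<comment> \<open>For B = 0 the polynomial is linear in s, and this s makes it equal to
        -1.\<close>
      then have "2 * ((A + 1) / (2 * (cmod z)\<^sup>2)) * (cmod z)\<^sup>2 = A + 1" by simp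
      then show False using key[of "(A + 1) / (2 * (cmod z)\<^sup>2)"] True by simp
    qed
    then show ?thesis using True by (simp add: z_def B_def)
  next
    case False
    then have "B > 0" using B0 by simp
    with key[of "1 / B"] have "(cmod z)\<^sup>2 / B \<le> A" by (simp add: power2_eq_square field_simps)
    then show ?thesis using \<open>B > 0\<close> by (simp add: field_simps A_def B_def z_def)
  qed
qed

lemma phi_Cauchy_Schwarz_one: "a \<in> L \<Longrightarrow> (cmod (\<phi> a))\<^sup>2 \<le> Re (\<phi> \<e>) * Re (\<phi> (a\<dagger> \<otimes> a))"
  using phi_Cauchy_Schwarz[of a \<e>] by (simp add: mult.commute)

text \<open>Compression by b sends the square of a to the square of a b.\<close>

lemma phi_conj:
  assumes b: "b \<in> L"
  shows "pos_functional (\<lambda>x. \<phi> (b\<dagger> \<otimes> x \<otimes> b))"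
proof -
  have "b\<dagger> \<otimes> (a\<dagger> \<otimes> a) \<otimes> b = (a \<otimes> b)\<dagger> \<otimes> (a \<otimes> b)" if "a \<in> L" for a
    using that b by (simp add: star_mul mul_assoc)
  then show ?thesis
    using b phi_Im phi_Re unfolding pos_functional_def
    by (auto simp: mul_add_left mul_add_right mul_smult_left mul_smult_right phi_add phi_smult)
qed

text \<open>Automatic boundedness: after scaling a\<dagger> a to norm at most 1, the unit minus it
  is the square of a self-adjoint element by \<open>l1_sqrt\<close>, so the functional is
  nonnegative there.\<close>

lemma phi_le_l1_norm:
  assumes a: "a \<in> L"
  shows "Re (\<phi> (a\<dagger> \<otimes> a)) \<le> Re (\<phi> \<e>) * (l1_norm a)\<^sup>2"
proof (cases "l1_norm a = 0")
  case True
  then have "a = (\<lambda>k x. 0)" using a by (intro l1_norm_eq_0) auto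
  then have "a\<dagger> \<otimes> a = (\<lambda>k x. 0)" by (simp add: l1_mult_def)
  then show ?thesis using True by (simp add: phi_zero)
next
  case False
  define c where "c = inverse ((l1_norm a)\<^sup>2)"
  have c: "c > 0" "c * (l1_norm a)\<^sup>2 = 1" using False by (auto simp: c_def)
  define x where "x = of_real c \<odot> (a\<dagger> \<otimes> a)"
  have x: "x \<in> L" using a by (simp add: x_def)
  have xs: "x\<dagger> = x" by (simp add: x_def star_smult star_mul)
  have "l1_norm x \<le> c * l1_norm (a\<dagger> \<otimes> a)"
    using l1_norm_smult_le[of "a\<dagger> \<otimes> a" "of_real c"] a c by (simp add: x_def)
  also have "l1_norm (a\<dagger> \<otimes> a) \<le> l1_norm (a\<dagger>) * l1_norm a" using a by (simp add: l1_norm_mul)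
  also have "\<dots> \<le> (l1_norm a)\<^sup>2"
    using l1_norm_star_le[OF a] a by (simp add: power2_eq_square mult_right_mono)
  finally have "l1_norm x \<le> 1" using c by (simp add: mult_left_mono)
  then obtain y where y: "y \<in> L" "y\<dagger> = y" "y \<otimes> y = \<e> \<ominus> x"
    using l1_sqrt[OF x xs] by blast
  have "0 \<le> Re (\<phi> (\<e> \<ominus> x))" using phi_Re[OF y(1)] y by simp
  then have "c * Re (\<phi> (a\<dagger> \<otimes> a)) \<le> Re (\<phi> \<e>)"
    using a x by (simp add: phi_diff) (simp add: x_def phi_smult)
  then have "(l1_norm a)\<^sup>2 * (c * Re (\<phi> (a\<dagger> \<otimes> a))) \<le> (l1_norm a)\<^sup>2 * Re (\<phi> \<e>)"
    by (rule mult_left_mono) simp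
  also have "(l1_norm a)\<^sup>2 * (c * Re (\<phi> (a\<dagger> \<otimes> a))) = Re (\<phi> (a\<dagger> \<otimes> a))"
    using c(2) by (simp add: mult.commute mult.left_commute)
  finally show ?thesis by (simp add: mult.commute)
qed

end

text \<open>The canonical expectation onto C(X) followed by evaluation at x; equivalently the vector
  state of e_0 in the regular representation over the orbit of x.\<close>

definition tau :: "'a \<Rightarrow> 'a l1 \<Rightarrow> complex" where
  "tau x a = a 0 x"

text \<open>At x, the coefficient of a\<dagger> a at 0 is the sum of the squared moduli of the
  coefficients of a, each taken at a point of the orbit of x.\<close>

lemma tau_state: "l1_state \<sigma> (tau x)"
proof -
  have "Im ((a\<dagger> \<otimes> a) 0 x) = 0 \<and> 0 \<le> Re ((a\<dagger> \<otimes> a) 0 x)" if a: "a \<in> L" for a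
  proof -
    let ?f = "\<lambda>k. (a\<dagger>) k x * a (0 - k) (tr (- k) x)"
    have s: "?f summable_on UNIV" using a by (intro mul_summable) auto
    have f: "?f k = of_real ((cmod (a (- k) (tr (- k) x)))\<^sup>2)" for k
      using complex_norm_square[of "a (- k) (tr (- k) x)"]
      by (simp add: l1_star_def mult.commute del: of_real_power)
    have "(a\<dagger> \<otimes> a) 0 x = infsum ?f UNIV" by (simp add: l1_mult_def)
    moreover have "Re (infsum ?f UNIV) = infsum (\<lambda>k. Re (?f k)) UNIV" by (rule infsum_Re[OF s, symmetric])
    moreover have "Im (infsum ?f UNIV) = infsum (\<lambda>k. Im (?f k)) UNIV" by (rule infsum_Im[OF s, symmetric])
    moreover have "infsum (\<lambda>k. Im (?f k)) UNIV = 0" unfolding f by simp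
    moreover have "infsum (\<lambda>k. Re (?f k)) UNIV \<ge> 0" unfolding f by (intro infsum_nonneg) simp
    ultimately show ?thesis by simp
  qed
  then show ?thesis
    by (auto simp: l1_state_def tau_def l1_add_def l1_smult_def coef0_def)
qed

section \<open>The C*-seminorm as a supremum over states\<close>

abbreviation "nrm \<equiv> cs_norm \<sigma>"

lemma state_functional: "l1_state \<sigma> \<phi> \<Longrightarrow> pos_functional \<phi>"
  by (simp add: state_iff)

lemma nrm_nonempty: "{Re (\<phi> (a\<dagger> \<otimes> a)) | \<phi>. l1_state \<sigma> \<phi>} \<noteq> {}"
  using tau_state by blast

lemma state_le_l1_norm: "l1_state \<sigma> \<phi> \<Longrightarrow> a \<in> L \<Longrightarrow> Re (\<phi> (a\<dagger> \<otimes> a)) \<le> (l1_norm a)\<^sup>2"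
  using phi_le_l1_norm[of \<phi> a] by (simp add: state_iff)

lemma nrm_bdd: "a \<in> L \<Longrightarrow> bdd_above {Re (\<phi> (a\<dagger> \<otimes> a)) | \<phi>. l1_state \<sigma> \<phi>}"
  by (rule bdd_aboveI[of _ "(l1_norm a)\<^sup>2"])
    (auto simp: state_le_l1_norm)

lemma nrm_least:
  assumes "0 \<le> M" and "\<And>\<phi>. l1_state \<sigma> \<phi> \<Longrightarrow> Re (\<phi> (a\<dagger> \<otimes> a)) \<le> M\<^sup>2"
  shows "nrm a \<le> M"
proof -
  have "Sup {Re (\<phi> (a\<dagger> \<otimes> a)) | \<phi>. l1_state \<sigma> \<phi>} \<le> M\<^sup>2"
    using nrm_nonempty assms by (intro cSup_least) auto
  then show ?thesis unfolding cs_norm_def using assms(1) by (simp add: real_le_lsqrt)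
qed

lemma nrm_upper_aux:
  assumes a: "a \<in> L"
  shows "0 \<le> Sup {Re (\<phi> (a\<dagger> \<otimes> a)) | \<phi>. l1_state \<sigma> \<phi>}"
    and "l1_state \<sigma> \<phi> \<Longrightarrow> Re (\<phi> (a\<dagger> \<otimes> a)) \<le> Sup {Re (\<phi> (a\<dagger> \<otimes> a)) | \<phi>. l1_state \<sigma> \<phi>}"
proof -
  show *: "Re (\<phi> (a\<dagger> \<otimes> a)) \<le> Sup {Re (\<phi> (a\<dagger> \<otimes> a)) | \<phi>. l1_state \<sigma> \<phi>}" if "l1_state \<sigma> \<phi>" for \<phi>
    using that by (intro cSup_upper nrm_bdd[OF a]) auto
  show "0 \<le> Sup {Re (\<phi> (a\<dagger> \<otimes> a)) | \<phi>. l1_state \<sigma> \<phi>}"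
    using *[OF tau_state] phi_Re[OF state_functional[OF tau_state] a] order_trans by blast
qed

lemma nrm_nonneg [simp]: "a \<in> L \<Longrightarrow> 0 \<le> nrm a"
  using nrm_upper_aux(1)[of a] by (simp add: cs_norm_def)

lemma state_le_nrm: "a \<in> L \<Longrightarrow> l1_state \<sigma> \<phi> \<Longrightarrow> Re (\<phi> (a\<dagger> \<otimes> a)) \<le> (nrm a)\<^sup>2"
  using nrm_upper_aux[of a] by (simp add: cs_norm_def)

lemma state_normalized:
  assumes phi: "pos_functional \<phi>" and "Re (\<phi> \<e>) \<noteq> 0"
  shows "l1_state \<sigma> (\<lambda>x. \<phi> x / of_real (Re (\<phi> \<e>)))"
proof -
  define r where "r = Re (\<phi> \<e>)"
  have "r > 0" "\<phi> \<e> = of_real r" using assms(2) phi_one[OF phi] by (auto simp: r_def)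
  then show ?thesis
    using phi unfolding r_def[symmetric] state_iff pos_functional_def by (auto simp: add_divide_distrib)
qed

text \<open>Normalise to a state; if the value at the unit is 0, Cauchy-Schwarz makes the functional
  vanish.\<close>

lemma functional_le_nrm:
  assumes phi: "pos_functional \<phi>" and a: "a \<in> L"
  shows "Re (\<phi> (a\<dagger> \<otimes> a)) \<le> Re (\<phi> \<e>) * (nrm a)\<^sup>2"
proof (cases "Re (\<phi> \<e>) = 0")
  case True
  then have "(cmod (\<phi> (a\<dagger> \<otimes> a)))\<^sup>2 \<le> 0"
    using phi_Cauchy_Schwarz_one[OF phi, of "a\<dagger> \<otimes> a"] a by simp
  then show ?thesis using True by simp
next
  case False
  then have "Re (\<phi> \<e>) > 0" using phi_one(1)[OF phi] by simp
  then show ?thesis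
    using state_le_nrm[OF a state_normalized[OF phi False]] by (simp add: field_simps)
qed

lemma functional_bound:
  assumes phi: "pos_functional \<phi>" and a: "a \<in> L"
  shows "cmod (\<phi> a) \<le> Re (\<phi> \<e>) * nrm a"
proof -
  have "(cmod (\<phi> a))\<^sup>2 \<le> Re (\<phi> \<e>) * Re (\<phi> (a\<dagger> \<otimes> a))" by (rule phi_Cauchy_Schwarz_one[OF phi a])
  also have "\<dots> \<le> (Re (\<phi> \<e>) * nrm a)\<^sup>2"
    using mult_left_mono[OF functional_le_nrm[OF phi a] phi_one(1)[OF phi]] by (simp only: mult_mult_square)
  finally show ?thesis
    by (rule power2_le_imp_le) (use phi_one(1)[OF phi] a in auto)
qed

lemma state_bound: "l1_state \<sigma> \<phi> \<Longrightarrow> a \<in> L \<Longrightarrow> cmod (\<phi> a) \<le> nrm a"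
  using functional_bound[of \<phi> a] by (simp add: state_iff)

lemma nrm_le_l1_norm: "a \<in> L \<Longrightarrow> nrm a \<le> l1_norm a"
  by (rule nrm_least) (auto simp: state_le_l1_norm)

lemma nrm_smult_le: "a \<in> L \<Longrightarrow> nrm (c \<odot> a) \<le> cmod c * nrm a"
proof (rule nrm_least)
  fix \<phi> assume a: "a \<in> L" and s: "l1_state \<sigma> \<phi>"
  note phi = state_functional[OF s]
  have "\<phi> ((c \<odot> a)\<dagger> \<otimes> (c \<odot> a)) = of_real ((cmod c)\<^sup>2) * \<phi> (a\<dagger> \<otimes> a)"
    using a complex_norm_square[of c] by (simp add: expand phi_smult[OF phi] mult.commute del: of_real_power)
  then have "Re (\<phi> ((c \<odot> a)\<dagger> \<otimes> (c \<odot> a))) = (cmod c)\<^sup>2 * Re (\<phi> (a\<dagger> \<otimes> a))"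
    by (simp del: of_real_power)
  then show "Re (\<phi> ((c \<odot> a)\<dagger> \<otimes> (c \<odot> a))) \<le> (cmod c * nrm a)\<^sup>2"
    using state_le_nrm[OF a s] by (simp add: power_mult_distrib mult_left_mono)
qed simp

lemma nrm_add: "a \<in> L \<Longrightarrow> b \<in> L \<Longrightarrow> nrm (a \<oplus> b) \<le> nrm a + nrm b"
proof (rule nrm_least)
  fix \<phi> assume a: "a \<in> L" and b: "b \<in> L" and s: "l1_state \<sigma> \<phi>"
  note phi = state_functional[OF s]
  let ?A = "Re (\<phi> (a\<dagger> \<otimes> a))" and ?B = "Re (\<phi> (b\<dagger> \<otimes> b))" and ?z = "\<phi> (b\<dagger> \<otimes> a)"
  have A: "?A \<le> (nrm a)\<^sup>2" "0 \<le> ?A" "?B \<le> (nrm b)\<^sup>2" "0 \<le> ?B"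
    using a b state_le_nrm[OF _ s] phi_Re[OF phi] by auto
  have "(cmod ?z)\<^sup>2 \<le> ?A * ?B" by (rule phi_Cauchy_Schwarz[OF phi a b])
  also have "\<dots> \<le> (nrm a)\<^sup>2 * (nrm b)\<^sup>2" using A by (intro mult_mono) auto
  finally have z: "cmod ?z \<le> nrm a * nrm b"
    unfolding power_mult_distrib[symmetric] by (rule power2_le_imp_le) (use a b in auto)
  have "Re (\<phi> ((a \<oplus> b)\<dagger> \<otimes> (a \<oplus> b))) = ?A + 2 * Re ?z + ?B"
    using phi_expand[OF phi a b, of 1] phi_hermitian[OF phi a b] by simp
  also have "\<dots> \<le> (nrm a)\<^sup>2 + 2 * (nrm a * nrm b) + (nrm b)\<^sup>2"
    using A z complex_Re_le_cmod[of ?z] by linarith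
  finally show "Re (\<phi> ((a \<oplus> b)\<dagger> \<otimes> (a \<oplus> b))) \<le> (nrm a + nrm b)\<^sup>2"
    by (simp add: power2_eq_square algebra_simps)
qed simp

text \<open>The square of a b is a\<dagger> a seen by the compressed functional of
  \<open>phi_conj\<close>, whose value at the unit is the state at b\<dagger> b.\<close>

lemma nrm_mul: "a \<in> L \<Longrightarrow> b \<in> L \<Longrightarrow> nrm (a \<otimes> b) \<le> nrm a * nrm b"
proof (rule nrm_least)
  fix \<phi> assume a: "a \<in> L" and b: "b \<in> L" and s: "l1_state \<sigma> \<phi>"
  note phi = state_functional[OF s]
  have "Re (\<phi> ((a \<otimes> b)\<dagger> \<otimes> (a \<otimes> b))) = Re (\<phi> (b\<dagger> \<otimes> (a\<dagger> \<otimes> a) \<otimes> b))"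
    using a b by (simp add: star_mul mul_assoc)
  also have "\<dots> \<le> Re (\<phi> (b\<dagger> \<otimes> \<e> \<otimes> b)) * (nrm a)\<^sup>2"
    by (rule functional_le_nrm[OF phi_conj[OF phi b] a])
  also have "\<dots> \<le> (nrm b)\<^sup>2 * (nrm a)\<^sup>2"
    using state_le_nrm[OF b s] by (simp add: mult_right_mono)
  finally show "Re (\<phi> ((a \<otimes> b)\<dagger> \<otimes> (a \<otimes> b))) \<le> (nrm a * nrm b)\<^sup>2"
    by (simp add: power_mult_distrib mult.commute)
qed simp

lemma submult_nrm: "submult_seminorm nrm"
  by (simp add: submult_seminorm_def nrm_add nrm_mul nrm_smult_le)

text \<open>Let t be the state at a a\<dagger>. Cauchy-Schwarz bounds t squared by the state at the
  square of a a\<dagger>; compression by a\<dagger> bounds that by t times the squared norm of a.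
  Cancel t.\<close>

lemma nrm_star_le: "a \<in> L \<Longrightarrow> nrm (a\<dagger>) \<le> nrm a"
proof (rule nrm_least)
  fix \<phi> assume a: "a \<in> L" and s: "l1_state \<sigma> \<phi>"
  note phi = state_functional[OF s]
  let ?t = "Re (\<phi> (a \<otimes> a\<dagger>))"
  have t0: "0 \<le> ?t" using phi_Re[OF phi, of "a\<dagger>"] a by simp
  have "?t\<^sup>2 \<le> (cmod (\<phi> (a \<otimes> a\<dagger>)))\<^sup>2"
    using abs_Re_le_cmod by (simp add: power2_le_iff_abs_le)
  also have "\<dots> \<le> Re (\<phi> ((a \<otimes> a\<dagger>)\<dagger> \<otimes> (a \<otimes> a\<dagger>)))"
    using phi_Cauchy_Schwarz_one[OF phi, of "a \<otimes> a\<dagger>"] a s by (simp add: state_iff)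
  also have "(a \<otimes> a\<dagger>)\<dagger> \<otimes> (a \<otimes> a\<dagger>) = (a\<dagger>)\<dagger> \<otimes> (a\<dagger> \<otimes> a) \<otimes> a\<dagger>"
    using a by (simp add: star_mul mul_assoc)
  also have "Re (\<phi> \<dots>) \<le> Re (\<phi> ((a\<dagger>)\<dagger> \<otimes> \<e> \<otimes> a\<dagger>)) * (nrm a)\<^sup>2"
    by (rule functional_le_nrm[OF phi_conj[OF phi] a]) (use a in simp)
  finally have "?t * ?t \<le> ?t * (nrm a)\<^sup>2" by (simp add: power2_eq_square)
  then have "?t \<le> (nrm a)\<^sup>2" using t0 by (cases "?t = 0") (auto simp: mult_le_cancel_left)
  then show "Re (\<phi> ((a\<dagger>)\<dagger> \<otimes> a\<dagger>)) \<le> (nrm a)\<^sup>2" by simp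
qed simp

lemma nrm_one: "nrm \<e> = 1"
proof (rule antisym)
  show "nrm \<e> \<le> 1" by (rule nrm_least) (auto simp: state_iff)
  have "tau x \<e> = 1" for x by (simp add: tau_def coef0_def)
  then show "1 \<le> nrm \<e>" using state_bound[OF tau_state, of \<e>] by simp
qed

lemma nrm_zero [simp]: "nrm (\<lambda>k x. 0) = 0"
  by (rule p_zero[OF submult_nrm])

text \<open>The identity (1+h)h(1+h) - (1-h)h(1-h) = 4hh bounds the norm by the numerical radius.\<close>

lemma nrm_selfadjoint_le:
  assumes h: "h \<in> L" "h\<dagger> = h" and w: "\<And>\<phi>. l1_state \<sigma> \<phi> \<Longrightarrow> \<bar>Re (\<phi> h)\<bar> \<le> 1"
  shows "nrm h \<le> 1"
proof (rule nrm_least)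
  fix \<phi> assume s: "l1_state \<sigma> \<phi>"
  note phi = state_functional[OF s]
  have w': "\<bar>Re (\<psi> h)\<bar> \<le> Re (\<psi> \<e>)" if psi: "pos_functional \<psi>" for \<psi>
  proof (cases "Re (\<psi> \<e>) = 0")
    case True
    have "(cmod (\<psi> h))\<^sup>2 \<le> 0" using phi_Cauchy_Schwarz_one[OF psi h(1)] True by simp
    then show ?thesis using True by simp
  next
    case False
    then have "Re (\<psi> \<e>) > 0" using phi_one(1)[OF psi] by simp
    then show ?thesis
      using w[OF state_normalized[OF psi False]] by (simp add: field_simps abs_le_iff)
  qed
  let ?p = "\<e> \<oplus> h" and ?m = "\<e> \<ominus> h"
  have pm: "?p \<in> L" "?m \<in> L" "?p\<dagger> = ?p" "?m\<dagger> = ?m" using h by (auto simp: star_add diff_conv star_smult)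
  have "\<bar>Re (\<phi> (?p\<dagger> \<otimes> h \<otimes> ?p))\<bar> \<le> Re (\<phi> (?p\<dagger> \<otimes> \<e> \<otimes> ?p))"
    "\<bar>Re (\<phi> (?m\<dagger> \<otimes> h \<otimes> ?m))\<bar> \<le> Re (\<phi> (?m\<dagger> \<otimes> \<e> \<otimes> ?m))"
    using w'[OF phi_conj[OF phi]] pm by blast+
  then have 1: "Re (\<phi> (?p \<otimes> h \<otimes> ?p)) - Re (\<phi> (?m \<otimes> h \<otimes> ?m)) \<le> Re (\<phi> (?p \<otimes> ?p)) + Re (\<phi> (?m \<otimes> ?m))"
    unfolding pm mul_one by linarith
  have "\<phi> (?p \<otimes> h \<otimes> ?p) - \<phi> (?m \<otimes> h \<otimes> ?m) = 4 * \<phi> (h \<otimes> h)"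
    "\<phi> (?p \<otimes> ?p) + \<phi> (?m \<otimes> ?m) = 2 * \<phi> \<e> + 2 * \<phi> (h \<otimes> h)"
    using h by (simp_all add: expand phi_add[OF phi] phi_smult[OF phi])
  then have "4 * Re (\<phi> (h \<otimes> h)) \<le> 2 * Re (\<phi> \<e>) + 2 * Re (\<phi> (h \<otimes> h))"
    using 1 by (simp add: complex_eq_iff)
  then show "Re (\<phi> (h\<dagger> \<otimes> h)) \<le> 1\<^sup>2"
    using s by (simp add: h state_iff)
qed simp

text \<open>Apply the self-adjoint case to the real and imaginary parts of a, scaled by w. The
  factor 2 from the splitting is harmless, since the bound serves to show that norms tend to
  0.\<close>

lemma nrm_le_numerical_radius:
  assumes a: "a \<in> L" and w: "\<And>\<phi>. l1_state \<sigma> \<phi> \<Longrightarrow> cmod (\<phi> a) \<le> w" and w0: "w > 0"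
  shows "nrm a \<le> 2 * w"
proof -
  define u v where "u = of_real (1/(2*w)) \<odot> (a \<oplus> a\<dagger>)" and "v = (\<i> / of_real (2*w)) \<odot> (a\<dagger> \<ominus> a)"
  have uv: "u \<in> L" "v \<in> L" using a by (auto simp: u_def v_def)
  have uvs: "u\<dagger> = u" "v\<dagger> = v"
    unfolding u_def v_def using w0
    by (simp_all add: star_add star_smult diff_conv) (simp_all add: vec_defs field_simps)
  have "\<bar>Re (\<phi> u)\<bar> \<le> 1" "\<bar>Re (\<phi> v)\<bar> \<le> 1" if s: "l1_state \<sigma> \<phi>" for \<phi>
  proof -
    note phi = state_functional[OF s]
    have "\<phi> u = of_real (Re (\<phi> a) / w)"
      using a w0 by (simp add: u_def phi_smult[OF phi] phi_add[OF phi] phi_star[OF phi] complex_eq_iff)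
    then show "\<bar>Re (\<phi> u)\<bar> \<le> 1"
      using w[OF s] w0 abs_Re_le_cmod[of "\<phi> a"] by simp
    have "\<phi> v = of_real (Im (\<phi> a) / w)"
      using a w0 by (simp add: v_def phi_smult[OF phi] phi_diff[OF phi] phi_star[OF phi] complex_eq_iff)
    then show "\<bar>Re (\<phi> v)\<bar> \<le> 1"
      using w[OF s] w0 abs_Im_le_cmod[of "\<phi> a"] by simp
  qed
  then have n: "nrm u \<le> 1" "nrm v \<le> 1" using uv uvs by (auto intro: nrm_selfadjoint_le)
  have "a = of_real w \<odot> u \<oplus> (of_real w * \<i>) \<odot> v"
    using w0 by (simp add: u_def v_def vec_defs field_simps)
  then have "nrm a \<le> nrm (of_real w \<odot> u) + nrm ((of_real w * \<i>) \<odot> v)"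
    using nrm_add[of "of_real w \<odot> u" "(of_real w * \<i>) \<odot> v"] uv by simp
  also have "\<dots> \<le> w * nrm u + w * nrm v"
    using nrm_smult_le[of u "of_real w"] nrm_smult_le[of v "of_real w * \<i>"] uv w0
    by (simp add: norm_mult)
  also have "\<dots> \<le> w * 1 + w * 1" using n w0 by (intro add_mono mult_left_mono) auto
  finally show ?thesis by simp
qed

lemma nrm_diff_le: "a \<in> L \<Longrightarrow> b \<in> L \<Longrightarrow> nrm (a \<ominus> b) \<le> nrm a + nrm b"
  using nrm_add[of a "(- 1) \<odot> b"] nrm_smult_le[of b "- 1"] by (simp add: diff_conv)

lemma nrm_diff_triangle: 
  assumes "a \<in> L" "b \<in> L" "c \<in> L" shows "nrm (a \<ominus> c) \<le> nrm (a \<ominus> b) + nrm (b \<ominus> c)"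
proof -
  have "a \<ominus> c = (a \<ominus> b) \<oplus> (b \<ominus> c)" by (simp add: vec_defs)
  then show ?thesis using nrm_add[of "a \<ominus> b" "b \<ominus> c"] assms by simp
qed

lemma nrm_diff_commute: "a \<in> L \<Longrightarrow> b \<in> L \<Longrightarrow> nrm (a \<ominus> b) = nrm (b \<ominus> a)"
  by (intro antisym p_diff_commute[OF submult_nrm])

lemma nrm_le_diff: "a \<in> L \<Longrightarrow> b \<in> L \<Longrightarrow> nrm a \<le> nrm (a \<ominus> b) + nrm b"
  using nrm_diff_triangle[of a b "\<lambda>k x. 0"] by (simp add: l1_diff_def)

lemma nrm_fdelta: "f \<in> CX \<Longrightarrow> nrm (fdelta f k) \<le> supn f"
  using nrm_le_l1_norm[of "fdelta f k"] l1_norm_fdelta[of f k] by simp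

text \<open>Multiplication by delta to the power -n moves the n-th coefficient to index 0, where the
  state \<open>tau x\<close> reads it. Uniformity in x and n is what later makes Fourier
  coefficients continuous on the completion.\<close>

lemma cmod_le_nrm:
  assumes a: "a \<in> L"
  shows "cmod (a n x) \<le> nrm a"
proof -
  let ?d = "fdelta (\<lambda>x. 1) (- n) :: 'a l1"
  have "supn (\<lambda>x::'a. 1) \<le> 1" by (rule supn_least) simp
  then have d: "nrm ?d \<le> 1" using nrm_fdelta[of "\<lambda>x. 1" "- n"] by simp
  have "tau x (a \<otimes> ?d) = a n x" by (simp add: tau_def mul_fdelta_right)
  then have "cmod (a n x) \<le> nrm (a \<otimes> ?d)" using state_bound[OF tau_state, of "a \<otimes> ?d" x] a by simp
  also have "\<dots> \<le> nrm a * nrm ?d" using a by (simp add: nrm_mul)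
  also have "\<dots> \<le> nrm a * 1" using d a by (intro mult_left_mono) auto
  finally show ?thesis by simp
qed

section \<open>The completion\<close>

abbreviation "cseq \<equiv> cs_seq \<sigma>"
abbreviation "cls \<equiv> cs_class \<sigma>"

definition cs_equiv :: "(nat \<Rightarrow> 'a l1) \<Rightarrow> (nat \<Rightarrow> 'a l1) \<Rightarrow> bool" where
  "cs_equiv s t \<longleftrightarrow> (\<lambda>n. nrm (s n \<ominus> t n)) \<longlonglongrightarrow> 0"

lemma l1_diff_apply: "(a \<ominus> b) n x = a n x - b n x"
  by (simp add: l1_diff_def)

lemma cseq_l1 [simp]: "cseq s \<Longrightarrow> s n \<in> L"
  by (simp add: cs_seq_def)

lemma cseqD:
  assumes "cseq s" "e > 0"
  obtains N where "\<And>m n. m \<ge> N \<Longrightarrow> n \<ge> N \<Longrightarrow> nrm (s m \<ominus> s n) < e"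
  using assms unfolding cs_seq_def by blast

text \<open>A single Lipschitz criterion for all operations; unary ones use the same sequence
  twice.\<close>

lemma cseqI:
  assumes s: "cseq s" and t: "cseq t" and f: "\<And>n. f n \<in> L" and K: "K > 0"
    and le: "\<And>m n. nrm (f m \<ominus> f n) \<le> K * (nrm (s m \<ominus> s n) + nrm (t m \<ominus> t n))"
  shows "cseq f"
  unfolding cs_seq_def
proof (intro conjI allI impI)
  fix e :: real assume "e > 0"
  then have e: "e / (2 * K) > 0" using K by simp
  obtain N1 where N1: "\<And>m n. m \<ge> N1 \<Longrightarrow> n \<ge> N1 \<Longrightarrow> nrm (s m \<ominus> s n) < e / (2 * K)"
    using cseqD[OF s e] by blast
  obtain N2 where N2: "\<And>m n. m \<ge> N2 \<Longrightarrow> n \<ge> N2 \<Longrightarrow> nrm (t m \<ominus> t n) < e / (2 * K)"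
    using cseqD[OF t e] by blast
  have "nrm (f m \<ominus> f n) < e" if "m \<ge> max N1 N2" "n \<ge> max N1 N2" for m n
  proof -
    have "nrm (s m \<ominus> s n) + nrm (t m \<ominus> t n) < e / (2 * K) + e / (2 * K)"
      using that by (intro add_strict_mono N1 N2) auto
    also have "\<dots> = e / K" using K by simp
    finally have "K * (nrm (s m \<ominus> s n) + nrm (t m \<ominus> t n)) < e" using K by (simp add: field_simps)
    then show ?thesis using le[of m n] by linarith
  qed
  then show "\<exists>N. \<forall>m\<ge>N. \<forall>n\<ge>N. nrm (f m \<ominus> f n) < e" by blast
qed (rule f)

lemma cs_equivI:
  assumes s: "cs_equiv s s'" and t: "cs_equiv t t'" and f: "\<And>n. f n \<in> L" "\<And>n. f' n \<in> L"
    and le: "\<And>n. nrm (f n \<ominus> f' n) \<le> K * (nrm (s n \<ominus> s' n) + nrm (t n \<ominus> t' n))"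
  shows "cs_equiv f f'"
  unfolding cs_equiv_def
proof (rule tendsto_sandwich[OF _ _ tendsto_const])
  show "(\<lambda>n. K * (nrm (s n \<ominus> s' n) + nrm (t n \<ominus> t' n))) \<longlonglongrightarrow> 0"
    using tendsto_mult_left[OF tendsto_add[OF s[unfolded cs_equiv_def] t[unfolded cs_equiv_def]], of K] by simp
qed (use le f in auto)

lemma cseq_const [simp]: "a \<in> L \<Longrightarrow> cseq (\<lambda>n. a)"
proof -
  assume "a \<in> L"
  moreover have "a \<ominus> a = (\<lambda>k x. 0)" by (simp add: vec_defs)
  ultimately show ?thesis by (simp add: cs_seq_def)
qed

lemma cseq_bounded:
  assumes s: "cseq s"
  obtains M where "M > 0" "\<And>n. nrm (s n) \<le> M"
proof -
  obtain N where N: "\<And>m n. m \<ge> N \<Longrightarrow> n \<ge> N \<Longrightarrow> nrm (s m \<ominus> s n) < 1"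
    using cseqD[OF s zero_less_one] by blast
  define M where "M = (\<Sum>i\<le>N. nrm (s i)) + 1"
  have i: "nrm (s i) \<le> (\<Sum>i\<le>N. nrm (s i))" if "i \<le> N" for i
    using that s by (intro member_le_sum) auto
  have "nrm (s n) \<le> M" for n
  proof (cases "n \<le> N")
    case True
    then show ?thesis using i[of n] by (simp add: M_def)
  next
    case False
    then have "nrm (s n) \<le> nrm (s n \<ominus> s N) + nrm (s N)" using s by (intro nrm_le_diff) auto
    then show ?thesis using N[of n N] False i[of N] by (simp add: M_def)
  qed
  moreover have "M > 0" unfolding M_def using s by (intro add_nonneg_pos sum_nonneg) auto
  ultimately show ?thesis by (rule that[rotated])
qed

lemma nrm_add_diff:
  assumes "a \<in> L" "b \<in> L" "a' \<in> L" "b' \<in> L"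
  shows "nrm ((a \<oplus> b) \<ominus> (a' \<oplus> b')) \<le> nrm (a \<ominus> a') + nrm (b \<ominus> b')"
proof -
  have "(a \<oplus> b) \<ominus> (a' \<oplus> b') = (a \<ominus> a') \<oplus> (b \<ominus> b')" by (simp add: vec_defs)
  then show ?thesis using nrm_add[of "a \<ominus> a'" "b \<ominus> b'"] assms by simp
qed

lemma nrm_smult_diff:
  assumes "a \<in> L" "a' \<in> L"
  shows "nrm (c \<odot> a \<ominus> c \<odot> a') \<le> (cmod c + 1) * nrm (a \<ominus> a')"
proof -
  have "c \<odot> a \<ominus> c \<odot> a' = c \<odot> (a \<ominus> a')" by (simp add: vec_defs algebra_simps)
  then have "nrm (c \<odot> a \<ominus> c \<odot> a') \<le> cmod c * nrm (a \<ominus> a')"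
    using nrm_smult_le[of "a \<ominus> a'" c] assms by simp
  also have "\<dots> \<le> (cmod c + 1) * nrm (a \<ominus> a')" using assms by (intro mult_right_mono) auto
  finally show ?thesis .
qed

lemma star_diff: "a\<dagger> \<ominus> b\<dagger> = (a \<ominus> b)\<dagger>"
  by (simp add: diff_conv star_add star_smult)

lemma nrm_star_diff: "a \<in> L \<Longrightarrow> a' \<in> L \<Longrightarrow> nrm (a\<dagger> \<ominus> a'\<dagger>) \<le> nrm (a \<ominus> a')"
  unfolding star_diff by (simp add: nrm_star_le)

lemma nrm_mul_diff:
  assumes L: "a \<in> L" "b \<in> L" "a' \<in> L" "b' \<in> L" and M: "nrm a \<le> M" "nrm b' \<le> M"
  shows "nrm (a \<otimes> b \<ominus> a' \<otimes> b') \<le> M * (nrm (a \<ominus> a') + nrm (b \<ominus> b'))"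
proof -
  have "a \<otimes> b \<ominus> a' \<otimes> b' = a \<otimes> (b \<ominus> b') \<oplus> (a \<ominus> a') \<otimes> b'"
    using L by (simp add: expand) (simp add: vec_defs)
  then have "nrm (a \<otimes> b \<ominus> a' \<otimes> b') \<le> nrm (a \<otimes> (b \<ominus> b')) + nrm ((a \<ominus> a') \<otimes> b')"
    using nrm_add[of "a \<otimes> (b \<ominus> b')" "(a \<ominus> a') \<otimes> b'"] L by simp
  also have "\<dots> \<le> nrm a * nrm (b \<ominus> b') + nrm (a \<ominus> a') * nrm b'"
    using L by (intro add_mono nrm_mul) auto
  also have "\<dots> \<le> M * nrm (b \<ominus> b') + nrm (a \<ominus> a') * M"
    using L M by (intro add_mono mult_mono order_refl nrm_nonneg l1_diff)
      (auto intro: order_trans[OF nrm_nonneg])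
  finally show ?thesis by (simp add: algebra_simps)
qed

lemma cseq_add [simp]: "cseq s \<Longrightarrow> cseq t \<Longrightarrow> cseq (\<lambda>n. s n \<oplus> t n)"
  by (rule cseqI[of s t _ 1]) (auto intro: nrm_add_diff)

lemma cseq_smult [simp]: 
  assumes s: "cseq s" shows "cseq (\<lambda>n. c \<odot> s n)"
proof (rule cseqI[OF s s, of _ "cmod c + 1"])
  fix m n
  have "(cmod c + 1) * nrm (s m \<ominus> s n) \<le> (cmod c + 1) * (nrm (s m \<ominus> s n) + nrm (s m \<ominus> s n))"
    using s by (intro mult_left_mono) auto
  then show "nrm (c \<odot> s m \<ominus> c \<odot> s n) \<le> (cmod c + 1) * (nrm (s m \<ominus> s n) + nrm (s m \<ominus> s n))"
    using nrm_smult_diff[of "s m" "s n" c] s by (meson cseq_l1 order_trans)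
qed (use s in \<open>auto simp: add_nonneg_pos\<close>)

lemma cseq_diff [simp]: "cseq s \<Longrightarrow> cseq t \<Longrightarrow> cseq (\<lambda>n. s n \<ominus> t n)"
  unfolding diff_conv by simp

lemma cseq_star [simp]: "cseq s \<Longrightarrow> cseq (\<lambda>n. (s n)\<dagger>)"
  by (rule cseqI[of s s _ 1])
    (auto intro!: order_trans[OF nrm_star_diff] simp: add_increasing)

lemma cseq_mul [simp]:
  assumes s: "cseq s" and t: "cseq t" shows "cseq (\<lambda>n. s n \<otimes> t n)"
proof -
  obtain M1 where M1: "M1 > 0" "\<And>n. nrm (s n) \<le> M1" using cseq_bounded[OF s] by blast
  obtain M2 where M2: "M2 > 0" "\<And>n. nrm (t n) \<le> M2" using cseq_bounded[OF t] by blast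
  show ?thesis
  proof (rule cseqI[OF s t])
    fix m n
    show "nrm (s m \<otimes> t m \<ominus> s n \<otimes> t n) \<le> max M1 M2 * (nrm (s m \<ominus> s n) + nrm (t m \<ominus> t n))"
      using s t M1(2) M2(2) by (intro nrm_mul_diff) (auto simp: le_max_iff_disj)
  qed (use s t M1 in auto)
qed

section \<open>Equivalence classes and the operations on representatives\<close>

lemma cs_equiv_refl: "cseq s \<Longrightarrow> cs_equiv s s"
proof -
  have "a \<ominus> a = (\<lambda>k x. 0)" for a :: "'a l1" by (simp add: vec_defs)
  then show ?thesis by (simp add: cs_equiv_def)
qed

lemma cs_equiv_sym: "cseq s \<Longrightarrow> cseq t \<Longrightarrow> cs_equiv s t \<Longrightarrow> cs_equiv t s"
  unfolding cs_equiv_def by (simp add: nrm_diff_commute)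

lemma cs_equiv_trans: 
  assumes "cseq s" "cseq t" "cseq u" "cs_equiv s t" "cs_equiv t u" shows "cs_equiv s u"
  by (rule cs_equivI[OF assms(4,5), of _ _ 1]) (use assms in \<open>auto intro!: nrm_diff_triangle\<close>)

lemma mem_cls: "t \<in> cls s \<longleftrightarrow> cseq t \<and> cs_equiv t s"
  by (simp add: cs_class_def cs_equiv_def)

lemma cls_eq_iff:
  assumes "cseq s" "cseq t" shows "cls s = cls t \<longleftrightarrow> cs_equiv s t"
proof
  assume "cls s = cls t"
  then show "cs_equiv s t" using assms cs_equiv_refl mem_cls by blast
next
  assume "cs_equiv s t"
  then show "cls s = cls t"
    using assms by (simp add: set_eq_iff mem_cls) (metis cs_equiv_trans cs_equiv_sym)
qed

lemma cls_Cstar [simp]: "cseq s \<Longrightarrow> cls s \<in> Cstar \<sigma>"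
  by (simp add: Cstar_def)

lemma Cstar_cases:
  assumes "A \<in> Cstar \<sigma>" obtains s where "cseq s" "A = cls s"
  using assms by (auto simp: Cstar_def)

lemma rep_cls:
  assumes "cseq s"
  shows "cseq (rep (cls s))" "cs_equiv (rep (cls s)) s"
proof -
  have "rep (cls s) \<in> cls s"
    unfolding rep_def by (rule someI[of _ s]) (simp add: mem_cls assms cs_equiv_refl)
  then show "cseq (rep (cls s))" "cs_equiv (rep (cls s)) s" by (simp_all add: mem_cls)
qed

lemma cadd_cls: "cseq s \<Longrightarrow> cseq t \<Longrightarrow> cadd \<sigma> (cls s) (cls t) = cls (\<lambda>n. s n \<oplus> t n)"
  unfolding cadd_def
  by (subst cls_eq_iff) (auto intro!: cs_equivI[OF rep_cls(2)[of s] rep_cls(2)[of t], of _ _ 1] nrm_add_diff simp: rep_cls)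

lemma csmult_cls: 
  assumes s: "cseq s" shows "csmult \<sigma> c (cls s) = cls (\<lambda>n. c \<odot> s n)"
proof -
  have "cs_equiv (\<lambda>n. c \<odot> rep (cls s) n) (\<lambda>n. c \<odot> s n)"
  proof (rule cs_equivI[OF rep_cls(2)[OF s] cs_equiv_refl[OF s], of _ _ "cmod c + 1"])
    fix n
    have "s n \<ominus> s n = (\<lambda>k x. 0)" by (simp add: vec_defs)
    then show "nrm (c \<odot> rep (cls s) n \<ominus> c \<odot> s n) \<le> (cmod c + 1) * (nrm (rep (cls s) n \<ominus> s n) + nrm (s n \<ominus> s n))"
      using nrm_smult_diff[of "rep (cls s) n" "s n" c] s rep_cls(1)[OF s] by simp
  qed (use s rep_cls(1)[OF s] in auto)
  then show ?thesis unfolding csmult_def using s by (subst cls_eq_iff) (auto simp: rep_cls)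
qed

lemma cstar_inv_cls: 
  assumes s: "cseq s" shows "cstar_inv \<sigma> (cls s) = cls (\<lambda>n. (s n)\<dagger>)"
proof -
  have "cs_equiv (\<lambda>n. (rep (cls s) n)\<dagger>) (\<lambda>n. (s n)\<dagger>)"
  proof (rule cs_equivI[OF rep_cls(2)[OF s] cs_equiv_refl[OF s], of _ _ 1])
    fix n
    have "s n \<ominus> s n = (\<lambda>k x. 0)" by (simp add: vec_defs)
    then show "nrm ((rep (cls s) n)\<dagger> \<ominus> (s n)\<dagger>) \<le> 1 * (nrm (rep (cls s) n \<ominus> s n) + nrm (s n \<ominus> s n))"
      using nrm_star_diff[of "rep (cls s) n" "s n"] s rep_cls(1)[OF s] by simp
  qed (use s rep_cls(1)[OF s] in auto)
  then show ?thesis unfolding cstar_inv_def using s by (subst cls_eq_iff) (auto simp: rep_cls)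
qed

lemma cs_equiv_mul:
  assumes s: "cseq s" "cseq s'" "cs_equiv s s'" and t: "cseq t" "cseq t'" "cs_equiv t t'"
  shows "cs_equiv (\<lambda>n. s n \<otimes> t n) (\<lambda>n. s' n \<otimes> t' n)"
proof -
  obtain M1 where M1: "M1 > 0" "\<And>n. nrm (s n) \<le> M1" using cseq_bounded[OF s(1)] by blast
  obtain M2 where M2: "M2 > 0" "\<And>n. nrm (t' n) \<le> M2" using cseq_bounded[OF t(2)] by blast
  show ?thesis
  proof (rule cs_equivI[OF s(3) t(3)])
    fix n
    show "nrm (s n \<otimes> t n \<ominus> s' n \<otimes> t' n) \<le> max M1 M2 * (nrm (s n \<ominus> s' n) + nrm (t n \<ominus> t' n))"
      using s t M1(2) M2(2) by (intro nrm_mul_diff) (auto simp: le_max_iff_disj)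
  qed (use s t in auto)
qed

lemma cmul_cls: "cseq s \<Longrightarrow> cseq t \<Longrightarrow> cmul \<sigma> (cls s) (cls t) = cls (\<lambda>n. s n \<otimes> t n)"
  unfolding cmul_def by (subst cls_eq_iff) (auto intro!: cs_equiv_mul simp: rep_cls)

lemma cnorm_cls:
  assumes s: "cseq s" shows "(\<lambda>n. nrm (s n)) \<longlonglongrightarrow> cnorm \<sigma> (cls s)"
proof -
  have lip: "\<bar>nrm a - nrm b\<bar> \<le> nrm (a \<ominus> b)" if "a \<in> L" "b \<in> L" for a b
    using nrm_le_diff[of a b] nrm_le_diff[of b a] nrm_diff_commute[of a b] that by linarith
  let ?r = "rep (cls s)"
  have r: "cseq ?r" "cs_equiv ?r s" using rep_cls[OF s] by auto
  have "Cauchy (\<lambda>n. nrm (?r n))"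
  proof (rule metric_CauchyI)
    fix e :: real assume "e > 0"
    then obtain N where "\<And>m n. m \<ge> N \<Longrightarrow> n \<ge> N \<Longrightarrow> nrm (?r m \<ominus> ?r n) < e" using cseqD[OF r(1)] by blast
    then show "\<exists>M. \<forall>m\<ge>M. \<forall>n\<ge>M. dist (nrm (?r m)) (nrm (?r n)) < e"
      unfolding dist_real_def using lip r(1) by (meson cseq_l1 le_less_trans)
  qed
  then have c: "(\<lambda>n. nrm (?r n)) \<longlonglongrightarrow> cnorm \<sigma> (cls s)"
    unfolding cnorm_def by (simp add: convergent_LIMSEQ_iff Cauchy_convergent_iff)
  have "(\<lambda>n. nrm (s n) - nrm (?r n)) \<longlonglongrightarrow> 0"
    by (rule Lim_null_comparison[OF _ r(2)[unfolded cs_equiv_def]])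
      (use lip[of "s _" "?r _"] r(1) s in \<open>simp add: nrm_diff_commute\<close>)
  from tendsto_add[OF this c] show ?thesis by simp
qed

abbreviation "em \<equiv> emb \<sigma>"

lemma em_Cstar [simp]: "a \<in> L \<Longrightarrow> em a \<in> Cstar \<sigma>"
  by (simp add: emb_def)

lemma cnorm_em: "a \<in> L \<Longrightarrow> cnorm \<sigma> (em a) = nrm a"
  unfolding emb_def by (rule LIMSEQ_unique[OF cnorm_cls tendsto_const]) simp

subsection \<open>Extension of bounded functionals\<close>

definition lipschitz_functional :: "('a l1 \<Rightarrow> complex) \<Rightarrow> bool" where
  "lipschitz_functional l \<longleftrightarrow> (\<exists>K. \<forall>a\<in>L. \<forall>b\<in>L. cmod (l a - l b) \<le> K * nrm (a \<ominus> b))"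

text \<open>The limit is taken along an arbitrarily chosen representative; \<open>cs_ext_cls\<close>
  shows that for Lipschitz functionals the choice does not matter.\<close>

definition cs_ext :: "('a l1 \<Rightarrow> complex) \<Rightarrow> 'a cstar \<Rightarrow> complex" where
  "cs_ext l A = lim (\<lambda>n. l (rep A n))"

lemma cs_ext_cls:
  assumes l: "lipschitz_functional l" and s: "cseq s"
  shows "(\<lambda>n. l (s n)) \<longlonglongrightarrow> cs_ext l (cls s)"
proof -
  obtain K0 where K0: "\<And>a b. a \<in> L \<Longrightarrow> b \<in> L \<Longrightarrow> cmod (l a - l b) \<le> K0 * nrm (a \<ominus> b)"
    using l by (auto simp: lipschitz_functional_def)
  \<comment> \<open>Made strictly positive so that \<open>e / K\<close> can serve as a
    tolerance.\<close>
  define K where "K = \<bar>K0\<bar> + 1"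
  have K: "K > 0" by (simp add: K_def)
  have lip: "cmod (l a - l b) \<le> K * nrm (a \<ominus> b)" if "a \<in> L" "b \<in> L" for a b
    by (rule order_trans[OF K0[OF that] mult_right_mono]) (use that in \<open>simp_all add: K_def\<close>)
  let ?r = "rep (cls s)"
  have r: "cseq ?r" "cs_equiv ?r s" using rep_cls[OF s] by auto
  have "Cauchy (\<lambda>n. l (?r n))"
  proof (rule metric_CauchyI)
    fix e :: real assume "e > 0"
    then have "e / K > 0" using K by simp
    then obtain N where N: "\<And>m n. m \<ge> N \<Longrightarrow> n \<ge> N \<Longrightarrow> nrm (?r m \<ominus> ?r n) < e / K" using cseqD[OF r(1)] by blast
    have "dist (l (?r m)) (l (?r n)) < e" if "m \<ge> N" "n \<ge> N" for m n
      using N[OF that] lip[of "?r m" "?r n"] r(1) K by (simp add: dist_norm field_simps)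
    then show "\<exists>M. \<forall>m\<ge>M. \<forall>n\<ge>M. dist (l (?r m)) (l (?r n)) < e" by blast
  qed
  then have c: "(\<lambda>n. l (?r n)) \<longlonglongrightarrow> cs_ext l (cls s)"
    unfolding cs_ext_def by (simp add: convergent_LIMSEQ_iff Cauchy_convergent_iff)
  have "(\<lambda>n. K * nrm (?r n \<ominus> s n)) \<longlonglongrightarrow> 0"
    using tendsto_mult_left[OF r(2)[unfolded cs_equiv_def], of K] by simp
  then have "(\<lambda>n. l (s n) - l (?r n)) \<longlonglongrightarrow> 0"
    by (rule Lim_null_comparison[rotated])
      (use lip[of "s _" "?r _"] r(1) s in \<open>simp add: nrm_diff_commute\<close>)
  from tendsto_add[OF this c] show ?thesis by simp
qed

lemma cs_ext_eqI: "lipschitz_functional l \<Longrightarrow> cseq s \<Longrightarrow> (\<lambda>n. l (s n)) \<longlonglongrightarrow> z \<Longrightarrow> cs_ext l (cls s) = z"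
  using cs_ext_cls LIMSEQ_unique by blast

lemma cs_ext_em: "lipschitz_functional l \<Longrightarrow> a \<in> L \<Longrightarrow> cs_ext l (em a) = l a"
  unfolding emb_def by (rule cs_ext_eqI) auto

lemma lipschitz_pos_functional: 
  assumes "pos_functional \<phi>" shows "lipschitz_functional \<phi>"
  unfolding lipschitz_functional_def
  using functional_bound[OF assms] phi_diff[OF assms] by (metis l1_diff)

lemma lipschitz_fourier: "lipschitz_functional (\<lambda>a. a n x)"
  unfolding lipschitz_functional_def
proof (intro exI[of _ 1] ballI)
  fix a b assume "a \<in> L" "b \<in> L"
  then show "cmod (a n x - b n x) \<le> 1 * nrm (a \<ominus> b)"
    using cmod_le_nrm[of "a \<ominus> b" n x] by (simp add: l1_diff_apply)
qed

definition fourier :: "int \<Rightarrow> 'a \<Rightarrow> 'a cstar \<Rightarrow> complex" where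
  "fourier n x = cs_ext (\<lambda>a. a n x)"

lemma fourier_cls: "cseq s \<Longrightarrow> (\<lambda>m. s m n x) \<longlonglongrightarrow> fourier n x (cls s)"
  unfolding fourier_def by (rule cs_ext_cls[OF lipschitz_fourier])

lemma fourier_eqI: "cseq s \<Longrightarrow> (\<lambda>m. s m n x) \<longlonglongrightarrow> z \<Longrightarrow> fourier n x (cls s) = z"
  unfolding fourier_def by (rule cs_ext_eqI[OF lipschitz_fourier])

lemma fourier_em: "a \<in> L \<Longrightarrow> fourier n x (em a) = a n x"
  unfolding fourier_def by (rule cs_ext_em[OF lipschitz_fourier])

text \<open>By \<open>cmod_le_nrm\<close> the coefficients of a Cauchy sequence converge uniformly
  in x. Continuity makes the set where a coefficient is nonzero open, and this is how interiors
  enter.\<close>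

lemma fourier_continuous:
  assumes "A \<in> Cstar \<sigma>" shows "continuous_on UNIV (\<lambda>x. fourier n x A)"
proof -
  obtain s where s: "cseq s" "A = cls s" using assms by (rule Cstar_cases)
  have u: "uniform_limit UNIV (\<lambda>m. s m n) (\<lambda>x. fourier n x A) sequentially"
  proof (rule uniform_limitI)
    fix e :: real assume e: "e > 0"
    then obtain N where N: "\<And>m k. m \<ge> N \<Longrightarrow> k \<ge> N \<Longrightarrow> nrm (s m \<ominus> s k) < e / 2"
      using cseqD[OF s(1), of "e / 2"] by auto
    have "dist (s m n x) (fourier n x A) < e" if "m \<ge> N" for m x
    proof -
      have "(\<lambda>k. cmod (s m n x - s k n x)) \<longlonglongrightarrow> cmod (s m n x - fourier n x A)"
        unfolding s(2) by (intro tendsto_intros fourier_cls[OF s(1)])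
      moreover have "cmod (s m n x - s k n x) \<le> e / 2" if "k \<ge> N" for k
        using cmod_le_nrm[of "s m \<ominus> s k" n x] N[OF \<open>m \<ge> N\<close> that] s(1) by (simp add: l1_diff_apply)
      ultimately have "cmod (s m n x - fourier n x A) \<le> e / 2" by (meson LIMSEQ_le_const2)
      then show ?thesis using e by (simp add: dist_norm)
    qed
    then show "\<forall>\<^sub>F m in sequentially. \<forall>x\<in>UNIV. dist (s m n x) (fourier n x A) < e"
      unfolding eventually_sequentially by blast
  qed
  show ?thesis
    by (rule uniform_limit_theorem[OF always_eventually u])
      (use l1_CX[OF cseq_l1[OF s(1)]] in \<open>simp_all add: CX_def\<close>)
qed

subsection \<open>Square roots in the completion\<close>

text \<open>Both iterates have norm at most 1, so one more step adds at most half the distance of x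
  and y. The constant grows with k, but it is applied at one fixed k only.\<close>

lemma sqrt_iter_lipschitz:
  assumes x: "x \<in> L" "nrm x \<le> 1" and y: "y \<in> L" "nrm y \<le> 1"
  shows "nrm (sqrt_iter x k \<ominus> sqrt_iter y k) \<le> real k * nrm (x \<ominus> y)"
proof (induction k)
  case 0
  have "sqrt_iter x 0 \<ominus> sqrt_iter y 0 = (\<lambda>k x. 0)" by (simp add: vec_defs)
  then show ?case by simp
next
  case (Suc k)
  let ?z = "sqrt_iter x k" and ?w = "sqrt_iter y k"
  have z: "?z \<in> L" "?w \<in> L" using x y by auto
  have b: "nrm ?z \<le> 1" "nrm ?w \<le> 1"
    using sqrt_iter_bound[OF submult_nrm x, of k] sqrt_iter_bound[OF submult_nrm y, of k] sqrt_bound_range[of k]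
    by auto
  have eq: "sqrt_iter x (Suc k) \<ominus> sqrt_iter y (Suc k) = (1/2) \<odot> ((x \<oplus> ?z \<otimes> ?z) \<ominus> (y \<oplus> ?w \<otimes> ?w))"
    by (simp add: vec_defs field_simps)
  have "nrm (sqrt_iter x (Suc k) \<ominus> sqrt_iter y (Suc k)) \<le> nrm ((x \<oplus> ?z \<otimes> ?z) \<ominus> (y \<oplus> ?w \<otimes> ?w)) / 2"
    unfolding eq by (rule p_half[OF submult_nrm]) (use x y z in auto)
  moreover have "nrm ((x \<oplus> ?z \<otimes> ?z) \<ominus> (y \<oplus> ?w \<otimes> ?w)) \<le> nrm (x \<ominus> y) + nrm (?z \<otimes> ?z \<ominus> ?w \<otimes> ?w)"
    using x y z by (intro nrm_add_diff) auto
  moreover have "nrm (?z \<otimes> ?z \<ominus> ?w \<otimes> ?w) \<le> nrm (?z \<ominus> ?w) + nrm (?z \<ominus> ?w)"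
    using nrm_mul_diff[of ?z ?z ?w ?w 1] z b by simp
  moreover have "0 \<le> nrm (x \<ominus> y)" using x y by simp
  ultimately have "nrm (sqrt_iter x (Suc k) \<ominus> sqrt_iter y (Suc k)) \<le> nrm (x \<ominus> y) + real k * nrm (x \<ominus> y)"
    using Suc by linarith
  then show ?case by (simp add: algebra_simps)
qed

lemma cseq_sqrt:
  assumes h: "cseq h" "\<And>n. (h n)\<dagger> = h n" "\<And>n. nrm (h n) \<le> 1"
  shows "\<exists>y. cseq y \<and> (\<forall>n. (y n)\<dagger> = y n) \<and> cs_equiv (\<lambda>n. y n \<otimes> y n) (\<lambda>n. \<e> \<ominus> h n)"
proof (intro exI conjI allI)
  \<comment> \<open>Diagonal choice: the n-th iterate for the n-th term of the representing
    sequence.\<close>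
  let ?z = "\<lambda>n. sqrt_iter (h n) n"
  let ?y = "\<lambda>n. \<e> \<ominus> ?z n"
  have hL: "h n \<in> L" for n using h(1) by simp
  have z: "?z n \<in> L" for n using hL by simp
  show "(?y n)\<dagger> = ?y n" for n
    using sqrt_iter_star[OF h(2)] by (simp add: star_diff[symmetric])
  have "cseq ?z"
    unfolding cs_seq_def
  proof (intro conjI allI impI)
    fix e :: real assume "e > 0"
    then have e: "e / 3 > 0" by simp
    have "Cauchy sqrt_bound" using sqrt_bound_convergent by (rule convergent_Cauchy)
    \<comment> \<open>From this k on, the iterates for every \<open>h i\<close> stay within e/3 of
      the k-th one; only the k-th iterates for different terms remain to be compared.\<close>
    then obtain k where k: "\<And>n. n \<ge> k \<Longrightarrow> sqrt_bound n - sqrt_bound k < e / 3"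
      using metric_CauchyD[OF _ e, of sqrt_bound] unfolding dist_real_def by (metis abs_less_iff order_refl)
    have "e / 3 / (real k + 1) > 0" using e by simp
    then obtain N where N: "\<And>m n. m \<ge> N \<Longrightarrow> n \<ge> N \<Longrightarrow> nrm (h m \<ominus> h n) < e / 3 / (real k + 1)"
      using cseqD[OF h(1)] by blast
    have "nrm (?z m \<ominus> ?z n) < e" if mn: "m \<ge> max N k" "n \<ge> max N k" for m n
    proof -
      have L: "sqrt_iter (h i) j \<in> L" for i j using hL by simp
      have 1: "nrm (?z i \<ominus> sqrt_iter (h i) k) < e / 3" if "i \<ge> k" for i
        using sqrt_iter_diff[OF submult_nrm hL h(3) that, of i] k[OF that] by linarith
      have "nrm (sqrt_iter (h m) k \<ominus> sqrt_iter (h n) k) \<le> real k * nrm (h m \<ominus> h n)"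
        by (rule sqrt_iter_lipschitz[OF hL h(3) hL h(3)])
      also have "\<dots> \<le> (real k + 1) * nrm (h m \<ominus> h n)" using hL by (intro mult_right_mono) auto
      also have "\<dots> < e / 3" using N[of m n] mn by (simp add: field_simps)
      finally have 2: "nrm (sqrt_iter (h m) k \<ominus> sqrt_iter (h n) k) < e / 3" .
      have "nrm (?z m \<ominus> ?z n) \<le> nrm (?z m \<ominus> sqrt_iter (h m) k)
         + (nrm (sqrt_iter (h m) k \<ominus> sqrt_iter (h n) k) + nrm (sqrt_iter (h n) k \<ominus> ?z n))"
        by (rule order_trans[OF nrm_diff_triangle[OF L L L] add_left_mono[OF nrm_diff_triangle[OF L L L]]])
      moreover have "nrm (sqrt_iter (h n) k \<ominus> ?z n) < e / 3"
        using 1[of n] nrm_diff_commute[OF L L, of n k n n] mn by simp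
      moreover have "nrm (?z m \<ominus> sqrt_iter (h m) k) < e / 3" using 1[of m] mn by simp
      ultimately show ?thesis using 2 by linarith
    qed
    then show "\<exists>N. \<forall>m\<ge>N. \<forall>n\<ge>N. nrm (?z m \<ominus> ?z n) < e" by blast
  qed (rule z)
  then show y: "cseq ?y" by simp
  show "cs_equiv (\<lambda>n. ?y n \<otimes> ?y n) (\<lambda>n. \<e> \<ominus> h n)"
    unfolding cs_equiv_def
  proof (rule tendsto_sandwich[OF _ _ tendsto_const])
    obtain l where l: "sqrt_bound \<longlonglongrightarrow> l" using sqrt_bound_convergent by (auto simp: convergent_def)
    have "(\<lambda>n. sqrt_bound (Suc n) - sqrt_bound n) \<longlonglongrightarrow> 0"
      using tendsto_diff[OF LIMSEQ_Suc[OF l] l] by (simp del: sqrt_bound.simps)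
    from tendsto_mult_left[OF this, of 2]
    show "(\<lambda>n. 2 * (sqrt_bound (Suc n) - sqrt_bound n)) \<longlonglongrightarrow> 0" by (simp del: sqrt_bound.simps)
    have "nrm (?y n \<otimes> ?y n \<ominus> (\<e> \<ominus> h n)) \<le> 2 * (sqrt_bound (Suc n) - sqrt_bound n)" for n
    proof -
      \<comment> \<open>The defect of the approximate root is twice the next increment of the
        iteration, hence bounded by the scalar increments.\<close>
      have "?y n \<otimes> ?y n \<ominus> (\<e> \<ominus> h n) = 2 \<odot> (sqrt_iter (h n) (Suc n) \<ominus> ?z n)"
        using hL[of n] z[of n] by (simp add: expand) (simp add: vec_defs field_simps)
      then have "nrm (?y n \<otimes> ?y n \<ominus> (\<e> \<ominus> h n)) \<le> 2 * nrm (sqrt_iter (h n) (Suc n) \<ominus> ?z n)"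
        using nrm_smult_le[of "sqrt_iter (h n) (Suc n) \<ominus> ?z n" 2] hL by (simp del: sqrt_iter.simps)
      from order_trans[OF this mult_left_mono[OF sqrt_iter_step[OF submult_nrm hL h(3)]]]
      show ?thesis by (simp del: sqrt_bound.simps)
    qed
    then show "\<forall>\<^sub>F n in sequentially. nrm (?y n \<otimes> ?y n \<ominus> (\<e> \<ominus> h n)) \<le> 2 * (sqrt_bound (Suc n) - sqrt_bound n)"
      by (intro always_eventually allI)
  qed (use y hL in simp)
qed

section \<open>Positive definite multipliers\<close>

lemma l1_finite_support:
  assumes "\<And>k. a k \<in> CX" "finite S" "\<And>k. k \<notin> S \<Longrightarrow> a k = (\<lambda>x. 0)"
  shows "a \<in> L" "l1_norm a \<le> (\<Sum>k\<in>S. supn (a k))"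
proof -
  let ?b = "\<lambda>k. if k \<in> S then supn (a k) else 0"
  have s: "?b summable_on UNIV"
    by (rule finite_nonzero_values_imp_summable_on) (auto intro: finite_subset[OF _ assms(2)])
  have d: "cmod (a k x) \<le> ?b k" for k x
    using cmod_le_supn[OF assms(1)] assms(3)[of k] by simp
  show "a \<in> L" by (rule l1_dominated(1)[OF assms(1) s d])
  have "infsum ?b UNIV = infsum ?b S" by (rule infsum_cong_neutral) auto
  then show "l1_norm a \<le> (\<Sum>k\<in>S. supn (a k))"
    using l1_dominated(2)[OF assms(1) s d] assms(2) by simp
qed

lemma c00_l1: "a \<in> c00 \<sigma> \<Longrightarrow> a \<in> L"
  by (simp add: c00_def)

lemma c00_approx:
  assumes a: "a \<in> L" and e: "e > 0"
  shows "\<exists>b\<in>c00 \<sigma>. l1_norm (a \<ominus> b) \<le> e"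
proof -
  let ?f = "\<lambda>k. supn (a k)"
  obtain F where F: "finite F" "dist (sum ?f F) (infsum ?f UNIV) \<le> e"
    using infsum_finite_approximation[OF l1_summable[OF a] e] by blast
  define b where "b = (\<lambda>k x. if k \<in> F then a k x else 0)"
  have bc: "b k \<in> CX" for k using l1_CX[OF a] by (cases "k \<in> F") (simp_all add: b_def)
  have bz: "b k = (\<lambda>x. 0)" if "k \<notin> F" for k using that by (simp add: b_def)
  have bL: "b \<in> L" by (rule l1_finite_support(1)[OF bc F(1) bz])
  have "{k. b k \<noteq> (\<lambda>x. 0)} \<subseteq> F" using bz by blast
  then have b00: "b \<in> c00 \<sigma>" using bL finite_subset[OF _ F(1)] by (simp add: c00_def)
  let ?g = "\<lambda>k. if k \<in> F then 0 else ?f k"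
  have gF: "?g summable_on UNIV"
    by (rule summable_on_comparison_test[OF l1_summable[OF a]]) (use l1_CX[OF a] in auto)
  have d: "cmod ((a \<ominus> b) k x) \<le> ?g k" for k x
    using cmod_le_supn[OF l1_CX[OF a]] by (simp add: b_def l1_diff_def)
  have "l1_norm (a \<ominus> b) \<le> infsum ?g UNIV"
    by (rule l1_dominated(2)[OF l1_CX[OF l1_diff[OF a bL]] gF d])
  also have "infsum ?g UNIV = infsum ?f (UNIV - F)"
    by (rule infsum_cong_neutral) auto
  also have "\<dots> = infsum ?f UNIV - sum ?f F"
  proof -
    have "infsum ?f UNIV = infsum ?f (F \<union> (UNIV - F))" by simp
    also have "\<dots> = infsum ?f F + infsum ?f (UNIV - F)"
      using l1_summable[OF a] F(1)
      by (intro infsum_Un_disjoint) (auto intro: summable_on_subset_banach)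
    finally show ?thesis using F(1) by simp
  qed
  also have "\<dots> \<le> e" using F(2) by (simp add: dist_real_def)
  finally show ?thesis using b00 by blast
qed

lemma c00_dense:
  assumes a: "a \<in> L"
  shows "\<exists>b. (\<forall>n::nat. b n \<in> c00 \<sigma>) \<and> (\<lambda>n. l1_norm (a \<ominus> b n)) \<longlonglongrightarrow> 0"
proof -
  have "\<exists>b. b \<in> c00 \<sigma> \<and> l1_norm (a \<ominus> b) \<le> inverse (real (Suc n))" for n
    using c00_approx[OF a, of "inverse (real (Suc n))"] by auto
  then obtain b where b: "\<And>n. b n \<in> c00 \<sigma> \<and> l1_norm (a \<ominus> b n) \<le> inverse (real (Suc n))"
    by metis
  have "(\<lambda>n. l1_norm (a \<ominus> b n)) \<longlonglongrightarrow> 0"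
    by (rule tendsto_sandwich[OF _ _ tendsto_const LIMSEQ_inverse_real_of_nat])
      (use b a in \<open>auto simp: c00_l1\<close>)
  with b show ?thesis by blast
qed

definition mlt :: "'a l1 \<Rightarrow> 'a l1 \<Rightarrow> 'a l1" where
  "mlt m a = (\<lambda>k x. m k x * a k x)"

text \<open>A positive semidefinite kernel m (j - i), exhibited as a Gram matrix with real invariant entries.\<close>

definition gram_factor :: "'a l1 \<Rightarrow> int set \<Rightarrow> int set \<Rightarrow> (int \<Rightarrow> 'a l1) \<Rightarrow> bool" where
  "gram_factor m S T g \<longleftrightarrow> finite T \<and>
     (\<forall>t\<in>T. \<forall>i\<in>S. g t i \<in> CX \<and> (\<forall>k x. g t i (tr k x) = g t i x) \<and> (\<forall>x. cnj (g t i x) = g t i x)) \<and>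
     (\<forall>i\<in>S. \<forall>j\<in>S. \<forall>x. m (j - i) x = (\<Sum>t\<in>T. g t i x * g t j x))"

text \<open>The bound by 1 makes multiplication contractive in \<open>l1_norm\<close> and the value
  at 0 fixes the unit. With the Gram factorisations on finite index sets this suffices to carry
  states to states.\<close>

definition pd_multiplier :: "'a l1 \<Rightarrow> bool" where
  "pd_multiplier m \<longleftrightarrow> (\<forall>k. m k \<in> CX) \<and> (\<forall>k x. cmod (m k x) \<le> 1) \<and> (\<forall>x. m 0 x = 1) \<and>
    (\<forall>S. finite S \<longrightarrow> (\<exists>T g. gram_factor m S T g))"

lemma mlt_add: "mlt m (a \<oplus> b) = mlt m a \<oplus> mlt m b"
  and mlt_diff: "mlt m (a \<ominus> b) = mlt m a \<ominus> mlt m b"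
  and mlt_smult: "mlt m (c \<odot> a) = c \<odot> mlt m a"
  by (simp_all add: mlt_def vec_defs algebra_simps)

lemma mlt_l1:
  assumes "\<And>k. m k \<in> CX" "\<And>k x. cmod (m k x) \<le> 1" "a \<in> L"
  shows "mlt m a \<in> L" "l1_norm (mlt m a) \<le> l1_norm a"
proof -
  have c: "mlt m a k \<in> CX" for k unfolding mlt_def using assms(1) l1_CX[OF assms(3)] by (rule CX_mult)
  have d: "cmod (mlt m a k x) \<le> supn (a k)" for k x
    using mult_mono[OF assms(2)[of k x] cmod_le_supn[OF l1_CX[OF assms(3), of k], of x]]
    by (simp add: mlt_def norm_mult)
  show "mlt m a \<in> L" "l1_norm (mlt m a) \<le> l1_norm a"
    using l1_dominated[OF c l1_summable[OF assms(3)] d] by (simp_all add: l1_norm_def)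
qed

lemma star_mul_apply:
  assumes "finite S" "\<And>i. i \<notin> S \<Longrightarrow> a i = (\<lambda>x. 0)"
  shows "(a\<dagger> \<otimes> b) n x = (\<Sum>i\<in>S. cnj (a i (tr i x)) * b (n + i) (tr i x))"
proof -
  have "(a\<dagger> \<otimes> b) n x = infsum (\<lambda>k. cnj (a (- k) (tr (- k) x)) * b (n - k) (tr (- k) x)) UNIV"
    by (simp add: l1_mult_def l1_star_def)
  also have "\<dots> = infsum (\<lambda>i. cnj (a i (tr i x)) * b (n + i) (tr i x)) UNIV"
    by (rule infsum_reindex_bij_witness[of _ uminus uminus]) auto
  also have "\<dots> = infsum (\<lambda>i. cnj (a i (tr i x)) * b (n + i) (tr i x)) S"
    by (rule infsum_cong_neutral) (auto simp: assms(2))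
  finally show ?thesis using assms(1) by simp
qed

lemma phi_sum:
  assumes phi: "pos_functional \<phi>" and "finite T" "\<And>t. t \<in> T \<Longrightarrow> c t \<in> L"
  shows "(\<lambda>k x. \<Sum>t\<in>T. c t k x) \<in> L \<and> \<phi> (\<lambda>k x. \<Sum>t\<in>T. c t k x) = (\<Sum>t\<in>T. \<phi> (c t))"
  using assms(2,3)
proof (induction T rule: finite_induct)
  case empty
  then show ?case by (simp add: phi_zero[OF phi])
next
  case (insert t T)
  then have "(\<lambda>k x. \<Sum>t\<in>insert t T. c t k x) = c t \<oplus> (\<lambda>k x. \<Sum>t\<in>T. c t k x)"
    by (simp add: l1_add_def)
  then show ?case using insert by (simp add: phi_add[OF phi])
qed

text \<open>If c_t is a with its i-th coefficient multiplied by g t i, then multiplying a\<dagger> a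
  by m gives the sum over t of the squares c_t\<dagger> c_t.\<close>

lemma mlt_square_pos:
  assumes m: "pd_multiplier m" and phi: "pos_functional \<phi>" and a: "a \<in> c00 \<sigma>"
  shows "Im (\<phi> (mlt m (a\<dagger> \<otimes> a))) = 0" "0 \<le> Re (\<phi> (mlt m (a\<dagger> \<otimes> a)))"
proof -
  define S where "S = {k. a k \<noteq> (\<lambda>x. 0)}"
  have S: "finite S" "\<And>k. k \<notin> S \<Longrightarrow> a k = (\<lambda>x. 0)" and aL: "a \<in> L"
    using a by (auto simp: S_def c00_def)
  obtain T g where gram: "gram_factor m S T g"
    using m S(1) by (auto simp: pd_multiplier_def)
  have T: "finite T" and
    g: "\<And>t i. t \<in> T \<Longrightarrow> i \<in> S \<Longrightarrow> g t i \<in> CX"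
    "\<And>t i k x. t \<in> T \<Longrightarrow> i \<in> S \<Longrightarrow> g t i (tr k x) = g t i x"
    "\<And>t i x. t \<in> T \<Longrightarrow> i \<in> S \<Longrightarrow> cnj (g t i x) = g t i x"
    and mg: "\<And>i j x. i \<in> S \<Longrightarrow> j \<in> S \<Longrightarrow> m (j - i) x = (\<Sum>t\<in>T. g t i x * g t j x)"
    using gram by (auto simp: gram_factor_def)
  define c where "c t = (\<lambda>k x. if k \<in> S then g t k x * a k x else 0)" for t
  have cz: "c t k = (\<lambda>x. 0)" if "k \<notin> S" for t k using that by (simp add: c_def)
  have cL: "c t \<in> L" if "t \<in> T" for t
  proof (rule l1_finite_support(1)[OF _ S(1) cz])
    fix k show "c t k \<in> CX"
      using g(1)[OF that] l1_CX[OF aL] by (cases "k \<in> S") (simp_all add: c_def CX_mult)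
  qed
  have "mlt m (a\<dagger> \<otimes> a) = (\<lambda>k x. \<Sum>t\<in>T. ((c t)\<dagger> \<otimes> c t) k x)"
  proof (intro ext)
    fix n x
    have "(\<Sum>t\<in>T. ((c t)\<dagger> \<otimes> c t) n x) = (\<Sum>t\<in>T. \<Sum>i\<in>S. cnj (c t i (tr i x)) * c t (n + i) (tr i x))"
      by (simp add: star_mul_apply[OF S(1) cz])
    also have "\<dots> = (\<Sum>i\<in>S. \<Sum>t\<in>T. cnj (c t i (tr i x)) * c t (n + i) (tr i x))"
      by (rule sum.swap)
    also have "\<dots> = (\<Sum>i\<in>S. m n x * (cnj (a i (tr i x)) * a (n + i) (tr i x)))"
    proof (rule sum.cong[OF refl])
      fix i assume i: "i \<in> S"
      show "(\<Sum>t\<in>T. cnj (c t i (tr i x)) * c t (n + i) (tr i x)) = m n x * (cnj (a i (tr i x)) * a (n + i) (tr i x))"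
      proof (cases "n + i \<in> S")
        case True
        \<comment> \<open>Realness and invariance along orbits allow the Gram factors to be
          evaluated at x instead of at the i-th iterate of x.\<close>
        have "(\<Sum>t\<in>T. cnj (c t i (tr i x)) * c t (n + i) (tr i x))
            = (\<Sum>t\<in>T. (g t i x * g t (n + i) x) * (cnj (a i (tr i x)) * a (n + i) (tr i x)))"
          by (rule sum.cong[OF refl]) (simp add: c_def i True g(2,3))
        also have "\<dots> = m n x * (cnj (a i (tr i x)) * a (n + i) (tr i x))"
          using mg[OF i True, of x] by (simp add: sum_distrib_right)
        finally show ?thesis .
      next
        case False
        then show ?thesis by (simp add: cz S(2))
      qed
    qed
    also have "\<dots> = mlt m (a\<dagger> \<otimes> a) n x"
      by (simp add: mlt_def star_mul_apply[OF S] sum_distrib_left)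
    finally show "mlt m (a\<dagger> \<otimes> a) n x = (\<Sum>t\<in>T. ((c t)\<dagger> \<otimes> c t) n x)" by simp
  qed
  then have "\<phi> (mlt m (a\<dagger> \<otimes> a)) = (\<Sum>t\<in>T. \<phi> ((c t)\<dagger> \<otimes> c t))"
    using phi_sum[OF phi T, of "\<lambda>t. (c t)\<dagger> \<otimes> c t"] cL by simp
  then show "Im (\<phi> (mlt m (a\<dagger> \<otimes> a))) = 0" "0 \<le> Re (\<phi> (mlt m (a\<dagger> \<otimes> a)))"
    using phi_Im[OF phi cL] phi_Re[OF phi cL] by (auto intro: sum_nonneg)
qed

text \<open>Written in terms of a and a - b alone, so that the bound tends to 0 as b approaches
  a.\<close>

lemma l1_norm_square_diff:
  assumes a: "a \<in> L" and b: "b \<in> L"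
  shows "l1_norm (a\<dagger> \<otimes> a \<ominus> b\<dagger> \<otimes> b) \<le> l1_norm (a \<ominus> b) * (2 * l1_norm a + l1_norm (a \<ominus> b))"
proof -
  let ?d = "a \<ominus> b"
  have d: "?d \<in> L" using a b by simp
  have "a\<dagger> \<otimes> a \<ominus> b\<dagger> \<otimes> b = (a\<dagger> \<otimes> ?d \<oplus> ?d\<dagger> \<otimes> a) \<ominus> ?d\<dagger> \<otimes> ?d"
    using a b by (simp add: expand) (simp add: vec_defs)
  then have "l1_norm (a\<dagger> \<otimes> a \<ominus> b\<dagger> \<otimes> b) \<le> l1_norm (a\<dagger> \<otimes> ?d \<oplus> ?d\<dagger> \<otimes> a) + l1_norm (?d\<dagger> \<otimes> ?d)"
    using l1_norm_diff[of "a\<dagger> \<otimes> ?d \<oplus> ?d\<dagger> \<otimes> a" "?d\<dagger> \<otimes> ?d"] a d by simp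
  also have "\<dots> \<le> (l1_norm (a\<dagger> \<otimes> ?d) + l1_norm (?d\<dagger> \<otimes> a)) + l1_norm (?d\<dagger> \<otimes> ?d)"
    using a d by (intro add_mono order_refl l1_norm_add) auto
  also have "\<dots> \<le> (l1_norm a * l1_norm ?d + l1_norm ?d * l1_norm a) + l1_norm ?d * l1_norm ?d"
    using a d by (intro add_mono order_trans[OF l1_norm_mul] mult_mono order_refl l1_norm_star_le) auto
  finally show ?thesis by (simp add: algebra_simps)
qed

lemma state_bound_l1: "l1_state \<sigma> \<phi> \<Longrightarrow> a \<in> L \<Longrightarrow> cmod (\<phi> a) \<le> l1_norm a"
  using state_bound[of \<phi> a] nrm_le_l1_norm[of a] by simp

text \<open>The Gram factorisation needs finite support, so positivity is first known on
  \<open>c00\<close>; it passes to the limit because multiplication by m does not increase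
  \<open>l1_norm\<close>.\<close>

lemma mlt_state:
  assumes m: "pd_multiplier m" and s: "l1_state \<sigma> \<phi>"
  shows "l1_state \<sigma> (\<lambda>a. \<phi> (mlt m a))"
proof -
  note phi = state_functional[OF s]
  have mc: "m k \<in> CX" "cmod (m k x) \<le> 1" "m 0 x = 1" for k x using m by (auto simp: pd_multiplier_def)
  note ml = mlt_l1[OF mc(1,2)]
  have pos: "Im (\<phi> (mlt m (a\<dagger> \<otimes> a))) = 0 \<and> 0 \<le> Re (\<phi> (mlt m (a\<dagger> \<otimes> a)))" if a: "a \<in> L" for a
  proof -
    obtain b where b: "\<And>n::nat. b n \<in> c00 \<sigma>" and lim: "(\<lambda>n. l1_norm (a \<ominus> b n)) \<longlonglongrightarrow> 0"
      using c00_dense[OF a] by blast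
    have bL: "b n \<in> L" for n using b by (rule c00_l1)
    have 0: "(\<lambda>n. l1_norm (a \<ominus> b n) * (2 * l1_norm a + l1_norm (a \<ominus> b n))) \<longlonglongrightarrow> 0"
      by (rule tendsto_eq_intros lim | simp)+
    have "(\<lambda>n. \<phi> (mlt m (a\<dagger> \<otimes> a)) - \<phi> (mlt m ((b n)\<dagger> \<otimes> b n))) \<longlonglongrightarrow> 0"
    proof (rule Lim_null_comparison[OF _ 0], intro always_eventually allI)
      fix n
      have L: "a\<dagger> \<otimes> a \<in> L" "(b n)\<dagger> \<otimes> b n \<in> L" using a bL by auto
      have eq: "\<phi> (mlt m (a\<dagger> \<otimes> a)) - \<phi> (mlt m ((b n)\<dagger> \<otimes> b n)) = \<phi> (mlt m (a\<dagger> \<otimes> a \<ominus> (b n)\<dagger> \<otimes> b n))"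
        unfolding mlt_diff using ml(1) L by (intro phi_diff[OF phi, symmetric])
      have "cmod (\<phi> (mlt m (a\<dagger> \<otimes> a)) - \<phi> (mlt m ((b n)\<dagger> \<otimes> b n))) \<le> l1_norm (mlt m (a\<dagger> \<otimes> a \<ominus> (b n)\<dagger> \<otimes> b n))"
        unfolding eq using ml(1) L by (intro state_bound_l1[OF s]) auto
      also have "\<dots> \<le> l1_norm (a\<dagger> \<otimes> a \<ominus> (b n)\<dagger> \<otimes> b n)" using L by (intro ml(2)) auto
      also have "\<dots> \<le> l1_norm (a \<ominus> b n) * (2 * l1_norm a + l1_norm (a \<ominus> b n))"
        by (rule l1_norm_square_diff[OF a bL])
      finally show "cmod (\<phi> (mlt m (a\<dagger> \<otimes> a)) - \<phi> (mlt m ((b n)\<dagger> \<otimes> b n)))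
         \<le> l1_norm (a \<ominus> b n) * (2 * l1_norm a + l1_norm (a \<ominus> b n))" .
    qed
    from tendsto_diff[OF tendsto_const[of "\<phi> (mlt m (a\<dagger> \<otimes> a))"] this]
    have l: "(\<lambda>n. \<phi> (mlt m ((b n)\<dagger> \<otimes> b n))) \<longlonglongrightarrow> \<phi> (mlt m (a\<dagger> \<otimes> a))" by simp
    have "(\<lambda>n. Im (\<phi> (mlt m ((b n)\<dagger> \<otimes> b n)))) \<longlonglongrightarrow> Im (\<phi> (mlt m (a\<dagger> \<otimes> a)))"
      using l by (rule tendsto_Im)
    moreover have "(\<lambda>n. Re (\<phi> (mlt m ((b n)\<dagger> \<otimes> b n)))) \<longlonglongrightarrow> Re (\<phi> (mlt m (a\<dagger> \<otimes> a)))"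
      using l by (rule tendsto_Re)
    ultimately show ?thesis
      using mlt_square_pos[OF m phi b] by (auto simp: LIMSEQ_const_iff intro: LIMSEQ_le_const)
  qed
  have "mlt m \<e> = \<e>" using mc(3) by (auto simp: mlt_def coef0_def fun_eq_iff)
  then show ?thesis
    using s pos ml(1) unfolding l1_state_def
    by (auto simp: mlt_add mlt_smult phi_add[OF phi] phi_smult[OF phi])
qed

subsection \<open>Fejer means and uniqueness of Fourier coefficients\<close>

text \<open>Fejer weights, constant in x. For N = 0 the division convention gives weight 1
  everywhere, so the kernel is used at \<open>Suc N\<close>.\<close>

definition fejer :: "nat \<Rightarrow> 'a l1" where
  "fejer N = (\<lambda>k x. of_real (max 0 (1 - \<bar>real_of_int k\<bar> / real N)))"

text \<open>The weights are normalised overlaps: two integer intervals of length N shifted by j - i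
  share max 0 (N - |j - i|) points.\<close>

lemma fejer_multiplier:
  assumes N: "N > 0"
  shows "pd_multiplier (fejer N)"
  unfolding pd_multiplier_def
proof (intro conjI allI impI)
  show "fejer N k \<in> CX" for k by (simp add: fejer_def)
  show "cmod (fejer N k x) \<le> 1" for k x unfolding fejer_def using N by (simp add: max_def)
  show "fejer N 0 x = 1" for x by (simp add: fejer_def)
  fix S :: "int set" assume S: "finite S"
  \<comment> \<open>All left end points s of windows of length N that meet S; \<open>g s i\<close>
    is the indicator of i lying in the window at s, scaled so that a product of two equals
    1/N.\<close>
  define T where "T = (\<Union>i\<in>S. {i - int N<..i})"
  define g :: "int \<Rightarrow> int \<Rightarrow> 'a \<Rightarrow> complex"
    where "g s i x = (if s \<le> i \<and> i < s + int N then of_real (1 / sqrt (real N)) else 0)" for s i x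
  have T: "finite T" using S by (simp add: T_def)
  have "fejer N (j - i) x = (\<Sum>s\<in>T. g s i x * g s j x)" if ij: "i \<in> S" "j \<in> S" for i j x
  proof -
    let ?I = "{max i j - int N<..min i j}"
    have "?I \<subseteq> {i - int N<..i}" by auto
    then have I: "?I \<subseteq> T" using ij unfolding T_def by blast
    have "sqrt (real N) * sqrt (real N) = real N" by simp
    then have gg: "g s i x * g s j x = (if s \<in> ?I then of_real (1 / real N) else 0)" for s
      unfolding g_def by (auto simp flip: of_real_mult)
    have "(\<Sum>s\<in>T. g s i x * g s j x) = (\<Sum>s\<in>T. if s \<in> ?I then of_real (1 / real N) else 0)"
      by (simp only: gg)
    also have "\<dots> = (\<Sum>s\<in>T \<inter> ?I. of_real (1 / real N))"
      by (rule sum.inter_restrict[OF T, symmetric])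
    also have "T \<inter> ?I = ?I" using I by blast
    also have "(\<Sum>s\<in>?I. complex_of_real (1 / real N)) = of_real (real (card ?I) / real N)" by simp
    also have "real (card ?I) = max 0 (real N - \<bar>real_of_int (j - i)\<bar>)" by (simp add: max_def min_def)
    also have "complex_of_real (max 0 (real N - \<bar>real_of_int (j - i)\<bar>) / real N) = fejer N (j - i) x"
      unfolding fejer_def using N by (auto simp: max_def field_simps)
    finally show ?thesis by simp
  qed
  then have "gram_factor (fejer N) S T g"
    using T by (auto simp: gram_factor_def g_def[abs_def])
  then show "\<exists>T g. gram_factor (fejer N) S T g" by blast
qed

lemma fejer_l1:
  assumes "a \<in> L"
  shows "mlt (fejer N) a \<in> L" "l1_norm (mlt (fejer N) a) \<le> l1_norm a"
proof -
  have c: "fejer N k \<in> CX" "cmod (fejer N k x) \<le> 1" for k x by (auto simp: fejer_def max_def)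
  show "mlt (fejer N) a \<in> L" "l1_norm (mlt (fejer N) a) \<le> l1_norm a" by (rule mlt_l1[OF c assms])+
qed

lemma fejer_tendsto_1: "(\<lambda>N. fejer (Suc N) k x) \<longlonglongrightarrow> 1"
proof -
  have "(\<lambda>N. \<bar>real_of_int k\<bar> * inverse (real (Suc N))) \<longlonglongrightarrow> \<bar>real_of_int k\<bar> * 0"
    by (intro tendsto_intros LIMSEQ_inverse_real_of_nat)
  then have "(\<lambda>N. max 0 (1 - \<bar>real_of_int k\<bar> / real (Suc N))) \<longlonglongrightarrow> max 0 (1 - 0)"
    by (intro tendsto_intros) (simp add: divide_inverse)
  from tendsto_of_real[OF this] show ?thesis unfolding fejer_def by simp
qed

lemma fejer_converges:
  assumes a: "a \<in> L"
  shows "(\<lambda>N. l1_norm (mlt (fejer (Suc N)) a \<ominus> a)) \<longlonglongrightarrow> 0"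
proof (rule LIMSEQ_I)
  fix e :: real assume "e > 0"
  then obtain b where b: "b \<in> c00 \<sigma>" "l1_norm (a \<ominus> b) \<le> e / 4" using c00_approx[OF a, of "e / 4"] by auto
  define S where "S = {k. b k \<noteq> (\<lambda>x. 0)}"
  have S: "finite S" "\<And>k. k \<notin> S \<Longrightarrow> b k = (\<lambda>x. 0)" and bL: "b \<in> L"
    using b by (auto simp: S_def c00_def)
  let ?F = "\<lambda>N. mlt (fejer (Suc N))"
  have fb: "l1_norm (?F N b \<ominus> b) \<le> (\<Sum>k\<in>S. cmod (fejer (Suc N) k undefined - 1) * supn (b k))" for N
  proof -
    have fL: "?F N b \<ominus> b \<in> L" using fejer_l1[OF bL] bL by simp
    have "l1_norm (?F N b \<ominus> b) \<le> (\<Sum>k\<in>S. supn ((?F N b \<ominus> b) k))"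
      by (rule l1_finite_support(2)[OF l1_CX[OF fL] S(1)]) (simp add: mlt_def l1_diff_def S(2))
    also have "\<dots> \<le> (\<Sum>k\<in>S. cmod (fejer (Suc N) k undefined - 1) * supn (b k))"
    proof (intro sum_mono supn_least)
      fix k x
      have "(?F N b \<ominus> b) k x = (fejer (Suc N) k undefined - 1) * b k x"
        by (simp add: mlt_def l1_diff_def fejer_def algebra_simps)
      then show "cmod ((?F N b \<ominus> b) k x) \<le> cmod (fejer (Suc N) k undefined - 1) * supn (b k)"
        using cmod_le_supn[OF l1_CX[OF bL], of k x] by (simp add: norm_mult mult_left_mono)
    qed
    finally show ?thesis .
  qed
  have "(\<lambda>N. \<Sum>k\<in>S. cmod (fejer (Suc N) k undefined - 1) * supn (b k)) \<longlonglongrightarrow> (\<Sum>k\<in>S. cmod (1 - 1) * supn (b k))"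
    by (intro tendsto_intros fejer_tendsto_1)
  then have "(\<lambda>N. \<Sum>k\<in>S. cmod (fejer (Suc N) k undefined - 1) * supn (b k)) \<longlonglongrightarrow> 0" by simp
  then have "\<forall>\<^sub>F N in sequentially. (\<Sum>k\<in>S. cmod (fejer (Suc N) k undefined - 1) * supn (b k)) < e / 4"
    using \<open>e > 0\<close> by (intro order_tendstoD(2)) auto
  then obtain N0 where N0: "\<And>N. N \<ge> N0 \<Longrightarrow> (\<Sum>k\<in>S. cmod (fejer (Suc N) k undefined - 1) * supn (b k)) < e / 4"
    unfolding eventually_sequentially by blast
  have "norm (l1_norm (?F N a \<ominus> a) - 0) < e" if "N \<ge> N0" for N
  proof -
    have L: "?F N a \<in> L" "?F N b \<in> L" "?F N (a \<ominus> b) \<in> L" using fejer_l1 a bL by auto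
    have "?F N a \<ominus> a = ?F N (a \<ominus> b) \<oplus> ((?F N b \<ominus> b) \<ominus> (a \<ominus> b))"
      by (simp add: mlt_diff) (simp add: vec_defs)
    then have 1: "l1_norm (?F N a \<ominus> a) \<le> l1_norm (?F N (a \<ominus> b)) + l1_norm ((?F N b \<ominus> b) \<ominus> (a \<ominus> b))"
      using l1_norm_add[of "?F N (a \<ominus> b)" "(?F N b \<ominus> b) \<ominus> (a \<ominus> b)"] L a bL by simp
    have 2: "l1_norm ((?F N b \<ominus> b) \<ominus> (a \<ominus> b)) \<le> l1_norm (?F N b \<ominus> b) + l1_norm (a \<ominus> b)"
      using L a bL by (intro l1_norm_diff) auto
    have 3: "l1_norm (?F N (a \<ominus> b)) \<le> l1_norm (a \<ominus> b)" using a bL by (intro fejer_l1) auto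
    have "l1_norm (?F N a \<ominus> a) < e" using 1 2 3 b(2) fb[of N] N0[OF that] \<open>e > 0\<close> by linarith
    then show ?thesis using L a by simp
  qed
  then show "\<exists>no. \<forall>N\<ge>no. norm (l1_norm (?F N a \<ominus> a) - 0) < e" by blast
qed

text \<open>A Fejer mean sees finitely many coefficients, so coefficientwise smallness makes it
  small in norm.\<close>

lemma fejer_l1_norm_le:
  assumes a: "a \<in> L" and N: "N > 0"
  shows "l1_norm (mlt (fejer N) a) \<le> (\<Sum>k\<in>{- int N..int N}. supn (a k))"
proof -
  have "l1_norm (mlt (fejer N) a) \<le> (\<Sum>k\<in>{- int N..int N}. supn (mlt (fejer N) a k))"
  proof (rule l1_finite_support(2)[OF l1_CX[OF fejer_l1(1)[OF a]]])
    fix k assume "k \<notin> {- int N..int N}"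
    then have "\<bar>k\<bar> > int N" by auto
    then have "\<bar>real_of_int k\<bar> > real N" by linarith
    then have "fejer N k x = 0" for x using N by (simp add: fejer_def max_def field_simps)
    then show "mlt (fejer N) a k = (\<lambda>x. 0)" by (simp add: mlt_def)
  qed simp
  also have "\<dots> \<le> (\<Sum>k\<in>{- int N..int N}. supn (a k))"
  proof (intro sum_mono supn_least)
    fix k x
    have "cmod (fejer N k x) \<le> 1" by (simp add: fejer_def max_def)
    then have "cmod (mlt (fejer N) a k x) \<le> 1 * supn (a k)"
      unfolding mlt_def norm_mult using cmod_le_supn[OF l1_CX[OF a]] by (intro mult_mono) auto
    then show "cmod (mlt (fejer N) a k x) \<le> supn (a k)" by simp
  qed
  finally show ?thesis .
qed

text \<open>A state composed with a Fejer mean is again a state, hence bounded by the norm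
  independently of N. Split s j into s j - s i and s i: the first part is small by the Cauchy
  property, the Fejer mean of the second vanishes as i grows. Only then does N tend to
  infinity.\<close>

lemma null_coefficients_null:
  assumes s: "cseq s" and z: "\<And>n x. (\<lambda>i. s i n x) \<longlonglongrightarrow> 0"
  shows "(\<lambda>i. nrm (s i)) \<longlonglongrightarrow> 0"
proof (rule LIMSEQ_I)
  fix r :: real assume r: "r > 0"
  \<comment> \<open>The numerical radius estimate loses a factor 2, and 2 e is below r.\<close>
  define e where "e = r / 3"
  have e: "e > 0" using r by (simp add: e_def)
  have sL: "s i \<in> L" for i using s by simp
  \<comment> \<open>Pointwise convergence becomes uniform because the sequence is Cauchy in a norm
    dominating all coefficients.\<close>
  have sup0: "(\<lambda>i. supn (s i n)) \<longlonglongrightarrow> 0" for n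
  proof (rule LIMSEQ_I)
    fix d :: real assume d: "d > 0"
    then obtain N where N: "\<And>i k. i \<ge> N \<Longrightarrow> k \<ge> N \<Longrightarrow> nrm (s i \<ominus> s k) < d / 2"
      using cseqD[OF s, of "d / 2"] by auto
    have le: "supn (s i n) \<le> d / 2" if i: "i \<ge> N" for i
    proof (rule supn_least)
      fix x
      have "(\<lambda>k. cmod (s i n x - s k n x)) \<longlonglongrightarrow> cmod (s i n x - 0)" by (intro tendsto_intros z)
      moreover have "cmod (s i n x - s k n x) \<le> d / 2" if "k \<ge> N" for k
        using cmod_le_nrm[of "s i \<ominus> s k" n x] N[OF i that] sL by (simp add: l1_diff_apply)
      ultimately have "cmod (s i n x - 0) \<le> d / 2" by (meson LIMSEQ_le_const2)
      then show "cmod (s i n x) \<le> d / 2" by simp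
    qed
    have ge: "0 \<le> supn (s i n)" for i using l1_CX[OF sL] by (rule supn_nonneg)
    have "norm (supn (s i n) - 0) < d" if "i \<ge> N" for i
      using le[OF that] ge[of i] d by simp
    then show "\<exists>no. \<forall>i\<ge>no. norm (supn (s i n) - 0) < d" by blast
  qed
  obtain N0 where N0: "\<And>i k. i \<ge> N0 \<Longrightarrow> k \<ge> N0 \<Longrightarrow> nrm (s i \<ominus> s k) < e"
    using cseqD[OF s e] by blast
  have le: "nrm (s j) \<le> 2 * e" if j: "j \<ge> N0" for j
  proof (rule nrm_le_numerical_radius[OF sL _ e])
    fix \<phi> assume st: "l1_state \<sigma> \<phi>"
    note phi = state_functional[OF st]
    have F: "cmod (\<phi> (mlt (fejer (Suc N)) (s j))) \<le> e" for N
    proof -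
      have stN: "l1_state \<sigma> (\<lambda>a. \<phi> (mlt (fejer (Suc N)) a))" by (intro mlt_state fejer_multiplier st) simp
      let ?b = "\<lambda>i. e + (\<Sum>k\<in>{- int (Suc N)..int (Suc N)}. supn (s i k))"
      have "?b \<longlonglongrightarrow> e + (\<Sum>k\<in>{- int (Suc N)..int (Suc N)}. 0)"
        by (intro tendsto_intros sup0)
      then have lim: "?b \<longlonglongrightarrow> e" by simp
      have "cmod (\<phi> (mlt (fejer (Suc N)) (s j))) \<le> ?b i" if i: "i \<ge> N0" for i
      proof -
        have "mlt (fejer (Suc N)) (s j) = mlt (fejer (Suc N)) (s j \<ominus> s i) \<oplus> mlt (fejer (Suc N)) (s i)"
          unfolding mlt_diff by (simp add: vec_defs)
        then have "\<phi> (mlt (fejer (Suc N)) (s j)) = \<phi> (mlt (fejer (Suc N)) (s j \<ominus> s i)) + \<phi> (mlt (fejer (Suc N)) (s i))"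
          using fejer_l1(1) sL by (simp add: phi_add[OF phi])
        then have "cmod (\<phi> (mlt (fejer (Suc N)) (s j))) \<le> cmod (\<phi> (mlt (fejer (Suc N)) (s j \<ominus> s i))) + cmod (\<phi> (mlt (fejer (Suc N)) (s i)))"
          by (simp add: norm_triangle_ineq)
        also have "\<dots> \<le> nrm (s j \<ominus> s i) + l1_norm (mlt (fejer (Suc N)) (s i))"
          using state_bound[OF stN, of "s j \<ominus> s i"] state_bound_l1[OF st fejer_l1(1)[OF sL]] sL
          by (intro add_mono) auto
        also have "\<dots> \<le> ?b i" using N0[OF j i] fejer_l1_norm_le[OF sL, of "Suc N"] by (intro add_mono) auto
        finally show ?thesis .
      qed
      with lim show ?thesis by (intro LIMSEQ_le_const[of ?b]) auto
    qed
    have "(\<lambda>N. \<phi> (mlt (fejer (Suc N)) (s j)) - \<phi> (s j)) \<longlonglongrightarrow> 0"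
    proof (rule Lim_null_comparison[OF _ fejer_converges[OF sL, of j]], intro always_eventually allI)
      fix N
      have "\<phi> (mlt (fejer (Suc N)) (s j)) - \<phi> (s j) = \<phi> (mlt (fejer (Suc N)) (s j) \<ominus> s j)"
        using fejer_l1(1)[OF sL] sL by (simp add: phi_diff[OF phi])
      then show "cmod (\<phi> (mlt (fejer (Suc N)) (s j)) - \<phi> (s j)) \<le> l1_norm (mlt (fejer (Suc N)) (s j) \<ominus> s j)"
        using state_bound_l1[OF st, of "mlt (fejer (Suc N)) (s j) \<ominus> s j"] fejer_l1(1)[OF sL] sL by simp
    qed
    from tendsto_add[OF this tendsto_const[of "\<phi> (s j)"]]
    have "(\<lambda>N. cmod (\<phi> (mlt (fejer (Suc N)) (s j)))) \<longlonglongrightarrow> cmod (\<phi> (s j))" by (simp add: tendsto_norm)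
    then show "cmod (\<phi> (s j)) \<le> e" using F by (intro LIMSEQ_le_const2) auto
  qed
  have "norm (nrm (s j) - 0) < r" if "j \<ge> N0" for j
    using le[OF that] nrm_nonneg[OF sL[of j]] r by (simp add: e_def)
  then show "\<exists>no. \<forall>j\<ge>no. norm (nrm (s j) - 0) < r" by blast
qed

lemma fourier_unique:
  assumes "A \<in> Cstar \<sigma>" "B \<in> Cstar \<sigma>" and eq: "\<And>n x. fourier n x A = fourier n x B"
  shows "A = B"
proof -
  obtain s where s: "cseq s" "A = cls s" using assms(1) by (rule Cstar_cases)
  obtain t where t: "cseq t" "B = cls t" using assms(2) by (rule Cstar_cases)
  have "(\<lambda>i. nrm (s i \<ominus> t i)) \<longlonglongrightarrow> 0"
  proof (rule null_coefficients_null)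
    show "cseq (\<lambda>i. s i \<ominus> t i)" using s t by simp
    show "(\<lambda>i. (s i \<ominus> t i) n x) \<longlonglongrightarrow> 0" for n x
      using tendsto_diff[OF fourier_cls[OF s(1), of n x] fourier_cls[OF t(1), of n x]] eq[of n x] s t
      by (simp add: l1_diff_apply)
  qed
  then show ?thesis using s t by (simp add: cls_eq_iff cs_equiv_def)
qed

section \<open>The commutant of C(X)\<close>

lemma bump:
  assumes "open U" "x \<in> U"
  shows "\<exists>f\<in>CX. f x = 1 \<and> (\<forall>y::'a. y \<notin> U \<longrightarrow> f y = 0)"
proof -
  have "normal_space (euclidean :: 'a topology)"
  proof (rule compact_Hausdorff_or_regular_imp_normal_space)
    show "compact_space (euclidean :: 'a topology)" using compact_space by (simp add: compact_space_def)
    show "Hausdorff_space (euclidean :: 'a topology) \<or> regular_space (euclidean :: 'a topology)"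
      unfolding Hausdorff_space_def disjnt_def by (auto dest!: hausdorff)
  qed
  moreover have "closedin (euclidean :: 'a topology) (- U)" "closedin (euclidean :: 'a topology) {x}" "disjnt (- U) {x}"
    using assms by (auto simp: disjnt_def)
  ultimately obtain f :: "'a \<Rightarrow> real" where f: "continuous_map euclidean euclideanreal f" "f ` (- U) \<subseteq> {0}" "f ` {x} \<subseteq> {1}"
    using Urysohn_lemma_alt by metis
  have "(\<lambda>y. complex_of_real (f y)) \<in> CX"
    using f(1) by (auto simp: CX_def intro!: continuous_intros)
  moreover have "complex_of_real (f x) = 1" "\<forall>y. y \<notin> U \<longrightarrow> complex_of_real (f y) = 0" using f(2,3) by auto
  ultimately show ?thesis by (intro bexI[of _ "\<lambda>y. complex_of_real (f y)"]) auto
qed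

lemma separate:
  assumes "x \<noteq> (y::'a)" shows "\<exists>f\<in>CX. f x = 1 \<and> f y = 0"
  using bump[of "- {y}" x] assms by (auto simp: open_Compl)

lemma Fix_iff: "x \<in> Fix \<sigma> k \<longleftrightarrow> tr k x = x"
  by (simp add: Fix_def)

lemma Fix_uminus: "x \<in> Fix \<sigma> k \<Longrightarrow> tr (- k) x = x"
  using spow_spow[of "- k" k x] by (simp add: Fix_iff)

lemma Fix_uminus_iff: "tr (- k) x = x \<longleftrightarrow> x \<in> Fix \<sigma> k"
  using Fix_uminus[of x k] Fix_uminus[of x "- k"] by (auto simp: Fix_iff)

lemma em_add: "a \<in> L \<Longrightarrow> b \<in> L \<Longrightarrow> em (a \<oplus> b) = cadd \<sigma> (em a) (em b)"
  and em_smult: "a \<in> L \<Longrightarrow> em (c \<odot> a) = csmult \<sigma> c (em a)"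
  and em_mul: "a \<in> L \<Longrightarrow> b \<in> L \<Longrightarrow> em (a \<otimes> b) = cmul \<sigma> (em a) (em b)"
  and em_star: "a \<in> L \<Longrightarrow> em (a\<dagger>) = cstar_inv \<sigma> (em a)"
  by (simp_all add: emb_def cadd_cls csmult_cls cmul_cls cstar_inv_cls)

lemma mul_coef0_right: "(a \<otimes> coef0 f) n x = a n x * f (tr (- n) x)"
  and mul_coef0_left: "(coef0 f \<otimes> a) n x = f x * a n x"
  by (simp_all add: coef0_eq_fdelta mul_fdelta_left mul_fdelta_right)

lemma fourier_mul_coef0:
  assumes A: "A \<in> Cstar \<sigma>" and f: "f \<in> CX"
  shows "fourier n x (cmul \<sigma> A (em (coef0 f))) = fourier n x A * f (tr (- n) x)"
    and "fourier n x (cmul \<sigma> (em (coef0 f)) A) = f x * fourier n x A"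
    and "cmul \<sigma> A (em (coef0 f)) \<in> Cstar \<sigma>" "cmul \<sigma> (em (coef0 f)) A \<in> Cstar \<sigma>"
proof -
  obtain s where s: "cseq s" "A = cls s" using A by (rule Cstar_cases)
  have c: "cseq (\<lambda>n. coef0 f)" using f by simp
  have 1: "cmul \<sigma> A (em (coef0 f)) = cls (\<lambda>i. s i \<otimes> coef0 f)"
    unfolding emb_def s(2) by (rule cmul_cls[OF s(1) c])
  have 2: "cmul \<sigma> (em (coef0 f)) A = cls (\<lambda>i. coef0 f \<otimes> s i)"
    unfolding emb_def s(2) by (rule cmul_cls[OF c s(1)])
  note l = fourier_cls[OF s(1), of n x, folded s(2)]
  show "fourier n x (cmul \<sigma> A (em (coef0 f))) = fourier n x A * f (tr (- n) x)"
    unfolding 1 by (rule fourier_eqI[OF cseq_mul[OF s(1) c]]) (simp add: mul_coef0_right tendsto_mult_right l)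
  show "fourier n x (cmul \<sigma> (em (coef0 f)) A) = f x * fourier n x A"
    unfolding 2 by (rule fourier_eqI[OF cseq_mul[OF c s(1)]]) (simp add: mul_coef0_left tendsto_mult_left l)
  show "cmul \<sigma> A (em (coef0 f)) \<in> Cstar \<sigma>" "cmul \<sigma> (em (coef0 f)) A \<in> Cstar \<sigma>"
    unfolding 1 2 using s c by auto
qed

text \<open>Commutation with f says that the n-th coefficient at x is annihilated by f(x) minus the
  value of f at the -n-th iterate of x. Functions separate the two points unless x is in Fix
  n.\<close>

lemma comm_star_iff:
  assumes A: "A \<in> Cstar \<sigma>"
  shows "A \<in> comm_star \<sigma> \<longleftrightarrow> (\<forall>n x. x \<notin> Fix \<sigma> n \<longrightarrow> fourier n x A = 0)"
proof
  assume "A \<in> comm_star \<sigma>"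
  then have c: "cmul \<sigma> A (em (coef0 f)) = cmul \<sigma> (em (coef0 f)) A" if "f \<in> CX" for f
    using that by (auto simp: comm_star_def CX_in_def)
  show "\<forall>n x. x \<notin> Fix \<sigma> n \<longrightarrow> fourier n x A = 0"
  proof (intro allI impI)
    fix n x assume "x \<notin> Fix \<sigma> n"
    then have "x \<noteq> tr (- n) x" using Fix_uminus_iff[of n x] by auto
    then obtain f where f: "f \<in> CX" "f x = 1" "f (tr (- n) x) = 0" using separate by blast
    then show "fourier n x A = 0"
      using c[OF f(1)] fourier_mul_coef0(1,2)[OF A f(1), of n x] by simp
  qed
next
  assume z: "\<forall>n x. x \<notin> Fix \<sigma> n \<longrightarrow> fourier n x A = 0"
  have "cmul \<sigma> A (em (coef0 f)) = cmul \<sigma> (em (coef0 f)) A" if f: "f \<in> CX" for f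
  proof (rule fourier_unique)
    fix n x
    show "fourier n x (cmul \<sigma> A (em (coef0 f))) = fourier n x (cmul \<sigma> (em (coef0 f)) A)"
      using z Fix_uminus[of x n] by (cases "x \<in> Fix \<sigma> n") (auto simp: fourier_mul_coef0[OF A f])
  qed (use fourier_mul_coef0[OF A f] in auto)
  then show "A \<in> comm_star \<sigma>" using A by (auto simp: comm_star_def CX_in_def)
qed

lemma comm_star_Cstar: "A \<in> comm_star \<sigma> \<Longrightarrow> A \<in> Cstar \<sigma>"
  by (simp add: comm_star_def)

lemma em_comm_star: "a \<in> L \<Longrightarrow> (\<And>n x. x \<notin> Fix \<sigma> n \<Longrightarrow> a n x = 0) \<Longrightarrow> em a \<in> comm_star \<sigma>"
  by (simp add: comm_star_iff fourier_em)

lemma em_coef0_comm_star: "f \<in> CX \<Longrightarrow> em (coef0 f) \<in> comm_star \<sigma>"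
  by (rule em_comm_star[OF l1_coef0]) (auto simp: coef0_def Fix_iff)

subsection \<open>Extended positive functionals\<close>

lemma csmult_Cstar: "A \<in> Cstar \<sigma> \<Longrightarrow> csmult \<sigma> c A \<in> Cstar \<sigma>"
  by (auto elim!: Cstar_cases simp: csmult_cls)

context
  fixes \<psi> assumes psi: "pos_functional \<psi>"
begin

lemma psi_cls: "cseq s \<Longrightarrow> (\<lambda>n. \<psi> (s n)) \<longlonglongrightarrow> cs_ext \<psi> (cls s)"
  by (rule cs_ext_cls[OF lipschitz_pos_functional[OF psi]])

lemma psi_eqI: "cseq s \<Longrightarrow> (\<lambda>n. \<psi> (s n)) \<longlonglongrightarrow> z \<Longrightarrow> cs_ext \<psi> (cls s) = z"
  by (rule cs_ext_eqI[OF lipschitz_pos_functional[OF psi]])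

lemma psi_em: "a \<in> L \<Longrightarrow> cs_ext \<psi> (em a) = \<psi> a"
  by (rule cs_ext_em[OF lipschitz_pos_functional[OF psi]])

lemma psi_cadd:
  assumes "A \<in> Cstar \<sigma>" "B \<in> Cstar \<sigma>"
  shows "cs_ext \<psi> (cadd \<sigma> A B) = cs_ext \<psi> A + cs_ext \<psi> B"
proof -
  obtain s where s: "cseq s" "A = cls s" using assms(1) by (rule Cstar_cases)
  obtain t where t: "cseq t" "B = cls t" using assms(2) by (rule Cstar_cases)
  show ?thesis unfolding s(2) t(2) cadd_cls[OF s(1) t(1)]
    by (rule psi_eqI) (use s t tendsto_add[OF psi_cls[OF s(1)] psi_cls[OF t(1)]] in \<open>simp_all add: phi_add[OF psi]\<close>)
qed

lemma psi_csmult: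
  assumes "A \<in> Cstar \<sigma>" shows "cs_ext \<psi> (csmult \<sigma> c A) = c * cs_ext \<psi> A"
proof -
  obtain s where s: "cseq s" "A = cls s" using assms(1) by (rule Cstar_cases)
  show ?thesis unfolding s(2) csmult_cls[OF s(1)]
    by (rule psi_eqI) (use s tendsto_mult_left[OF psi_cls[OF s(1)], of c] in \<open>simp_all add: phi_smult[OF psi]\<close>)
qed

lemma psi_cnorm:
  assumes "A \<in> Cstar \<sigma>" shows "cmod (cs_ext \<psi> A) \<le> Re (\<psi> \<e>) * cnorm \<sigma> A"
proof -
  obtain s where s: "cseq s" "A = cls s" using assms(1) by (rule Cstar_cases)
  show ?thesis unfolding s(2)
  proof (rule LIMSEQ_le)
    show "(\<lambda>n. cmod (\<psi> (s n))) \<longlonglongrightarrow> cmod (cs_ext \<psi> (cls s))" by (intro tendsto_norm psi_cls s)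
    show "(\<lambda>n. Re (\<psi> \<e>) * nrm (s n)) \<longlonglongrightarrow> Re (\<psi> \<e>) * cnorm \<sigma> (cls s)"
      by (intro tendsto_mult_left cnorm_cls s)
    show "\<exists>N. \<forall>n\<ge>N. cmod (\<psi> (s n)) \<le> Re (\<psi> \<e>) * nrm (s n)" using functional_bound[OF psi] s by auto
  qed
qed

lemma psi_cpos:
  assumes "cpos \<sigma> A" shows "Im (cs_ext \<psi> A) = 0" "0 \<le> Re (cs_ext \<psi> A)"
proof -
  obtain B where B: "B \<in> Cstar \<sigma>" "A = cmul \<sigma> (cstar_inv \<sigma> B) B" using assms by (auto simp: cpos_def)
  obtain s where s: "cseq s" "B = cls s" using B(1) by (rule Cstar_cases)
  have A: "A = cls (\<lambda>n. (s n)\<dagger> \<otimes> s n)" using B s by (simp add: cstar_inv_cls cmul_cls)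
  have l: "(\<lambda>n. \<psi> ((s n)\<dagger> \<otimes> s n)) \<longlonglongrightarrow> cs_ext \<psi> A" unfolding A using s by (intro psi_cls) simp
  have "(\<lambda>n. Im (\<psi> ((s n)\<dagger> \<otimes> s n))) \<longlonglongrightarrow> Im (cs_ext \<psi> A)" using l by (rule tendsto_Im)
  then show "Im (cs_ext \<psi> A) = 0" using phi_Im[OF psi] s by (simp add: LIMSEQ_const_iff)
  show "0 \<le> Re (cs_ext \<psi> A)"
    by (rule LIMSEQ_le_const[OF tendsto_Re[OF l]]) (use phi_Re[OF psi] s in auto)
qed

end

text \<open>A functional that attains its norm at the unit is positive. After scaling, p =
  b\<dagger> b lies between 0 and 1 in every state. The norm of p + i t for real t excludes an
  imaginary part of the value at p; the norm of 1 - p excludes a negative real part.\<close>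

lemma contractive_unital_positive:
  assumes add: "\<And>a b. a \<in> L \<Longrightarrow> b \<in> L \<Longrightarrow> \<phi> (a \<oplus> b) = \<phi> a + \<phi> b"
    and smult: "\<And>c a. a \<in> L \<Longrightarrow> \<phi> (c \<odot> a) = c * \<phi> a"
    and bound: "\<And>a. a \<in> L \<Longrightarrow> cmod (\<phi> a) \<le> r * nrm a"
    and unit: "\<phi> \<e> = of_real r" and r0: "0 \<le> r"
  shows "pos_functional \<phi>"
proof -
  have "Im (\<phi> (a\<dagger> \<otimes> a)) = 0 \<and> 0 \<le> Re (\<phi> (a\<dagger> \<otimes> a))" if a: "a \<in> L" for a
  proof -
    \<comment> \<open>The summand 1 avoids division by zero.\<close>
    define M where "M = nrm a + 1"
    have M: "M > 0" using a by (simp add: M_def add_nonneg_pos)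
    define b where "b = of_real (1 / M) \<odot> a"
    have b: "b \<in> L" using a by (simp add: b_def)
    have "nrm b \<le> (1 / M) * nrm a" using nrm_smult_le[OF a, of "of_real (1 / M)"] M by (simp add: b_def norm_divide)
    also have "\<dots> \<le> 1" using M a by (simp add: M_def)
    finally have bn: "nrm b \<le> 1" .
    define p where "p = b\<dagger> \<otimes> b"
    have p: "p \<in> L" "p\<dagger> = p" using b by (auto simp: p_def star_mul)
    have sp: "0 \<le> Re (\<rho> p)" "Re (\<rho> p) \<le> 1" "Re (\<rho> (p \<otimes> p)) \<le> Re (\<rho> p)" if s: "l1_state \<sigma> \<rho>" for \<rho>
    proof -
      note rho = state_functional[OF s]
      show "0 \<le> Re (\<rho> p)" using phi_Re[OF rho b] by (simp add: p_def)
      have "(nrm b)\<^sup>2 \<le> 1" using bn b by (simp add: power_le_one)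
      then show "Re (\<rho> p) \<le> 1" using state_le_nrm[OF b s] by (simp add: p_def)
      have "nrm (b\<dagger>) \<le> 1" using nrm_star_le[OF b] bn by simp
      then have n: "(nrm (b\<dagger>))\<^sup>2 \<le> 1" using b by (simp add: power_le_one)
      have "p \<otimes> p = b\<dagger> \<otimes> ((b\<dagger>)\<dagger> \<otimes> b\<dagger>) \<otimes> b" using b by (simp add: p_def mul_assoc)
      then have "Re (\<rho> (p \<otimes> p)) \<le> Re (\<rho> (b\<dagger> \<otimes> \<e> \<otimes> b)) * (nrm (b\<dagger>))\<^sup>2"
        using functional_le_nrm[OF phi_conj[OF rho b], of "b\<dagger>"] b by simp
      also have "\<dots> \<le> Re (\<rho> p) * 1"
        using n \<open>0 \<le> Re (\<rho> p)\<close> by (simp add: p_def mult_left_le)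
      finally show "Re (\<rho> (p \<otimes> p)) \<le> Re (\<rho> p)" by simp
    qed
    have 1: "nrm (\<e> \<ominus> p) \<le> 1"
    proof (rule nrm_least)
      fix \<rho> assume s: "l1_state \<sigma> \<rho>"
      note rho = state_functional[OF s]
      have "\<rho> ((\<e> \<ominus> p)\<dagger> \<otimes> (\<e> \<ominus> p)) = \<rho> \<e> - 2 * \<rho> p + \<rho> (p \<otimes> p)"
        using p by (simp add: expand phi_add[OF rho] phi_smult[OF rho])
      then show "Re (\<rho> ((\<e> \<ominus> p)\<dagger> \<otimes> (\<e> \<ominus> p))) \<le> 1\<^sup>2"
        using sp[OF s] s by (simp add: state_iff)
    qed simp
    \<comment> \<open>In the square the mixed terms cancel, since p is self-adjoint and i t is
      purely imaginary.\<close>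
    have 2: "nrm (p \<oplus> (\<i> * of_real t) \<odot> \<e>) \<le> sqrt (1 + t\<^sup>2)" for t :: real
    proof (rule nrm_least)
      fix \<rho> assume s: "l1_state \<sigma> \<rho>"
      note rho = state_functional[OF s]
      have cc: "(\<i> * complex_of_real t) * (\<i> * complex_of_real t) = - ((complex_of_real t)\<^sup>2)"
        by (simp add: complex_eq_iff power2_eq_square)
      have "\<rho> ((p \<oplus> (\<i> * of_real t) \<odot> \<e>)\<dagger> \<otimes> (p \<oplus> (\<i> * of_real t) \<odot> \<e>)) = \<rho> (p \<otimes> p) + of_real (t\<^sup>2) * \<rho> \<e>"
        using p cc by (simp add: expand phi_add[OF rho] phi_smult[OF rho])
      then show "Re (\<rho> ((p \<oplus> (\<i> * of_real t) \<odot> \<e>)\<dagger> \<otimes> (p \<oplus> (\<i> * of_real t) \<odot> \<e>))) \<le> (sqrt (1 + t\<^sup>2))\<^sup>2"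
        using sp[OF s] s by (simp add: state_iff)
    qed simp
    have "cmod (\<phi> p + \<i> * of_real (t * r)) \<le> r * sqrt (1 + t\<^sup>2)" for t :: real
    proof -
      have "\<phi> (p \<oplus> (\<i> * of_real t) \<odot> \<e>) = \<phi> p + \<i> * of_real (t * r)"
        using p by (simp add: add smult unit)
      then show ?thesis
        using bound[of "p \<oplus> (\<i> * of_real t) \<odot> \<e>"] p mult_left_mono[OF 2[of t] r0] by simp
    qed
    then have "(cmod (\<phi> p + \<i> * of_real (t * r)))\<^sup>2 \<le> (r * sqrt (1 + t\<^sup>2))\<^sup>2" for t :: real
      by (rule power_mono) simp
    then have "(Re (\<phi> p))\<^sup>2 + (Im (\<phi> p) + t * r)\<^sup>2 \<le> r\<^sup>2 * (1 + t\<^sup>2)" for t :: real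
      by (simp add: cmod_power2 power_mult_distrib)
    then have key: "(Im (\<phi> p) + t * r)\<^sup>2 \<le> r\<^sup>2 * (1 + t\<^sup>2)" for t :: real
      by (rule order_trans[rotated]) simp
    have im: "Im (\<phi> p) = 0"
    proof (rule ccontr)
      assume v: "Im (\<phi> p) \<noteq> 0"
      have "(Im (\<phi> p))\<^sup>2 + 2 * t * r * Im (\<phi> p) \<le> r\<^sup>2" for t
        using key[of t] by (simp add: power2_eq_square algebra_simps)
      \<comment> \<open>At this t the linear term equals the square of r, which leaves the square of
        the imaginary part at most 0.\<close>
      from this[of "r / (2 * Im (\<phi> p))"]
      have "(Im (\<phi> p))\<^sup>2 + 2 * (r / (2 * Im (\<phi> p))) * r * Im (\<phi> p) \<le> r\<^sup>2" .
      moreover have "2 * (r / (2 * Im (\<phi> p))) * r * Im (\<phi> p) = r\<^sup>2" using v by (simp add: power2_eq_square)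
      ultimately have "(Im (\<phi> p))\<^sup>2 \<le> 0" by linarith
      then show False using v by simp
    qed
    have "\<phi> (\<e> \<ominus> p) = of_real r - \<phi> p" using p by (simp add: diff_conv add smult unit)
    then have "cmod (of_real r - \<phi> p) \<le> r" using bound[of "\<e> \<ominus> p"] p 1 mult_left_mono[OF 1 r0] by simp
    then have "Re (of_real r - \<phi> p) \<le> r" using complex_Re_le_cmod order_trans by blast
    then have re: "0 \<le> Re (\<phi> p)" by simp
    have "a\<dagger> \<otimes> a = of_real (M\<^sup>2) \<odot> p"
      using M a by (simp add: p_def b_def expand) (simp add: vec_defs power2_eq_square)
    then have "\<phi> (a\<dagger> \<otimes> a) = of_real (M\<^sup>2) * \<phi> p" using p by (simp add: smult)
    then show ?thesis using im re by (simp del: of_real_power)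
  qed
  then show ?thesis using add smult by (simp add: pos_functional_def)
qed

section \<open>Projections onto the commutant\<close>

abbreviation dl :: "int \<Rightarrow> 'a l1" where "dl k \<equiv> fdelta (\<lambda>x. 1) k"

lemma fdelta_mul: "fdelta f j \<otimes> fdelta g k = fdelta (\<lambda>x. f x * g (tr (- j) x)) (j + k)"
  by (auto simp: fun_eq_iff mul_fdelta_left) (auto simp: fdelta_def)

text \<open>The vector functional of e_0 + c e_(-n) in the regular representation over the orbit of x;
  on C(X) it is a multiple of evaluation at x whenever x is in Fix n.\<close>

definition orbit_functional :: "int \<Rightarrow> 'a \<Rightarrow> complex \<Rightarrow> 'a l1 \<Rightarrow> complex" where
  "orbit_functional n x c b = tau x ((\<e> \<oplus> c \<odot> dl (- n))\<dagger> \<otimes> b \<otimes> (\<e> \<oplus> c \<odot> dl (- n)))"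

lemma orbit_functional_pos: "pos_functional (orbit_functional n x c)"
  unfolding orbit_functional_def[abs_def]
  by (rule phi_conj[OF state_functional[OF tau_state]]) simp

lemma orbit_functional_expand:
  assumes b: "b \<in> L"
  shows "orbit_functional n x c b
    = b 0 x + c * b n x + cnj c * b (- n) (tr (- n) x) + cnj c * c * b 0 (tr (- n) x)"
proof -
  have st: "(dl (- n))\<dagger> = dl n" by (simp add: star_fdelta)
  show ?thesis
    unfolding orbit_functional_def tau_def using b
    by (simp add: expand st) (simp add: l1_add_def l1_smult_def mul_fdelta_left mul_fdelta_right)
qed

text \<open>The expansion is a polynomial in c and its conjugate. Differences at c and -c remove the
  terms even in c; combining c = 1 with c = i isolates the coefficient of c.\<close>

lemma polarization:
  assumes b: "b \<in> L"
  shows "b n x = (orbit_functional n x 1 b - orbit_functional n x (- 1) b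
     - \<i> * (orbit_functional n x \<i> b - orbit_functional n x (- \<i>) b)) / 4"
  unfolding orbit_functional_expand[OF b] by (simp add: algebra_simps)

lemma fourier_polarization:
  assumes B: "B \<in> Cstar \<sigma>"
  shows "fourier n x B = (cs_ext (orbit_functional n x 1) B - cs_ext (orbit_functional n x (- 1)) B
     - \<i> * (cs_ext (orbit_functional n x \<i>) B - cs_ext (orbit_functional n x (- \<i>)) B)) / 4"
proof -
  obtain s where s: "cseq s" "B = cls s" using B by (rule Cstar_cases)
  note l = psi_cls[OF orbit_functional_pos s(1)]
  have "(\<lambda>i. (orbit_functional n x 1 (s i) - orbit_functional n x (- 1) (s i)
     - \<i> * (orbit_functional n x \<i> (s i) - orbit_functional n x (- \<i>) (s i))) / 4) \<longlonglongrightarrow>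
     (cs_ext (orbit_functional n x 1) (cls s) - cs_ext (orbit_functional n x (- 1)) (cls s)
     - \<i> * (cs_ext (orbit_functional n x \<i>) (cls s) - cs_ext (orbit_functional n x (- \<i>)) (cls s))) / 4"
    by (intro tendsto_intros l) simp
  then show ?thesis unfolding s(2)
    by (intro fourier_eqI[OF s(1)]) (simp add: polarization[OF cseq_l1[OF s(1)], symmetric])
qed

text \<open>The common consequence of the two kinds of hypotheses on E. The bound, whose constant
  may depend on the functional, is a separate clause because positivity on the dense subalgebra says
  nothing about the values of E at limits.\<close>

definition positive_contractive :: "('a cstar \<Rightarrow> 'a cstar) \<Rightarrow> bool" where
  "positive_contractive E \<longleftrightarrow> (\<forall>\<psi>. pos_functional \<psi> \<longrightarrow>
     pos_functional (\<lambda>a. cs_ext \<psi> (E (em a))) \<and>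
     (\<exists>K. \<forall>B\<in>Cstar \<sigma>. cmod (cs_ext \<psi> (E B)) \<le> K * cnorm \<sigma> B))"

lemma cnorm_nonneg: "A \<in> Cstar \<sigma> \<Longrightarrow> 0 \<le> cnorm \<sigma> A"
  by (erule Cstar_cases) (auto intro!: LIMSEQ_le_const[OF cnorm_cls])

lemma cnorm_csmult:
  assumes "A \<in> Cstar \<sigma>" shows "cnorm \<sigma> (csmult \<sigma> c A) \<le> cmod c * cnorm \<sigma> A"
proof -
  obtain s where s: "cseq s" "A = cls s" using assms by (rule Cstar_cases)
  show ?thesis unfolding s(2) csmult_cls[OF s(1)]
  proof (rule LIMSEQ_le)
    show "(\<lambda>n. nrm (c \<odot> s n)) \<longlonglongrightarrow> cnorm \<sigma> (cls (\<lambda>n. c \<odot> s n))" by (intro cnorm_cls cseq_smult s)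
    show "(\<lambda>n. cmod c * nrm (s n)) \<longlonglongrightarrow> cmod c * cnorm \<sigma> (cls s)" by (intro tendsto_mult_left cnorm_cls s)
  qed (use s nrm_smult_le in auto)
qed

section \<open>Norm one projections and positive projections under positive functionals\<close>

context
  fixes E assumes E: "is_proj_onto \<sigma> E (comm_star \<sigma>)"
begin

lemma E_comm: "A \<in> Cstar \<sigma> \<Longrightarrow> E A \<in> comm_star \<sigma>"
  using E by (auto simp: is_proj_onto_def)

lemma E_Cstar: "A \<in> Cstar \<sigma> \<Longrightarrow> E A \<in> Cstar \<sigma>"
  using E_comm comm_star_Cstar by blast

lemma E_id: "A \<in> comm_star \<sigma> \<Longrightarrow> E A = A"
proof -
  assume "A \<in> comm_star \<sigma>"
  then have "A \<in> E ` Cstar \<sigma>" using E by (simp add: is_proj_onto_def)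
  then obtain B where "B \<in> Cstar \<sigma>" "A = E B" by blast
  then show ?thesis using E by (simp add: is_proj_onto_def)
qed

lemma E_add: "A \<in> Cstar \<sigma> \<Longrightarrow> B \<in> Cstar \<sigma> \<Longrightarrow> E (cadd \<sigma> A B) = cadd \<sigma> (E A) (E B)"
  and E_smult: "A \<in> Cstar \<sigma> \<Longrightarrow> E (csmult \<sigma> c A) = csmult \<sigma> c (E A)"
  using E by (auto simp: is_proj_onto_def)

lemma E_one: "E (em \<e>) = em \<e>"
  by (intro E_id em_coef0_comm_star) simp

lemma E_functional_add:
  assumes "pos_functional \<psi>" "a \<in> L" "b \<in> L"
  shows "cs_ext \<psi> (E (em (a \<oplus> b))) = cs_ext \<psi> (E (em a)) + cs_ext \<psi> (E (em b))"
  using assms by (simp add: em_add E_add psi_cadd E_Cstar)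

lemma E_functional_smult:
  assumes "pos_functional \<psi>" "a \<in> L"
  shows "cs_ext \<psi> (E (em (c \<odot> a))) = c * cs_ext \<psi> (E (em a))"
  using assms by (simp add: em_smult E_smult psi_csmult E_Cstar)

text \<open>Homogeneity; scaling by the norm plus e also covers elements of norm 0.\<close>

lemma norm_one_contractive:
  assumes n1: "norm_one \<sigma> E" and A: "A \<in> Cstar \<sigma>"
  shows "cnorm \<sigma> (E A) \<le> cnorm \<sigma> A"
proof (rule field_le_epsilon)
  fix e :: real assume e: "e > 0"
  define r where "r = cnorm \<sigma> A + e"
  have r: "r > 0" using cnorm_nonneg[OF A] e by (simp add: r_def)
  let ?B = "csmult \<sigma> (of_real (1 / r)) A"
  have B: "?B \<in> Cstar \<sigma>" using A by (rule csmult_Cstar)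
  have "cnorm \<sigma> ?B \<le> (1 / r) * cnorm \<sigma> A" using cnorm_csmult[OF A, of "of_real (1 / r)"] r by (simp add: norm_divide)
  also have "\<dots> \<le> 1" using r e by (simp add: r_def)
  finally have 1: "cnorm \<sigma> (E ?B) \<le> 1" using n1 B by (auto simp: norm_one_def)
  obtain s where s: "cseq s" "A = cls s" using A by (rule Cstar_cases)
  have "csmult \<sigma> (of_real r) ?B = A"
    unfolding s(2) csmult_cls[OF s(1)] using s(1) r by (simp add: csmult_cls)
  then have "E A = csmult \<sigma> (of_real r) (E ?B)" using E_smult[OF B, of "of_real r"] by simp
  then have "cnorm \<sigma> (E A) \<le> r * cnorm \<sigma> (E ?B)" using cnorm_csmult[OF E_Cstar[OF B], of "of_real r"] r by simp
  also have "\<dots> \<le> r * 1" using 1 r by (intro mult_left_mono) auto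
  finally show "cnorm \<sigma> (E A) \<le> cnorm \<sigma> A + e" by (simp add: r_def)
qed

text \<open>E fixes the unit, so a positive functional composed with E attains its bound there and
  \<open>contractive_unital_positive\<close> applies.\<close>

lemma norm_one_positive_contractive:
  assumes n1: "norm_one \<sigma> E"
  shows "positive_contractive E"
  unfolding positive_contractive_def
proof (intro allI impI conjI)
  fix \<psi> assume psi: "pos_functional \<psi>"
  have b: "cmod (cs_ext \<psi> (E B)) \<le> Re (\<psi> \<e>) * cnorm \<sigma> B" if "B \<in> Cstar \<sigma>" for B
    by (rule order_trans[OF psi_cnorm[OF psi E_Cstar[OF that]]
          mult_left_mono[OF norm_one_contractive[OF n1 that] phi_one(1)[OF psi]]])
  then show "\<exists>K. \<forall>B\<in>Cstar \<sigma>. cmod (cs_ext \<psi> (E B)) \<le> K * cnorm \<sigma> B" by blast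
  show "pos_functional (\<lambda>a. cs_ext \<psi> (E (em a)))"
  proof (rule contractive_unital_positive)
    show "cs_ext \<psi> (E (em \<e>)) = of_real (Re (\<psi> \<e>))"
      unfolding E_one using phi_one(3)[OF psi] by (simp add: psi_em[OF psi])
    show "cmod (cs_ext \<psi> (E (em a))) \<le> Re (\<psi> \<e>) * nrm a" if "a \<in> L" for a
      using b[of "em a"] that by (simp add: cnorm_em)
  qed (use E_functional_add[OF psi] E_functional_smult[OF psi] phi_one(1)[OF psi] in auto)
qed

text \<open>By \<open>cseq_sqrt\<close> the unit minus h is a square in the completion, so E maps it
  to a positive element. The same for -h bounds the real value on both sides.\<close>

lemma positive_bound_selfadjoint:
  assumes pos: "positive_map \<sigma> E" and psi: "pos_functional \<psi>"
    and h: "cseq h" "\<And>n. (h n)\<dagger> = h n" "\<And>n. nrm (h n) \<le> 1"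
  shows "cmod (cs_ext \<psi> (E (cls h))) \<le> Re (\<psi> \<e>)"
proof -
  have key: "Im (cs_ext \<psi> (E (cls g))) = 0 \<and> Re (cs_ext \<psi> (E (cls g))) \<le> Re (\<psi> \<e>)"
    if g: "cseq g" "\<And>n. (g n)\<dagger> = g n" "\<And>n. nrm (g n) \<le> 1" for g
  proof -
    obtain y where y: "cseq y" "\<And>n. (y n)\<dagger> = y n" "cs_equiv (\<lambda>n. y n \<otimes> y n) (\<lambda>n. \<e> \<ominus> g n)"
      using cseq_sqrt[OF g] by blast
    have "cls (\<lambda>n. \<e> \<ominus> g n) = cls (\<lambda>n. y n \<otimes> y n)"
      using y g by (subst eq_commute) (simp add: cls_eq_iff)
    also have "\<dots> = cmul \<sigma> (cstar_inv \<sigma> (cls y)) (cls y)"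
      using y by (simp add: cstar_inv_cls cmul_cls)
    finally have "cpos \<sigma> (cls (\<lambda>n. \<e> \<ominus> g n))" using y by (auto simp: cpos_def)
    then have cp: "cpos \<sigma> (E (cls (\<lambda>n. \<e> \<ominus> g n)))" using pos g by (simp add: positive_map_def)
    have "cls (\<lambda>n. \<e> \<ominus> g n) = cadd \<sigma> (em \<e>) (csmult \<sigma> (- 1) (cls g))"
      unfolding emb_def csmult_cls[OF g(1)] using g(1) by (simp add: cadd_cls diff_conv)
    then have "E (cls (\<lambda>n. \<e> \<ominus> g n)) = cadd \<sigma> (em \<e>) (csmult \<sigma> (- 1) (E (cls g)))"
      using g(1) by (simp add: E_add E_smult csmult_Cstar E_one)
    then have "cs_ext \<psi> (E (cls (\<lambda>n. \<e> \<ominus> g n))) = \<psi> \<e> - cs_ext \<psi> (E (cls g))"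
      using g(1) by (simp add: psi_cadd[OF psi] psi_csmult[OF psi] psi_em[OF psi] csmult_Cstar E_Cstar)
    then show ?thesis using psi_cpos[OF psi cp] phi_one(2)[OF psi] by simp
  qed
  have "nrm ((- 1) \<odot> h n) \<le> 1" for n using nrm_smult_le[of "h n" "- 1"] h by (simp add: order_trans)
  then have m: "Re (cs_ext \<psi> (E (cls (\<lambda>n. (- 1) \<odot> h n)))) \<le> Re (\<psi> \<e>)"
    using h by (intro conjunct2[OF key]) (auto simp: star_smult)
  have "cs_ext \<psi> (E (cls (\<lambda>n. (- 1) \<odot> h n))) = - cs_ext \<psi> (E (cls h))"
    using h by (simp add: csmult_cls[symmetric] E_smult psi_csmult[OF psi] E_Cstar)
  with m key[OF h] show ?thesis by (simp add: cmod_eq_Re abs_le_iff)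
qed

text \<open>Positivity is immediate, boundedness is the content: an element splits into two
  self-adjoint parts, each bounded by \<open>positive_bound_selfadjoint\<close>, whence the factor
  2.\<close>

lemma positive_map_positive_contractive:
  assumes pos: "positive_map \<sigma> E"
  shows "positive_contractive E"
  unfolding positive_contractive_def
proof (intro allI impI conjI)
  fix \<psi> assume psi: "pos_functional \<psi>"
  show "pos_functional (\<lambda>a. cs_ext \<psi> (E (em a)))"
    unfolding pos_functional_def
  proof (intro conjI ballI allI)
    fix a assume a: "a \<in> L"
    then have "cpos \<sigma> (em (a\<dagger> \<otimes> a))" unfolding cpos_def by (auto simp: em_mul em_star intro!: bexI[of _ "em a"])
    then have "cpos \<sigma> (E (em (a\<dagger> \<otimes> a)))" using pos a by (simp add: positive_map_def)
    then show "Im (cs_ext \<psi> (E (em (a\<dagger> \<otimes> a)))) = 0" "0 \<le> Re (cs_ext \<psi> (E (em (a\<dagger> \<otimes> a))))"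
      using psi_cpos[OF psi] by auto
  qed (use E_functional_add[OF psi] E_functional_smult[OF psi] in auto)
  have "cmod (cs_ext \<psi> (E B)) \<le> 2 * Re (\<psi> \<e>) * cnorm \<sigma> B" if B: "B \<in> Cstar \<sigma>" for B
  proof -
    have le: "cmod (cs_ext \<psi> (E B)) \<le> 2 * Re (\<psi> \<e>) * r" if r: "r > cnorm \<sigma> B" for r
    proof -
      have r0: "r > 0" using r cnorm_nonneg[OF B] by simp
      obtain s' where s': "cseq s'" "B = cls s'" using B by (rule Cstar_cases)
      have "\<forall>\<^sub>F n in sequentially. nrm (s' n) < r"
        using cnorm_cls[OF s'(1)] r s'(2) by (simp add: order_tendstoD)
      then obtain N where N: "\<And>n. n \<ge> N \<Longrightarrow> nrm (s' n) < r" unfolding eventually_sequentially by blast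
      \<comment> \<open>Dropping finitely many terms makes the norm of every term at most r, as the
        square root construction requires.\<close>
      define s where "s n = s' (n + N)" for n
      have s: "cseq s" unfolding cs_seq_def
      proof (intro conjI allI impI)
        fix e :: real assume "e > 0"
        then obtain M where "\<And>m n. m \<ge> M \<Longrightarrow> n \<ge> M \<Longrightarrow> nrm (s' m \<ominus> s' n) < e" using cseqD[OF s'(1)] by blast
        then show "\<exists>N. \<forall>m\<ge>N. \<forall>n\<ge>N. nrm (s m \<ominus> s n) < e" unfolding s_def by (meson trans_le_add1)
      qed (use s' in \<open>simp add: s_def\<close>)
      have "cs_equiv s s'" unfolding cs_equiv_def
      proof (rule LIMSEQ_I)
        fix e :: real assume "e > 0"
        then obtain M where "\<And>m n. m \<ge> M \<Longrightarrow> n \<ge> M \<Longrightarrow> nrm (s' m \<ominus> s' n) < e" using cseqD[OF s'(1)] by blast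
        then have "norm (nrm (s n \<ominus> s' n) - 0) < e" if "n \<ge> M" for n using that s'(1) by (simp add: s_def)
        then show "\<exists>no. \<forall>n\<ge>no. norm (nrm (s n \<ominus> s' n) - 0) < e" by blast
      qed
      then have Bs: "B = cls s" using s s' by (simp add: cls_eq_iff cs_equiv_sym)
      have sr: "nrm (s n) \<le> r" for n using N[of "n + N"] by (simp add: s_def)
      have sL: "s n \<in> L" for n using s by simp
      define u v where "u n = of_real (1 / (2 * r)) \<odot> (s n \<oplus> (s n)\<dagger>)"
        and "v n = (\<i> / of_real (2 * r)) \<odot> ((s n)\<dagger> \<ominus> s n)" for n
      have uv: "cseq u" "cseq v" unfolding u_def[abs_def] v_def[abs_def] using s by auto
      have us: "(u n)\<dagger> = u n" "(v n)\<dagger> = v n" for n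
        unfolding u_def v_def using r0
        by (simp_all add: star_add star_smult diff_conv) (simp_all add: vec_defs field_simps)
      have unit: "q \<le> 1" if "q \<le> (1 / (2 * r)) * p" "p \<le> 2 * r" for p q
      proof -
        have "(1 / (2 * r)) * p \<le> (1 / (2 * r)) * (2 * r)"
          using that(2) r0 by (intro mult_left_mono) auto
        also have "(1 / (2 * r)) * (2 * r) = 1" using r0 by simp
        finally show ?thesis using that(1) by linarith
      qed
      have un: "nrm (u n) \<le> 1" for n
      proof -
        have "nrm (s n \<oplus> (s n)\<dagger>) \<le> 2 * r"
          using nrm_add[of "s n" "(s n)\<dagger>"] nrm_star_le[OF sL, of n] sr[of n] sL[of n] by simp
        moreover have "nrm (u n) \<le> (1 / (2 * r)) * nrm (s n \<oplus> (s n)\<dagger>)"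
          unfolding u_def using nrm_smult_le[of "s n \<oplus> (s n)\<dagger>" "of_real (1 / (2 * r))"] sL[of n] r0
          by (simp add: norm_divide norm_mult)
        ultimately show ?thesis by (intro unit)
      qed
      have vn: "nrm (v n) \<le> 1" for n
      proof -
        have "nrm ((s n)\<dagger> \<ominus> s n) \<le> 2 * r"
          using nrm_diff_le[of "(s n)\<dagger>" "s n"] nrm_star_le[OF sL, of n] sr[of n] sL[of n] by simp
        moreover have "nrm (v n) \<le> (1 / (2 * r)) * nrm ((s n)\<dagger> \<ominus> s n)"
          unfolding v_def using nrm_smult_le[of "(s n)\<dagger> \<ominus> s n" "\<i> / of_real (2 * r)"] sL[of n] r0
          by (simp add: norm_divide norm_mult)
        ultimately show ?thesis by (intro unit)
      qed
      have "s = (\<lambda>n. of_real r \<odot> u n \<oplus> (of_real r * \<i>) \<odot> v n)"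
        using r0 by (simp add: u_def v_def vec_defs field_simps)
      then have "B = cadd \<sigma> (csmult \<sigma> (of_real r) (cls u)) (csmult \<sigma> (of_real r * \<i>) (cls v))"
        unfolding Bs csmult_cls[OF uv(1)] csmult_cls[OF uv(2)]
          cadd_cls[OF cseq_smult[OF uv(1)] cseq_smult[OF uv(2)]] by (rule arg_cong)
      then have "cs_ext \<psi> (E B) = of_real r * cs_ext \<psi> (E (cls u)) + of_real r * \<i> * cs_ext \<psi> (E (cls v))"
        using uv by (simp add: E_add E_smult csmult_Cstar psi_cadd[OF psi] psi_csmult[OF psi] E_Cstar)
      then have "cmod (cs_ext \<psi> (E B)) \<le> r * cmod (cs_ext \<psi> (E (cls u))) + r * cmod (cs_ext \<psi> (E (cls v)))"
        using norm_triangle_ineq[of "of_real r * cs_ext \<psi> (E (cls u))" "of_real r * \<i> * cs_ext \<psi> (E (cls v))"] r0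
        by (simp add: norm_mult)
      also have "\<dots> \<le> r * Re (\<psi> \<e>) + r * Re (\<psi> \<e>)"
        using positive_bound_selfadjoint[OF pos psi uv(1) us(1) un] positive_bound_selfadjoint[OF pos psi uv(2) us(2) vn] r0
        by (intro add_mono mult_left_mono) auto
      finally show ?thesis by (simp add: algebra_simps)
    qed
    \<comment> \<open>The estimate holds for every r above the norm of B; now r decreases to
      it.\<close>
    have l: "((\<lambda>r. 2 * Re (\<psi> \<e>) * r) \<longlongrightarrow> 2 * Re (\<psi> \<e>) * cnorm \<sigma> B) (at_right (cnorm \<sigma> B))"
      by (intro tendsto_intros)
    show ?thesis
      by (rule tendsto_lowerbound[OF l])
        (use le in \<open>auto simp: eventually_at_filter intro!: always_eventually\<close>)
  qed
  then show "\<exists>K. \<forall>B\<in>Cstar \<sigma>. cmod (cs_ext \<psi> (E B)) \<le> K * cnorm \<sigma> B" by blast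
qed

end

lemma Cstar_c00_cases:
  assumes "A \<in> Cstar \<sigma>"
  obtains b where "cseq b" "\<And>i. b i \<in> c00 \<sigma>" "A = cls b"
proof -
  obtain s where s: "cseq s" "A = cls s" using assms by (rule Cstar_cases)
  have sL: "s i \<in> L" for i using s by simp
  have "\<exists>b. b \<in> c00 \<sigma> \<and> l1_norm (s i \<ominus> b) \<le> inverse (real (Suc i))" for i
    using c00_approx[OF sL, of "inverse (real (Suc i))"] by auto
  then obtain b where b: "\<And>i. b i \<in> c00 \<sigma>" "\<And>i. l1_norm (s i \<ominus> b i) \<le> inverse (real (Suc i))"
    by metis
  have bL: "b i \<in> L" for i using b(1) by (rule c00_l1)
  have nb: "nrm (s i \<ominus> b i) \<le> inverse (real (Suc i))" for i
    using nrm_le_l1_norm[of "s i \<ominus> b i"] b(2)[of i] sL bL by simp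
  have eq: "cs_equiv s b"
    unfolding cs_equiv_def
    by (rule tendsto_sandwich[OF _ _ tendsto_const LIMSEQ_inverse_real_of_nat]) (use nb sL bL in auto)
  have "cseq b" unfolding cs_seq_def
  proof (intro conjI allI impI)
    fix e :: real assume e: "e > 0"
    then have e3: "e / 3 > 0" by simp
    obtain N1 where N1: "\<And>m n. m \<ge> N1 \<Longrightarrow> n \<ge> N1 \<Longrightarrow> nrm (s m \<ominus> s n) < e / 3" using cseqD[OF s(1) e3] by blast
    have "\<forall>\<^sub>F i in sequentially. nrm (s i \<ominus> b i) < e / 3"
      using eq e3 unfolding cs_equiv_def by (rule order_tendstoD)
    then obtain N2 where N2: "\<And>i. i \<ge> N2 \<Longrightarrow> nrm (s i \<ominus> b i) < e / 3" unfolding eventually_sequentially by blast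
    have "nrm (b m \<ominus> b n) < e" if "m \<ge> max N1 N2" "n \<ge> max N1 N2" for m n
      using nrm_diff_triangle[of "b m" "s m" "b n"] nrm_diff_triangle[of "s m" "s n" "b n"]
        nrm_diff_commute[of "b m" "s m"] bL sL N1[of m n] N2[of m] N2[of n] that by simp
    then show "\<exists>N. \<forall>m\<ge>N. \<forall>n\<ge>N. nrm (b m \<ominus> b n) < e" by blast
  qed (rule bL)
  moreover from this have "A = cls b" using s eq by (simp add: cls_eq_iff)
  ultimately show ?thesis using b(1) that by blast
qed

lemma orbit_functional_coef0:
  assumes "x \<in> Fix \<sigma> n" "h \<in> CX" "h x = 0"
  shows "orbit_functional n x c (coef0 h) = 0"
  unfolding orbit_functional_expand[OF l1_coef0[OF assms(2)]]
  using assms(3) Fix_uminus[OF assms(1)] by (simp add: coef0_def)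

lemma coef0_mul: "coef0 f \<otimes> coef0 g = coef0 (\<lambda>x. f x * g x)"
  by (auto simp: coef0_eq_fdelta fdelta_mul)

lemma fourier_cadd:
  assumes "A \<in> Cstar \<sigma>" "B \<in> Cstar \<sigma>"
  shows "fourier n x (cadd \<sigma> A B) = fourier n x A + fourier n x B"
proof -
  obtain s where s: "cseq s" "A = cls s" using assms(1) by (rule Cstar_cases)
  obtain t where t: "cseq t" "B = cls t" using assms(2) by (rule Cstar_cases)
  show ?thesis unfolding s(2) t(2) cadd_cls[OF s(1) t(1)]
  proof (rule fourier_eqI)
    show "cseq (\<lambda>i. s i \<oplus> t i)" using s t by simp
    show "(\<lambda>i. (s i \<oplus> t i) n x) \<longlonglongrightarrow> fourier n x (cls s) + fourier n x (cls t)"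
      unfolding l1_add_def by (intro tendsto_add fourier_cls s t)
  qed
qed

section \<open>Fourier coefficients of an arbitrary projection\<close>

context
  fixes E assumes E: "is_proj_onto \<sigma> E (comm_star \<sigma>)" and pc: "positive_contractive E"
begin

lemma E_module_functional:
  assumes x: "x \<in> Fix \<sigma> n" and f: "f \<in> CX" and y: "y \<in> L"
  shows "cs_ext (orbit_functional n x c) (E (em (y \<otimes> coef0 f))) = f x * cs_ext (orbit_functional n x c) (E (em y))"
    and "cs_ext (orbit_functional n x c) (E (em (coef0 f \<otimes> y))) = f x * cs_ext (orbit_functional n x c) (E (em y))"
proof -
  define \<phi> where "\<phi> a = cs_ext (orbit_functional n x c) (E (em a))" for a
  have phi: "pos_functional \<phi>"
    using pc orbit_functional_pos unfolding positive_contractive_def \<phi>_def[abs_def] by blast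
  \<comment> \<open>Removing the constant f(x) leaves a function vanishing at x, which the
    functional cannot see on either side of y.\<close>
  define g where "g = (\<lambda>z. f z - f x)"
  have g: "g \<in> CX" using f by (simp add: g_def CX_diff)
  have gx: "g x = 0" by (simp add: g_def)
  \<comment> \<open>C(X) lies in the commutant, so E fixes it and the orbit functional itself is
    evaluated.\<close>
  have phi0: "\<phi> (coef0 h) = 0" if "h \<in> CX" "h x = 0" for h
    unfolding \<phi>_def using that x
    by (simp add: E_id[OF E] em_coef0_comm_star psi_em[OF orbit_functional_pos] orbit_functional_coef0)
  have z: "\<phi> ((coef0 g)\<dagger> \<otimes> coef0 g) = 0" "\<phi> (coef0 g \<otimes> (coef0 g)\<dagger>) = 0"
    unfolding star_coef0 coef0_mul using g by (auto intro!: phi0 CX_mult CX_cnj simp: gx)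
  have yg: "\<phi> (y \<otimes> coef0 g) = 0"
    using phi_Cauchy_Schwarz[OF phi, of "coef0 g" "y\<dagger>"] y g z by simp
  have gy: "\<phi> (coef0 g \<otimes> y) = 0"
    using phi_Cauchy_Schwarz[OF phi, of y "(coef0 g)\<dagger>"] y g z by simp
  have "y \<otimes> coef0 f = y \<otimes> coef0 g \<oplus> f x \<odot> y" "coef0 f \<otimes> y = coef0 g \<otimes> y \<oplus> f x \<odot> y"
    by (simp_all add: fun_eq_iff l1_add_def l1_smult_def mul_coef0_right mul_coef0_left g_def algebra_simps)
  then have "\<phi> (y \<otimes> coef0 f) = f x * \<phi> y" "\<phi> (coef0 f \<otimes> y) = f x * \<phi> y"
    using yg gy y g by (simp_all add: phi_add[OF phi] phi_smult[OF phi])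
  then show "cs_ext (orbit_functional n x c) (E (em (y \<otimes> coef0 f))) = f x * cs_ext (orbit_functional n x c) (E (em y))"
    "cs_ext (orbit_functional n x c) (E (em (coef0 f \<otimes> y))) = f x * cs_ext (orbit_functional n x c) (E (em y))"
    by (simp_all add: \<phi>_def)
qed

lemma E_module:
  assumes x: "x \<in> Fix \<sigma> n" and f: "f \<in> CX" and y: "y \<in> L"
  shows "fourier n x (E (em (y \<otimes> coef0 f))) = f x * fourier n x (E (em y))"
    and "fourier n x (E (em (coef0 f \<otimes> y))) = f x * fourier n x (E (em y))"
proof -
  have C: "E (em (y \<otimes> coef0 f)) \<in> Cstar \<sigma>" "E (em (coef0 f \<otimes> y)) \<in> Cstar \<sigma>" "E (em y) \<in> Cstar \<sigma>"
    using f y by (auto intro!: E_Cstar[OF E])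
  show "fourier n x (E (em (y \<otimes> coef0 f))) = f x * fourier n x (E (em y))"
    "fourier n x (E (em (coef0 f \<otimes> y))) = f x * fourier n x (E (em y))"
    unfolding fourier_polarization[OF C(1)] fourier_polarization[OF C(2)] fourier_polarization[OF C(3)]
      E_module_functional[OF x f y] by (simp_all add: algebra_simps)
qed

text \<open>f delta^k is also delta^k times f composed with the k-th iterate of \<sigma>; the left
  and right module rules at x therefore give two values for the same coefficient.\<close>

lemma E_fdelta_eq:
  assumes x: "x \<in> Fix \<sigma> n" and f: "f \<in> CX"
  shows "fourier n x (E (em (fdelta f k))) = f x * fourier n x (E (em (dl k)))"
    and "f x * fourier n x (E (em (dl k))) = f (tr k x) * fourier n x (E (em (dl k)))"
proof -
  have f': "(\<lambda>z. f (tr k z)) \<in> CX" using f by (rule CX_spow)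
  have "fdelta f k = coef0 f \<otimes> dl k" "fdelta f k = dl k \<otimes> coef0 (\<lambda>z. f (tr k z))"
    by (simp_all add: coef0_eq_fdelta fdelta_mul)
  then show "fourier n x (E (em (fdelta f k))) = f x * fourier n x (E (em (dl k)))"
    "f x * fourier n x (E (em (dl k))) = f (tr k x) * fourier n x (E (em (dl k)))"
    using E_module(2)[OF x f, of "dl k"] E_module(1)[OF x f', of "dl k"] by simp_all
qed

lemma E_delta: "fourier n x (E (em (dl k))) = (if n = k then chi \<sigma> k x else 0)"
proof -
  let ?G = "\<lambda>n x. fourier n x (E (em (dl k)))"
  have EC: "E (em (dl k)) \<in> comm_star \<sigma>" "E (em (dl k)) \<in> Cstar \<sigma>" by (auto intro!: E_comm[OF E] E_Cstar[OF E])
  have 1: "?G n x = 0" if "x \<notin> Fix \<sigma> n" for n x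
    using comm_star_iff[OF EC(2)] EC(1) that by blast
  \<comment> \<open>Here f takes different values at x and at its k-th iterate, so the two module
    rules contradict each other unless the coefficient is 0.\<close>
  have 2: "?G n x = 0" if "x \<notin> Fix \<sigma> k" for n x
  proof (cases "x \<in> Fix \<sigma> n")
    case True
    have "x \<noteq> tr k x" using that by (auto simp: Fix_iff)
    then obtain f where f: "f \<in> CX" "f x = 1" "f (tr k x) = 0" using separate by blast
    then show ?thesis using E_fdelta_eq(2)[OF True f(1), of k] by simp
  qed (rule 1)
  \<comment> \<open>A bump function inside the interior puts f delta^k into the commutant, where E
    is the identity; the module rule transfers this to delta^k.\<close>
  have 3: "?G n x = (if n = k then 1 else 0)" if xU: "x \<in> interior (Fix \<sigma> k)" for n x
  proof -
    have xk: "x \<in> Fix \<sigma> k" using xU interior_subset by blast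
    obtain f where f: "f \<in> CX" "f x = 1" "\<And>y. y \<notin> interior (Fix \<sigma> k) \<Longrightarrow> f y = 0"
      using bump[OF open_interior xU] by blast
    have "em (fdelta f k) \<in> comm_star \<sigma>"
    proof (rule em_comm_star)
      fix m y assume "y \<notin> Fix \<sigma> m"
      then show "fdelta f k m y = 0" using f(3)[of y] interior_subset by (auto simp: fdelta_def)
    qed (use f in simp)
    then have e: "fourier n x (E (em (fdelta f k))) = fdelta f k n x"
      using f(1) by (simp add: E_id[OF E] fourier_em)
    show ?thesis
    proof (cases "x \<in> Fix \<sigma> n")
      case True
      then show ?thesis using E_fdelta_eq(1)[OF True f(1), of k] e f(2) by (simp add: fdelta_def)
    next
      case False
      then show ?thesis using 1[OF False] xk by auto
    qed
  qed
  \<comment> \<open>The set where the coefficient is nonzero is open and lies in Fix k, hence in its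
    interior.\<close>
  have 4: "?G n x = 0" if "x \<notin> interior (Fix \<sigma> k)" for n x
  proof (rule ccontr)
    assume nz: "?G n x \<noteq> 0"
    have "open {z. ?G n z \<noteq> 0}"
    proof -
      have "continuous_on UNIV (?G n)" by (rule fourier_continuous[OF EC(2)])
      then have "open (?G n -` (- {0}))" by (intro open_vimage) auto
      then show ?thesis by (simp add: vimage_def)
    qed
    moreover have "{z. ?G n z \<noteq> 0} \<subseteq> Fix \<sigma> k" using 2 by blast
    ultimately have "{z. ?G n z \<noteq> 0} \<subseteq> interior (Fix \<sigma> k)" by (rule interior_maximal[rotated])
    then show False using nz that by blast
  qed
  show ?thesis using 3[of x n] 4[of x n] by (auto simp: chi_def)
qed

lemma interior_Fix_closed: "closed (interior (Fix \<sigma> k))"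
proof -
  have "continuous_on UNIV (\<lambda>x. fourier k x (E (em (dl k))))"
    by (rule fourier_continuous) (auto intro!: E_Cstar[OF E])
  then have "continuous_on UNIV (chi \<sigma> k)" unfolding E_delta by simp
  then have "closed (chi \<sigma> k -` {1})" by (intro closed_vimage) auto
  moreover have "chi \<sigma> k -` {1} = interior (Fix \<sigma> k)" by (auto simp: chi_def split: if_splits)
  ultimately show ?thesis by simp
qed

lemma E_fdelta: 
  assumes f: "f \<in> CX"
  shows "fourier n x (E (em (fdelta f k))) = chi \<sigma> n x * fdelta f k n x"
proof (cases "x \<in> Fix \<sigma> n")
  case True
  show ?thesis unfolding E_fdelta_eq(1)[OF True f] E_delta by (simp add: fdelta_def)
next
  case False
  then have "chi \<sigma> n x = 0" using interior_subset by (auto simp: chi_def)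
  moreover have "fourier n x (E (em (fdelta f k))) = 0"
    using False f comm_star_iff[OF E_Cstar[OF E], of "em (fdelta f k)"] E_comm[OF E, of "em (fdelta f k)"] by simp
  ultimately show ?thesis by simp
qed

lemma E_c00:
  assumes a: "a \<in> c00 \<sigma>"
  shows "fourier n x (E (em a)) = chi \<sigma> n x * a n x"
proof -
  define S where "S = {k. a k \<noteq> (\<lambda>x. 0)}"
  have S: "finite S" "\<And>k. k \<notin> S \<Longrightarrow> a k = (\<lambda>x. 0)" and aL: "a \<in> L"
    using a by (auto simp: S_def c00_def)
  have "(\<lambda>m y. \<Sum>k\<in>T. fdelta (a k) k m y) \<in> L \<and>
      fourier n x (E (em (\<lambda>m y. \<Sum>k\<in>T. fdelta (a k) k m y))) = chi \<sigma> n x * (\<Sum>k\<in>T. fdelta (a k) k n x)"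
    if "finite T" for T
    using that
  proof (induction T rule: finite_induct)
    case empty
    have "em (\<lambda>m y. 0) \<in> comm_star \<sigma>" by (rule em_comm_star) auto
    then show ?case by (simp add: E_id[OF E] fourier_em)
  next
    case (insert k T)
    let ?s = "\<lambda>m y. \<Sum>k\<in>T. fdelta (a k) k m y"
    have eq: "(\<lambda>m y. \<Sum>k\<in>insert k T. fdelta (a k) k m y) = fdelta (a k) k \<oplus> ?s"
      using insert by (simp add: l1_add_def)
    have f: "a k \<in> CX" using aL by (rule l1_CX)
    then have "fourier n x (E (em (fdelta (a k) k \<oplus> ?s))) = fourier n x (E (em (fdelta (a k) k))) + fourier n x (E (em ?s))"
      using insert by (simp add: em_add E_add[OF E] fourier_cadd E_Cstar[OF E])
    then show ?case unfolding eq using insert f by (simp add: E_fdelta algebra_simps)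
  qed
  from this[OF S(1)] have "fourier n x (E (em (\<lambda>m y. \<Sum>k\<in>S. fdelta (a k) k m y))) = chi \<sigma> n x * (\<Sum>k\<in>S. fdelta (a k) k n x)"
    by blast
  moreover have "(\<Sum>k\<in>S. fdelta (a k) k m y) = a m y" for m y
    using S by (cases "m \<in> S") (auto simp: fdelta_def)
  ultimately show ?thesis by simp
qed

text \<open>Continuity of E in norm is not at hand, so convergence is tested under orbit
  functionals, where \<open>positive_contractive\<close> supplies a bound, and polarization returns
  to coefficients.\<close>

lemma E_fourier:
  assumes A: "A \<in> Cstar \<sigma>"
  shows "fourier n x (E A) = chi \<sigma> n x * fourier n x A"
proof -
  obtain b where b: "cseq b" "\<And>i. b i \<in> c00 \<sigma>" "A = cls b" using Cstar_c00_cases[OF A] by blast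
  have bL: "b i \<in> L" for i using b(1) by simp
  have lim: "(\<lambda>i. cs_ext \<psi> (E (em (b i)))) \<longlonglongrightarrow> cs_ext \<psi> (E A)" if psi: "pos_functional \<psi>" for \<psi>
  proof -
    obtain K where K: "\<And>B. B \<in> Cstar \<sigma> \<Longrightarrow> cmod (cs_ext \<psi> (E B)) \<le> K * cnorm \<sigma> B"
      using pc psi unfolding positive_contractive_def by blast
    let ?D = "\<lambda>i. cls (\<lambda>j. b j \<ominus> b i)"
    have D: "?D i \<in> Cstar \<sigma>" for i using b(1) bL by simp
    have cn: "(\<lambda>i. cnorm \<sigma> (?D i)) \<longlonglongrightarrow> 0"
    proof (rule LIMSEQ_I)
      fix e :: real assume e: "e > 0"
      then obtain N where N: "\<And>m n. m \<ge> N \<Longrightarrow> n \<ge> N \<Longrightarrow> nrm (b m \<ominus> b n) < e / 2"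
        using cseqD[OF b(1), of "e / 2"] by auto
      have "norm (cnorm \<sigma> (?D i) - 0) < e" if i: "i \<ge> N" for i
      proof -
        have "(\<lambda>j. nrm (b j \<ominus> b i)) \<longlonglongrightarrow> cnorm \<sigma> (?D i)" using b(1) bL by (intro cnorm_cls) simp
        then have "cnorm \<sigma> (?D i) \<le> e / 2"
          by (rule LIMSEQ_le_const2) (use N[OF _ i] in \<open>auto intro!: exI[of _ N] less_imp_le\<close>)
        then show ?thesis using cnorm_nonneg[OF D[of i]] e by simp
      qed
      then show "\<exists>no. \<forall>i\<ge>no. norm (cnorm \<sigma> (?D i) - 0) < e" by blast
    qed
    have "cs_ext \<psi> (E A) - cs_ext \<psi> (E (em (b i))) = cs_ext \<psi> (E (?D i))" for i
    proof -
      have "?D i = cadd \<sigma> A (csmult \<sigma> (- 1) (em (b i)))"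
        unfolding b(3) emb_def csmult_cls[OF cseq_const[OF bL]] using b(1) bL by (simp add: cadd_cls diff_conv)
      then show ?thesis using A bL
        by (simp add: E_add[OF E] E_smult[OF E] csmult_Cstar psi_cadd[OF psi] psi_csmult[OF psi] E_Cstar[OF E])
    qed
    then have "(\<lambda>i. cs_ext \<psi> (E A) - cs_ext \<psi> (E (em (b i)))) \<longlonglongrightarrow> 0"
      by (intro Lim_null_comparison[OF _ tendsto_mult_left[OF cn, of K, simplified]]) (simp add: K D)
    from tendsto_diff[OF tendsto_const[of "cs_ext \<psi> (E A)"] this] show ?thesis by simp
  qed
  have "(\<lambda>i. fourier n x (E (em (b i)))) \<longlonglongrightarrow> fourier n x (E A)"
    unfolding fourier_polarization[OF E_Cstar[OF E em_Cstar[OF bL]]] fourier_polarization[OF E_Cstar[OF E A]]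
    by (intro tendsto_intros lim orbit_functional_pos) simp
  moreover have "(\<lambda>i. chi \<sigma> n x * b i n x) \<longlonglongrightarrow> chi \<sigma> n x * fourier n x A"
    unfolding b(3) by (intro tendsto_mult_left fourier_cls b(1))
  ultimately show ?thesis unfolding E_c00[OF b(2)] by (rule LIMSEQ_unique)
qed

end

section \<open>The conditional expectation when the interiors are clopen\<close>

abbreviation "U k \<equiv> interior (Fix \<sigma> k)"

lemma U_0 [simp]: "U 0 = UNIV"
  by (simp add: Fix_def)

lemma U_uminus: "U (- k) = U k"
proof -
  have "Fix \<sigma> (- k) = Fix \<sigma> k" using Fix_uminus_iff by (auto simp: Fix_iff)
  then show ?thesis by simp
qed

text \<open>Together with \<open>U_0\<close> and \<open>U_uminus\<close>: for fixed x, the indices k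
  with x in \<open>U k\<close> form a subgroup of the integers.\<close>

lemma U_add: "x \<in> U j \<Longrightarrow> x \<in> U k \<Longrightarrow> x \<in> U (j + k)"
proof -
  assume x: "x \<in> U j" "x \<in> U k"
  have "U j \<inter> U k \<subseteq> Fix \<sigma> (j + k)"
  proof
    fix y assume "y \<in> U j \<inter> U k"
    then have "y \<in> Fix \<sigma> j" "y \<in> Fix \<sigma> k" using interior_subset by auto
    then show "y \<in> Fix \<sigma> (j + k)" by (simp add: Fix_iff spow_add del: spow_spow)
  qed
  then have "U j \<inter> U k \<subseteq> U (j + k)" by (intro interior_maximal) auto
  then show ?thesis using x by blast
qed

lemma U_diff: "x \<in> U j \<Longrightarrow> x \<in> U k \<Longrightarrow> x \<in> U (j - k)"
  using U_add[of x j "- k"] U_uminus[of k] by simp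

text \<open>Powers of \<sigma> commute, so Fix k is invariant under them, and preimages of open sets
  stay open.\<close>

lemma U_spow_imp: "tr j x \<in> U k \<Longrightarrow> x \<in> U k"
proof -
  assume x: "tr j x \<in> U k"
  have "open (tr j -` U k)" by (rule open_vimage[OF open_interior continuous_spow])
  moreover have "tr j -` U k \<subseteq> Fix \<sigma> k"
  proof
    fix y assume "y \<in> tr j -` U k"
    then have "tr j y \<in> Fix \<sigma> k" using interior_subset by auto
    then have "tr k (tr j y) = tr j y" by (simp add: Fix_iff)
    then have "tr (- j) (tr k (tr j y)) = tr (- j) (tr j y)" by (rule arg_cong)
    then show "y \<in> Fix \<sigma> k" by (simp add: Fix_iff)
  qed
  ultimately have "tr j -` U k \<subseteq> U k" by (rule interior_maximal[rotated])
  then show ?thesis using x by blast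
qed

lemma U_spow: "tr j x \<in> U k \<longleftrightarrow> x \<in> U k"
  using U_spow_imp[of j x k] U_spow_imp[of "- j" "tr j x" k] by auto

lemma chi_spow [simp]: "chi \<sigma> k (tr j x) = chi \<sigma> k x"
  by (simp add: chi_def U_spow)

text \<open>If k lies in the subgroup belonging to x, then n and n - k lie in it together.\<close>

lemma chi_cocycle: "chi \<sigma> n x * chi \<sigma> k x = chi \<sigma> k x * chi \<sigma> (n - k) x"
  using U_diff[of x n k] U_add[of x "n - k" k] by (auto simp: chi_def)

lemma chi_idem [simp]: "chi \<sigma> k x * (chi \<sigma> k x * z) = chi \<sigma> k x * z"
  by (simp add: chi_def)

lemma cnj_chi [simp]: "cnj (chi \<sigma> k x) = chi \<sigma> k x"
  by (simp add: chi_def)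

lemma chi_outside: "x \<notin> Fix \<sigma> k \<Longrightarrow> chi \<sigma> k x = 0"
  using interior_subset[of "Fix \<sigma> k"] by (auto simp: chi_def)

lemma chi_absorb:
  assumes c: "continuous_on UNIV g" and z: "\<And>x. x \<notin> Fix \<sigma> n \<Longrightarrow> g x = 0"
  shows "chi \<sigma> n x * g x = g x"
proof (cases "g x = 0")
  case False
  have "open (g -` (- {0}))" using c by (intro open_vimage) auto
  moreover have "g -` (- {0}) \<subseteq> Fix \<sigma> n" using z by auto
  ultimately have "g -` (- {0}) \<subseteq> U n" by (rule interior_maximal[rotated])
  then have "x \<in> U n" using False by auto
  then show ?thesis by (simp add: chi_def)
qed simp

abbreviation "Phi \<equiv> mlt (chi \<sigma>)"

lemma Phi_idem: "Phi (Phi a) = Phi a"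
  by (simp add: mlt_def)

lemma Phi_star: "Phi (a\<dagger>) = (Phi a)\<dagger>"
  by (auto simp: mlt_def l1_star_def chi_def fun_eq_iff U_spow U_uminus)

text \<open>Termwise this is \<open>chi_cocycle\<close>; invariance of \<open>chi\<close> along
  orbits permits evaluation of all its factors at x.\<close>

lemma Phi_left_module: "Phi (Phi a \<otimes> b) = Phi a \<otimes> Phi b"
proof (intro ext)
  fix n x
  have "Phi (Phi a \<otimes> b) n x = infsum (\<lambda>k. chi \<sigma> n x * (chi \<sigma> k x * a k x * b (n - k) (tr (- k) x))) UNIV"
    by (simp add: mlt_def l1_mult_def infsum_cmult_right')
  also have "\<dots> = infsum (\<lambda>k. chi \<sigma> k x * a k x * (chi \<sigma> (n - k) x * b (n - k) (tr (- k) x))) UNIV"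
  proof (rule infsum_cong)
    fix k
    have "chi \<sigma> n x * (chi \<sigma> k x * a k x * b (n - k) (tr (- k) x))
        = (chi \<sigma> n x * chi \<sigma> k x) * (a k x * b (n - k) (tr (- k) x))" by (simp only: ac_simps)
    also have "\<dots> = (chi \<sigma> k x * chi \<sigma> (n - k) x) * (a k x * b (n - k) (tr (- k) x))"
      by (simp only: chi_cocycle[of n x k])
    also have "\<dots> = chi \<sigma> k x * a k x * (chi \<sigma> (n - k) x * b (n - k) (tr (- k) x))"
      by (simp only: ac_simps)
    finally show "chi \<sigma> n x * (chi \<sigma> k x * a k x * b (n - k) (tr (- k) x)) =
       chi \<sigma> k x * a k x * (chi \<sigma> (n - k) x * b (n - k) (tr (- k) x))" .
  qed
  also have "\<dots> = (Phi a \<otimes> Phi b) n x" by (simp add: mlt_def l1_mult_def)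
  finally show "Phi (Phi a \<otimes> b) n x = (Phi a \<otimes> Phi b) n x" .
qed

lemma Phi_right_module: "Phi (a \<otimes> Phi b) = Phi a \<otimes> Phi b"
proof -
  have "Phi (b\<dagger>) \<otimes> a\<dagger> = (a \<otimes> Phi b)\<dagger>" by (simp add: Phi_star star_mul)
  then have "Phi (a \<otimes> Phi b) = (Phi (Phi (b\<dagger>) \<otimes> a\<dagger>))\<dagger>" by (simp only: Phi_star star_star)
  also have "\<dots> = Phi a \<otimes> Phi b" unfolding Phi_left_module by (simp add: Phi_star star_mul)
  finally show ?thesis .
qed

section \<open>Clopen interiors: positivity and contractivity of multiplication by
  \<open>chi\<close>\<close>

context
  assumes clopen: "\<And>k. closed (U k)"
begin

lemma chi_CX [simp]: "chi \<sigma> k \<in> CX"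
proof -
  have "continuous_on UNIV (chi \<sigma> k)"
    unfolding continuous_on_open_vimage[OF open_UNIV]
  proof (intro allI impI)
    fix B :: "complex set"
    have "chi \<sigma> k -` B \<inter> UNIV = (if 1 \<in> B then U k else {}) \<union> (if 0 \<in> B then - U k else {})"
      by (auto simp: chi_def split: if_splits)
    then show "open (chi \<sigma> k -` B \<inter> UNIV)" using clopen[of k] by (auto simp: open_Compl)
  qed
  then show ?thesis by (simp add: CX_def)
qed

text \<open>At a point x, the relation "x in \<open>U (j - i)\<close>" partitions S into classes.
  The Gram factor g t i is the indicator of t being the least element of the class of i, so the sum
  over t is 1 exactly when i and j share a class.\<close>

lemma chi_multiplier: "pd_multiplier (chi \<sigma>)"
  unfolding pd_multiplier_def
proof (intro conjI allI impI)
  show "chi \<sigma> k \<in> CX" for k by simp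
  show "cmod (chi \<sigma> k x) \<le> 1" for k x by (simp add: chi_def)
  show "chi \<sigma> 0 x = 1" for x by (simp add: chi_def)
  fix S :: "int set" assume S: "finite S"
  \<comment> \<open>Being the least element of the class is written as a polynomial in the functions
    \<open>chi\<close>, so that continuity and invariance along orbits are inherited.\<close>
  define g :: "int \<Rightarrow> int \<Rightarrow> 'a \<Rightarrow> complex"
    where "g t i x = chi \<sigma> (t - i) x * (\<Prod>s\<in>{s\<in>S. s < t}. 1 - chi \<sigma> (s - i) x)" for t i x
  have gc: "g t i \<in> CX" for t i
  proof -
    have "continuous_on UNIV (chi \<sigma> j)" for j using chi_CX[of j] by (simp add: CX_def)
    then have "continuous_on UNIV (\<lambda>x. chi \<sigma> (t - i) x * (\<Prod>s\<in>{s\<in>S. s < t}. 1 - chi \<sigma> (s - i) x))"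
      by (intro continuous_intros)
    then show ?thesis by (simp add: CX_def g_def[abs_def])
  qed
  define first where "first i x = Min {s\<in>S. x \<in> U (s - i)}" for i x
  have fst: "first i x \<in> S" "x \<in> U (first i x - i)" "\<And>s. s \<in> S \<Longrightarrow> x \<in> U (s - i) \<Longrightarrow> first i x \<le> s"
    if "i \<in> S" for i x
  proof -
    have fin: "finite {s\<in>S. x \<in> U (s - i)}" using S by simp
    have "i \<in> {s\<in>S. x \<in> U (s - i)}" using that by simp
    then have "first i x \<in> {s\<in>S. x \<in> U (s - i)}" unfolding first_def by (intro Min_in fin) blast
    then show "first i x \<in> S" "x \<in> U (first i x - i)" by auto
    show "first i x \<le> s" if "s \<in> S" "x \<in> U (s - i)" for s
      unfolding first_def using that by (intro Min_le fin) simp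
  qed
  have gv: "g t i x = (if t = first i x then 1 else 0)" if "t \<in> S" "i \<in> S" for t i x
  proof (cases "t = first i x")
    case True
    have "1 - chi \<sigma> (s - i) x = 1" if "s \<in> {s\<in>S. s < t}" for s
    proof -
      have "x \<notin> U (s - i)" using fst(3)[OF \<open>i \<in> S\<close>, of s x] that True by auto
      then show ?thesis by (simp add: chi_def)
    qed
    moreover have "chi \<sigma> (t - i) x = 1" using fst(2)[OF \<open>i \<in> S\<close>, of x] True by (simp add: chi_def)
    ultimately show ?thesis using True by (simp add: g_def)
  next
    case False
    show ?thesis
    proof (cases "x \<in> U (t - i)")
      case True
      then have "first i x < t" using fst(3)[OF \<open>i \<in> S\<close> \<open>t \<in> S\<close>, of x] False by simp
      moreover have "1 - chi \<sigma> (first i x - i) x = 0" using fst(2)[OF \<open>i \<in> S\<close>, of x] by (simp add: chi_def)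
      \<comment> \<open>The factor at s = \<open>first i x\<close> is 0.\<close>
      ultimately have "(\<Prod>s\<in>{s\<in>S. s < t}. 1 - chi \<sigma> (s - i) x) = 0"
        using S fst(1)[OF \<open>i \<in> S\<close>, of x] by (intro prod_zero) auto
      then show ?thesis using False by (simp add: g_def)
    next
      case F: False
      then show ?thesis using False by (simp add: g_def chi_def)
    qed
  qed
  have "chi \<sigma> (j - i) x = (\<Sum>t\<in>S. g t i x * g t j x)" if ij: "i \<in> S" "j \<in> S" for i j x
  proof -
    have "(\<Sum>t\<in>S. g t i x * g t j x) = (\<Sum>t\<in>S. if t = first i x then (if first i x = first j x then 1 else 0) else 0)"
      by (rule sum.cong) (use ij in \<open>auto simp: gv\<close>)
    also have "\<dots> = (if first i x = first j x then 1 else 0)" using S fst(1)[OF ij(1)] by simp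
    also have "\<dots> = chi \<sigma> (j - i) x"
    proof (cases "x \<in> U (j - i)")
      case True
      have "x \<in> U (s - i) \<longleftrightarrow> x \<in> U (s - j)" for s
        using U_diff[OF _ True, of "s - i"] U_add[OF _ True, of "s - j"] by auto
      then have "first i x = first j x" by (simp add: first_def)
      then show ?thesis using True by (simp add: chi_def)
    next
      case False
      have "first i x \<noteq> first j x"
      proof
        assume "first i x = first j x"
        then have "x \<in> U ((first i x - i) - (first i x - j))"
          using U_diff[of x "first i x - i" "first i x - j"] fst(2)[OF ij(1), of x] fst(2)[OF ij(2), of x] by simp
        then show False using False by simp
      qed
      then show ?thesis using False by (simp add: chi_def)
    qed
    finally show ?thesis by simp
  qed
  moreover have "g t i (tr k x) = g t i x" "cnj (g t i x) = g t i x" for t i k x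
    by (simp_all add: g_def)
  ultimately have "gram_factor (chi \<sigma>) S S g" using S gc by (simp add: gram_factor_def)
  then show "\<exists>T g. gram_factor (chi \<sigma>) S T g" by blast
qed

lemma Phi_l1 [simp]: "a \<in> L \<Longrightarrow> Phi a \<in> L"
  by (rule mlt_l1(1)) (auto simp: chi_def)

text \<open>The Schwarz inequality for an expectation: with w = a - Phi a, the module rules give Phi
  (w\<dagger> w) = Phi (a\<dagger> a) - (Phi a)\<dagger> (Phi a), which states see as nonnegative. A
  state composed with Phi is again a state.\<close>

lemma Phi_contractive: "a \<in> L \<Longrightarrow> nrm (Phi a) \<le> nrm a"
proof (rule nrm_least)
  fix \<phi> assume a: "a \<in> L" and s: "l1_state \<sigma> \<phi>"
  note phi = state_functional[OF s]
  note sP = mlt_state[OF chi_multiplier s]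
  note phiP = state_functional[OF sP]
  let ?w = "a \<ominus> Phi a"
  have "Phi (?w\<dagger> \<otimes> ?w) = Phi (a\<dagger> \<otimes> a) \<ominus> (Phi a)\<dagger> \<otimes> Phi a"
  proof -
    have eq: "?w\<dagger> \<otimes> ?w = ((a\<dagger> \<otimes> a \<ominus> a\<dagger> \<otimes> Phi a) \<ominus> Phi (a\<dagger>) \<otimes> a) \<oplus> Phi (a\<dagger>) \<otimes> Phi a"
      unfolding Phi_star using a by (simp add: expand) (simp add: vec_defs)
    show ?thesis
      unfolding eq mlt_add mlt_diff Phi_left_module Phi_right_module
      by (simp add: Phi_star Phi_idem) (simp add: vec_defs)
  qed
  moreover have "0 \<le> Re (\<phi> (Phi (?w\<dagger> \<otimes> ?w)))" using phi_Re[OF phiP, of ?w] a by simp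
  ultimately have "Re (\<phi> ((Phi a)\<dagger> \<otimes> Phi a)) \<le> Re (\<phi> (Phi (a\<dagger> \<otimes> a)))"
    using a by (simp add: phi_diff[OF phi])
  also have "\<dots> \<le> (nrm a)\<^sup>2" using state_le_nrm[OF a sP] .
  finally show "Re (\<phi> ((Phi a)\<dagger> \<otimes> Phi a)) \<le> (nrm a)\<^sup>2" .
qed simp

section \<open>The expectation on the completion and its properties\<close>

definition expect :: "'a cstar \<Rightarrow> 'a cstar" where
  "expect A = cls (\<lambda>n. Phi (rep A n))"

lemma Phi_diff_le: "a \<in> L \<Longrightarrow> b \<in> L \<Longrightarrow> nrm (Phi a \<ominus> Phi b) \<le> nrm (a \<ominus> b)"
  unfolding mlt_diff[symmetric] by (rule Phi_contractive) simp

lemma cseq_Phi [simp]: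
  assumes s: "cseq s" shows "cseq (\<lambda>n. Phi (s n))"
proof (rule cseqI[OF s s, of _ 1])
  fix m n
  show "nrm (Phi (s m) \<ominus> Phi (s n)) \<le> 1 * (nrm (s m \<ominus> s n) + nrm (s m \<ominus> s n))"
    using Phi_diff_le[of "s m" "s n"] s by (simp add: order_trans[OF _ mult_right_mono[of 1 2, simplified]])
qed (use s in auto)

lemma expect_cls:
  assumes s: "cseq s" shows "expect (cls s) = cls (\<lambda>n. Phi (s n))"
proof -
  note r = rep_cls[OF s]
  have "cs_equiv (\<lambda>n. Phi (rep (cls s) n)) (\<lambda>n. Phi (s n))"
    unfolding cs_equiv_def
    by (rule tendsto_sandwich[OF _ _ tendsto_const r(2)[unfolded cs_equiv_def]])
      (use r(1) s Phi_diff_le in auto)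
  then show ?thesis unfolding expect_def using r(1) s by (simp add: cls_eq_iff)
qed

lemma expect_Cstar: "A \<in> Cstar \<sigma> \<Longrightarrow> expect A \<in> Cstar \<sigma>"
  by (erule Cstar_cases) (simp add: expect_cls)

lemma expect_em: "a \<in> L \<Longrightarrow> expect (em a) = em (Phi a)"
  unfolding emb_def by (simp add: expect_cls)

lemma fourier_expect:
  assumes "A \<in> Cstar \<sigma>" shows "fourier n x (expect A) = chi \<sigma> n x * fourier n x A"
proof -
  obtain s where s: "cseq s" "A = cls s" using assms by (rule Cstar_cases)
  have "(\<lambda>i. Phi (s i) n x) \<longlonglongrightarrow> chi \<sigma> n x * fourier n x (cls s)"
    unfolding mlt_def by (intro tendsto_mult_left fourier_cls s)
  then show ?thesis unfolding s(2) expect_cls[OF s(1)] by (rule fourier_eqI[OF cseq_Phi[OF s(1)]])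
qed

lemma expect_comm_star: "A \<in> Cstar \<sigma> \<Longrightarrow> expect A \<in> comm_star \<sigma>"
  by (simp add: comm_star_iff expect_Cstar fourier_expect chi_outside)

lemma expect_id:
  assumes "A \<in> comm_star \<sigma>" shows "expect A = A"
proof (rule fourier_unique)
  have A: "A \<in> Cstar \<sigma>" using assms by (rule comm_star_Cstar)
  show "expect A \<in> Cstar \<sigma>" "A \<in> Cstar \<sigma>" using A by (auto simp: expect_Cstar)
  show "fourier n x (expect A) = fourier n x A" for n x
    unfolding fourier_expect[OF A] using comm_star_iff[OF A] assms
    by (intro chi_absorb fourier_continuous A) auto
qed

lemma expect_proj: "is_proj_onto \<sigma> expect (comm_star \<sigma>)"
  unfolding is_proj_onto_def
proof (intro conjI ballI allI)
  fix A B assume "A \<in> Cstar \<sigma>" "B \<in> Cstar \<sigma>"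
  then obtain s t where "cseq s" "A = cls s" "cseq t" "B = cls t" by (metis Cstar_cases)
  then show "expect (cadd \<sigma> A B) = cadd \<sigma> (expect A) (expect B)"
    by (simp add: cadd_cls expect_cls mlt_add)
next
  fix c A assume "A \<in> Cstar \<sigma>"
  then obtain s where "cseq s" "A = cls s" by (rule Cstar_cases)
  then show "expect (csmult \<sigma> c A) = csmult \<sigma> c (expect A)"
    by (simp add: csmult_cls expect_cls mlt_smult)
next
  show "expect (expect A) = expect A" if "A \<in> Cstar \<sigma>" for A
    using that by (intro expect_id expect_comm_star)
  show "expect ` Cstar \<sigma> = comm_star \<sigma>"
    using expect_comm_star expect_id comm_star_Cstar by (metis (no_types, lifting) image_iff subsetI subset_antisym)
qed

lemma expect_norm_one: "norm_one \<sigma> expect"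
  unfolding norm_one_def
proof (intro conjI ballI impI allI)
  fix A assume A: "A \<in> Cstar \<sigma>" "cnorm \<sigma> A \<le> 1"
  obtain s where s: "cseq s" "A = cls s" using A(1) by (rule Cstar_cases)
  have "cnorm \<sigma> (expect A) \<le> cnorm \<sigma> A"
    unfolding s(2) expect_cls[OF s(1)]
    by (rule LIMSEQ_le[OF cnorm_cls[OF cseq_Phi[OF s(1)]] cnorm_cls[OF s(1)]])
      (use s Phi_contractive in auto)
  then show "cnorm \<sigma> (expect A) \<le> 1" using A(2) by simp
next
  fix e :: real assume "e > 0"
  moreover have "cnorm \<sigma> (expect (em \<e>)) = 1"
    by (simp add: expect_id em_coef0_comm_star cnorm_em nrm_one)
  moreover have "cnorm \<sigma> (em \<e>) = 1" by (simp add: cnorm_em nrm_one)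
  ultimately show "\<exists>A\<in>Cstar \<sigma>. cnorm \<sigma> A \<le> 1 \<and> 1 - e < cnorm \<sigma> (expect A)"
    by (intro bexI[of _ "em \<e>"]) auto
qed

text \<open>The images p of squares are nonnegative in every state, but \<open>cpos\<close> demands
  a square. With M a norm bound for p, the element h = 1 - p / M has norm at most 1, so p = M (1 -
  h) is the square of the root of 1 - h scaled by the square root of M.\<close>

lemma expect_positive: "positive_map \<sigma> expect"
  unfolding positive_map_def
proof (intro ballI impI)
  fix A assume "A \<in> Cstar \<sigma>" "cpos \<sigma> A"
  then obtain B where "B \<in> Cstar \<sigma>" and AB: "A = cmul \<sigma> (cstar_inv \<sigma> B) B" by (auto simp: cpos_def)
  then obtain b where b: "cseq b" "B = cls b" by (auto elim: Cstar_cases)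
  have A: "A = cls (\<lambda>n. (b n)\<dagger> \<otimes> b n)" using AB b by (simp add: cstar_inv_cls cmul_cls)
  define p where "p n = Phi ((b n)\<dagger> \<otimes> b n)" for n
  have p: "cseq p" unfolding p_def[abs_def] using b by simp
  have pL: "p n \<in> L" for n using p by simp
  have ps: "(p n)\<dagger> = p n" for n by (simp add: p_def Phi_star[symmetric] star_mul)
  have EA: "expect A = cls p" unfolding A p_def[abs_def] using b by (simp add: expect_cls)
  obtain M where M: "M > 0" "\<And>n. nrm (p n) \<le> M" using cseq_bounded[OF p] by blast
  define h where "h n = \<e> \<ominus> of_real (1 / M) \<odot> p n" for n
  have h: "cseq h" unfolding h_def[abs_def] using p by simp
  have hL: "h n \<in> L" for n using h by simp
  have hs: "(h n)\<dagger> = h n" for n unfolding h_def by (simp add: star_diff[symmetric] star_smult ps)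
  have hn: "nrm (h n) \<le> 1" for n
  proof (rule nrm_selfadjoint_le[OF hL hs])
    fix \<phi> assume s: "l1_state \<sigma> \<phi>"
    note phi = state_functional[OF s]
    have "0 \<le> Re (\<phi> (p n))"
      unfolding p_def using phi_Re[OF state_functional[OF mlt_state[OF chi_multiplier s]], of "b n"] b by simp
    moreover have "Re (\<phi> (p n)) \<le> M"
      using complex_Re_le_cmod[of "\<phi> (p n)"] state_bound[OF s pL[of n]] M(2)[of n] by linarith
    moreover have "\<phi> (h n) = 1 - of_real (1 / M) * \<phi> (p n)"
      unfolding h_def using pL[of n] s by (simp add: phi_diff[OF phi] phi_smult[OF phi] state_iff)
    then have "Re (\<phi> (h n)) = 1 - Re (\<phi> (p n)) / M" by simp
    moreover have "0 \<le> t / M \<and> t / M \<le> 1" if "0 \<le> t" "t \<le> M" for t using that M(1) by simp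
    ultimately show "\<bar>Re (\<phi> (h n))\<bar> \<le> 1" by (smt (verit))
  qed
  obtain y where y: "cseq y" "\<And>n. (y n)\<dagger> = y n" "cs_equiv (\<lambda>n. y n \<otimes> y n) (\<lambda>n. \<e> \<ominus> h n)"
    using cseq_sqrt[OF h hs hn] by blast
  define C where "C = cls (\<lambda>n. of_real (sqrt M) \<odot> y n)"
  have C: "C \<in> Cstar \<sigma>" using y by (simp add: C_def)
  have sq: "complex_of_real (sqrt M) * complex_of_real (sqrt M) = of_real M"
    using M(1) by (simp flip: of_real_mult)
  have "cmul \<sigma> (cstar_inv \<sigma> C) C = cls (\<lambda>n. of_real M \<odot> (y n \<otimes> y n))"
    unfolding C_def using y(1,2) by (simp add: cstar_inv_cls cmul_cls star_smult mul_smult_left mul_smult_right sq)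
  also have "\<dots> = csmult \<sigma> (of_real M) (cls (\<lambda>n. y n \<otimes> y n))" using y(1) by (simp add: csmult_cls)
  also have "cls (\<lambda>n. y n \<otimes> y n) = cls (\<lambda>n. \<e> \<ominus> h n)" using y h by (simp add: cls_eq_iff)
  also have "csmult \<sigma> (of_real M) \<dots> = cls (\<lambda>n. of_real M \<odot> (\<e> \<ominus> h n))" using h by (simp add: csmult_cls)
  also have "(\<lambda>n. of_real M \<odot> (\<e> \<ominus> h n)) = p" using M(1) by (simp add: h_def vec_defs)
  finally show "cpos \<sigma> (expect A)" unfolding EA cpos_def using C by auto
qed

text \<open>As \<open>chi\<close> at index 0 is 1, a zero image forces the coefficient of A = lim
  b\<dagger> b at 0 to vanish. Cauchy-Schwarz for \<open>tau x\<close> bounds every other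
  coefficient by that one.\<close>

lemma expect_faithful: "faithful_map \<sigma> expect"
  unfolding faithful_map_def
proof (intro ballI impI)
  fix A assume A: "A \<in> Cstar \<sigma>" and "cpos \<sigma> A \<and> expect A = czero \<sigma>"
  then have z: "expect A = em (\<lambda>k x. 0)" and "cpos \<sigma> A" by (auto simp: czero_def)
  then obtain B where "B \<in> Cstar \<sigma>" and AB: "A = cmul \<sigma> (cstar_inv \<sigma> B) B" by (auto simp: cpos_def)
  then obtain b where b: "cseq b" "B = cls b" by (auto elim: Cstar_cases)
  have bL: "b i \<in> L" for i using b by simp
  have Ab: "A = cls (\<lambda>n. (b n)\<dagger> \<otimes> b n)" using AB b by (simp add: cstar_inv_cls cmul_cls)
  have bb: "cseq (\<lambda>n. (b n)\<dagger> \<otimes> b n)" using b by simp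
  obtain M where M: "M > 0" "\<And>n. nrm (b n) \<le> M" using cseq_bounded[OF b(1)] by blast
  have "fourier n x A = 0" for n x
  proof -
    note phi = state_functional[OF tau_state[of x]]
    have "fourier 0 x A = 0"
      using fourier_expect[OF A, of 0 x] z by (simp add: fourier_em chi_def)
    then have "(\<lambda>i. ((b i)\<dagger> \<otimes> b i) 0 x) \<longlonglongrightarrow> 0" using fourier_cls[OF bb, of 0 x] Ab by simp
    from tendsto_Re[OF this] have "(\<lambda>i. Re (tau x ((b i)\<dagger> \<otimes> b i))) \<longlonglongrightarrow> 0" by (simp add: tau_def)
    from tendsto_mult_left[OF this, of "M\<^sup>2"]
    have l: "(\<lambda>i. M\<^sup>2 * Re (tau x ((b i)\<dagger> \<otimes> b i))) \<longlonglongrightarrow> 0" by simp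
    have "(\<lambda>i. (cmod (((b i)\<dagger> \<otimes> b i) n x))\<^sup>2) \<longlonglongrightarrow> 0"
    proof (rule tendsto_sandwich[OF _ _ tendsto_const l])
      have "(cmod (((b i)\<dagger> \<otimes> b i) n x))\<^sup>2 \<le> M\<^sup>2 * Re (tau x ((b i)\<dagger> \<otimes> b i))" for i
      proof -
        \<comment> \<open>The shift brings coefficient n of b\<dagger> b to index 0, as the mixed
          term of b and ?c under \<open>tau x\<close>.\<close>
        let ?c = "b i \<otimes> dl (- n)"
        have cL: "?c \<in> L" using bL by simp
        have "supn (\<lambda>x::'a. 1) \<le> 1" by (rule supn_least) simp
        then have dn: "nrm (dl (- n)) \<le> 1" using nrm_fdelta[of "\<lambda>x. 1" "- n"] by simp
        have "nrm ?c \<le> nrm (b i) * nrm (dl (- n))" using bL by (intro nrm_mul) auto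
        also have "\<dots> \<le> M * 1" using M dn by (intro mult_mono) auto
        finally have "(nrm ?c)\<^sup>2 \<le> M\<^sup>2" using cL by (intro power_mono) auto
        then have cM: "Re (tau x (?c\<dagger> \<otimes> ?c)) \<le> M\<^sup>2" using state_le_nrm[OF cL tau_state[of x]] by linarith
        have "((b i)\<dagger> \<otimes> b i) n x = tau x ((b i)\<dagger> \<otimes> ?c)"
          using bL by (simp add: mul_assoc[symmetric]) (simp add: tau_def mul_fdelta_right)
        then have "(cmod (((b i)\<dagger> \<otimes> b i) n x))\<^sup>2 \<le> Re (tau x (?c\<dagger> \<otimes> ?c)) * Re (tau x ((b i)\<dagger> \<otimes> b i))"
          using phi_Cauchy_Schwarz[OF phi cL bL[of i]] by simp
        also have "\<dots> \<le> M\<^sup>2 * Re (tau x ((b i)\<dagger> \<otimes> b i))"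
          using cM phi_Re[OF phi bL[of i]] by (rule mult_right_mono)
        finally show ?thesis .
      qed
      then show "\<forall>\<^sub>F i in sequentially. (cmod (((b i)\<dagger> \<otimes> b i) n x))\<^sup>2 \<le> M\<^sup>2 * Re (tau x ((b i)\<dagger> \<otimes> b i))"
        by (intro always_eventually allI)
    qed simp
    from tendsto_real_sqrt[OF this] have "(\<lambda>i. ((b i)\<dagger> \<otimes> b i) n x) \<longlonglongrightarrow> 0"
      by (simp add: tendsto_norm_zero_iff)
    then show ?thesis unfolding Ab by (rule fourier_eqI[OF bb])
  qed
  then show "A = czero \<sigma>"
    unfolding czero_def using A by (intro fourier_unique) (auto simp: fourier_em)
qed

lemma expect_bimodule: "bimodule_map \<sigma> expect (comm_star \<sigma>)"
  unfolding bimodule_map_def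
proof (intro ballI)
  fix A B Y assume AB: "A \<in> comm_star \<sigma>" "B \<in> comm_star \<sigma>" and Y: "Y \<in> Cstar \<sigma>"
  obtain a where a: "cseq a" "A = cls a" using comm_star_Cstar[OF AB(1)] by (rule Cstar_cases)
  obtain b where b: "cseq b" "B = cls b" using comm_star_Cstar[OF AB(2)] by (rule Cstar_cases)
  obtain y where y: "cseq y" "Y = cls y" using Y by (rule Cstar_cases)
  \<comment> \<open>Elements of the commutant are fixed by \<open>expect\<close>, so they have
    representatives in the range of \<open>Phi\<close>, to which the module rules apply term by
    term.\<close>
  have A: "A = cls (\<lambda>n. Phi (a n))" using expect_id[OF AB(1)] a by (simp add: expect_cls)
  have B: "B = cls (\<lambda>n. Phi (b n))" using expect_id[OF AB(2)] b by (simp add: expect_cls)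
  show "expect (cmul \<sigma> (cmul \<sigma> A Y) B) = cmul \<sigma> (cmul \<sigma> A (expect Y)) B"
    unfolding A B y(2) using a(1) b(1) y(1)
    by (simp add: cmul_cls expect_cls Phi_left_module Phi_right_module)
qed

lemma expect_c00: "expect ` (em ` c00 \<sigma>) = em ` comm00 \<sigma>"
proof -
  have 1: "Phi a \<in> comm00 \<sigma>" if a: "a \<in> c00 \<sigma>" for a
  proof -
    have "{k. Phi a k \<noteq> (\<lambda>x. 0)} \<subseteq> {k. a k \<noteq> (\<lambda>x. 0)}" by (auto simp: mlt_def)
    moreover have "finite {k. a k \<noteq> (\<lambda>x. 0)}" using a by (simp add: c00_def)
    ultimately have "finite {k. Phi a k \<noteq> (\<lambda>x. 0)}" by (rule finite_subset)
    then have c: "Phi a \<in> c00 \<sigma>" using c00_l1[OF a] by (simp add: c00_def)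
    have "Phi a \<otimes> coef0 f = coef0 f \<otimes> Phi a" for f
    proof (intro ext)
      fix n x
      show "(Phi a \<otimes> coef0 f) n x = (coef0 f \<otimes> Phi a) n x"
        unfolding mul_coef0_left mul_coef0_right mlt_def
        using Fix_uminus[of x n] chi_outside[of x n] by (cases "x \<in> Fix \<sigma> n") auto
    qed
    with c show ?thesis by (simp add: comm00_def)
  qed
  have 2: "Phi a = a" if a: "a \<in> comm00 \<sigma>" for a
  proof (intro ext)
    fix n x
    have aL: "a \<in> L" using a by (auto simp: comm00_def c00_def)
    have z: "a n y = 0" if "y \<notin> Fix \<sigma> n" for y
    proof -
      have "y \<noteq> tr (- n) y" using that Fix_uminus_iff[of n y] by auto
      then obtain f where f: "f \<in> CX" "f y = 1" "f (tr (- n) y) = 0" using separate by blast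
      have "a \<otimes> coef0 f = coef0 f \<otimes> a" using a f(1) by (simp add: comm00_def)
      then have "(a \<otimes> coef0 f) n y = (coef0 f \<otimes> a) n y" by simp
      then show ?thesis using f by (simp add: mul_coef0_left mul_coef0_right)
    qed
    have "continuous_on UNIV (a n)" using l1_CX[OF aL, of n] by (simp add: CX_def)
    from chi_absorb[OF this z] show "Phi a n x = a n x" by (simp add: mlt_def)
  qed
  show ?thesis
  proof (intro equalityI subsetI)
    fix A assume "A \<in> expect ` (em ` c00 \<sigma>)"
    then obtain a where "a \<in> c00 \<sigma>" "A = expect (em a)" by blast
    then have "A = em (Phi a)" "Phi a \<in> comm00 \<sigma>" using 1 c00_l1 by (auto simp: expect_em)
    then show "A \<in> em ` comm00 \<sigma>" by blast
  next
    fix A assume "A \<in> em ` comm00 \<sigma>"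
    then obtain a where a: "a \<in> comm00 \<sigma>" "A = em a" by blast
    then have c: "a \<in> c00 \<sigma>" by (simp add: comm00_def)
    then have "expect (em a) = A" using 2[OF a(1)] a(2) c00_l1[OF c] by (simp add: expect_em)
    then show "A \<in> expect ` (em ` c00 \<sigma>)" using c by blast
  qed
qed

lemma expect_unique:
  assumes E: "is_proj_onto \<sigma> E (comm_star \<sigma>)" and pc: "positive_contractive E" and A: "A \<in> Cstar \<sigma>"
  shows "E A = expect A"
  by (rule fourier_unique) (simp_all add: A E_Cstar[OF E] expect_Cstar E_fourier[OF E pc] fourier_expect)

end

end

text \<open>\<open>is_proj_onto\<close> constrains a map only on \<open>Cstar \<sigma>\<close>, so
  uniqueness is expressed as agreement there.\<close>

theorem theorem5p4:
  fixes \<sigma> :: "'a::t2_space \<Rightarrow> 'a"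
  assumes "compact (UNIV :: 'a set)"
    and "homeomorphism UNIV UNIV \<sigma> (inv \<sigma>)"
  defines "P1 \<equiv> (\<forall>k::int. closed (interior (Fix \<sigma> k)))"
    and "P2 \<equiv> (\<lambda>E. is_proj_onto \<sigma> E (comm_star \<sigma>) \<and> norm_one \<sigma> E)"
    and "P3 \<equiv> (\<lambda>E. is_proj_onto \<sigma> E (comm_star \<sigma>) \<and> positive_map \<sigma> E)"
  shows "(P1 \<longleftrightarrow> (\<exists>E. P2 E)) \<and> (P1 \<longleftrightarrow> (\<exists>E. P3 E)) \<and>
    (P1 \<longrightarrow> (\<exists>E'. (\<forall>E. P2 E \<or> P3 E \<longrightarrow> (\<forall>A \<in> Cstar \<sigma>. E A = E' A)) \<and>
       (\<forall>l \<in> c00 \<sigma>. E' (emb \<sigma> l) = emb \<sigma> (\<lambda>k x. chi \<sigma> k x * l k x)) \<and>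
       is_proj_onto \<sigma> E' (comm_star \<sigma>) \<and>
       faithful_map \<sigma> E' \<and> positive_map \<sigma> E' \<and> norm_one \<sigma> E' \<and>
       bimodule_map \<sigma> E' (comm_star \<sigma>) \<and>
       E' ` (emb \<sigma> ` c00 \<sigma>) = emb \<sigma> ` comm00 \<sigma>))"
proof -
  interpret dynamical_system \<sigma> using assms(1,2) by unfold_locales
  \<comment> \<open>Both kinds of projection enter the remaining argument only through
    \<open>positive_contractive\<close>, so one proof of closedness and uniqueness serves for (2)
    and (3).\<close>
  have pc: "is_proj_onto \<sigma> E (comm_star \<sigma>) \<and> positive_contractive E" if "P2 E \<or> P3 E" for E
    using that norm_one_positive_contractive[of E] positive_map_positive_contractive[of E]
    by (auto simp: P2_def P3_def)
  have closed_if: "P1" if "P2 E \<or> P3 E" for E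
    using pc[OF that] interior_Fix_closed[of E] by (auto simp: P1_def)
  have fwd: "(\<forall>E. P2 E \<or> P3 E \<longrightarrow> (\<forall>A \<in> Cstar \<sigma>. E A = expect A)) \<and>
       (\<forall>l \<in> c00 \<sigma>. expect (emb \<sigma> l) = emb \<sigma> (\<lambda>k x. chi \<sigma> k x * l k x)) \<and>
       is_proj_onto \<sigma> expect (comm_star \<sigma>) \<and>
       faithful_map \<sigma> expect \<and> positive_map \<sigma> expect \<and> norm_one \<sigma> expect \<and>
       bimodule_map \<sigma> expect (comm_star \<sigma>) \<and>
       expect ` (emb \<sigma> ` c00 \<sigma>) = emb \<sigma> ` comm00 \<sigma>" if "P1"
  proof -
    have cl: "closed (interior (Fix \<sigma> k))" for k using that by (simp add: P1_def)
    have "expect (em l) = em (\<lambda>k x. chi \<sigma> k x * l k x)" if "l \<in> c00 \<sigma>" for l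
      using expect_em[OF cl c00_l1[OF that]] by (simp add: mlt_def)
    then show ?thesis
      using pc expect_unique[OF cl] expect_proj[OF cl] expect_faithful[OF cl] expect_positive[OF cl]
        expect_norm_one[OF cl] expect_bimodule[OF cl] expect_c00[OF cl] by blast
  qed
  have P23: "P2 expect" "P3 expect" if "P1" using fwd[OF that] by (auto simp: P2_def P3_def)
  show ?thesis
  proof (intro conjI impI)
    show "P1 \<longleftrightarrow> (\<exists>E. P2 E)" "P1 \<longleftrightarrow> (\<exists>E. P3 E)" using closed_if P23 by blast+
  qed (rule exI, rule fwd)
qed

end
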